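(* Let $N\ge 1$, $m\geq 2$, let $T_1,\dots,T_m$ be non-singular linear contractions on $\mathbb{R}^N$, and let $\mu$ be the Bernoulli measure on $I_\infty=\{1,\dots,m\}^{\mathbb{N}}$ with probabilities $p_1,\dots,p_m>0$, $\sum_{i=1}^m p_i=1$. Let $\Omega$ be a space of families $\omega=\{\omega_{\mathbf{i}}:\mathbf{i}\in I\}$ of translation vectors in $\mathbb{R}^N$ such that, for some non-empty compact set $B\subset\mathbb{R}^N$, $T_{i_k}(B)+\omega_{i_1,\dots,i_k}\subseteq B$ for all $k\ge1$, all $(i_1,\dots,i_k)\in I_k$ and all $\omega\in\Omega$; let $\mathsf{P}$ be a probability measure on $\Omega$ such that the random vectors $\omega_{\mathbf{i}}$ are jointly measurable, and let $\mathsf{E}$ denote expectation with respect to $\mathsf{P}$. Let $\mu^\omega$ be the projection of $\mu$ onto the almost self-affine set $E^\omega$. Suppose that there are numbers $0\le s<\min\{d_1,N\}$ arbitrarily close to $\min\{d_1,N\}$ for each of which there exists $c<\infty$ such that $$\mathsf{E}\left(|x^\omega(\mathbf{i})-x^\omega(\mathbf{j})|^{-s}\right)\le\frac{c}{\phi^s(T_{\mathbf{i}\wedge\mathbf{j}})}\qquad(\mathbf{i}\ne\mathbf{j}\in I_\infty).$$ Then, for $\mathsf{P}$-almost all $\omega$, the measure $\mu^\omega$ is exact dimensional, with $$\lim_{r\to0}\frac{\log\mu^\omega(B(x,r))}{\log r}=D^1(\mu^\omega)=\min\{d_1,N\}$$ for $\mu^\omega$-almost all $x$ (in particular the limit ex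ists).
   Context: A linear contraction is a linear map of Euclidean operator norm less than $1$. $B(x,r)$ is the closed ball with centre $x$ and radius $r$. Code space: $I_k=\{1,\dots,m\}^k$, $I=\bigcup_{k\ge0}I_k$, $I_\infty=\{1,\dots,m\}^{\mathbb{N}}$; for $\mathbf{i}\in I$, $|\mathbf{i}|$ is its length and $C_{\mathbf{i}}\subset I_\infty$ is the cylinder of all infinite sequences beginning with $\mathbf{i}$. For $\mathbf{i}\neq\mathbf{j}\in I_\infty$, $\mathbf{i}\wedge\mathbf{j}\in I$ is their maximal common initial subsequence. The Bernoulli measure $\mu$ is the Borel probability measure on $I_\infty$ with $\mu(C_{\mathbf{i}})=p_{i_1}\cdots p_{i_k}$ for $\mathbf{i}=(i_1,\dots,i_k)$. For $\mathbf{i}=(i_1,\dots,i_k)\in I$ write $T_{\mathbf{i}}=T_{i_1}\cdots T_{i_k}$ ($T_\emptyset$ is the identity, and $\phi^s(T_\emptyset)=1$). Almost self-affine sets and measures: for $\omega\in\Omega$ and $\mathbf{i}=(i_1,i_2,\dots)\in I_\infty$ let $$x^\omega(\mathbf{i})=\omega_{i_1}+T_{i_1}\omega_{i_1,i_2}+T_{i_1}T_{i_2}\omega_{i_1,i_2,i_3}+\cdots.$$ Then $E^\omega=\{x^\omega(\mathbf{i}):\mathbf{i}\in I_\infty\}$, a compact set, and $\mu^\omega(A)=\mu\{\mathbf{i}:x^\omega(\mathbf{i})\in A\}$. Singular value function: for a non-singular linear contraction $T$ with singular values $1>\alpha_1\ge\cdots\ge\alpha_N>0$ and $0<s\le N$,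 $\phi^s(T)=\alpha_1\cdots\alpha_{l-1}\alpha_l^{\,s-l+1}$ where $l$ is the integer with $l-1<s\le l$; $\phi^0(T)=1$; and $\phi^s(T)=(\alpha_1\cdots\alpha_N)^{s/N}$ for $s\ge N$. For $s\ge0$ let $$P(s,1)=\lim_{k\to\infty}\frac1k\sum_{|\mathbf{i}|=k}\mu(C_{\mathbf{i}})\log\big(\phi^s(T_{\mathbf{i}})^{-1}\mu(C_{\mathbf{i}})\big).$$ This limit exists, $P(\cdot,1)$ is continuous and strictly increasing in $s$, and $d_1>0$ is the unique number with $P(d_1,1)=0$. A Borel probability measure $\nu$ on $\mathbb{R}^N$ is exact dimensional (of dimension $s$) if $\lim_{r\to0}\log\nu(B(x,r))/\log r$ exists and equals $s$ for $\nu$-almost all $x$. The information dimension $D^1(\nu)$ is $\lim_{r\to0}\frac{\sum_{C}\nu(C)\log\nu(C)}{\log r}$ when this limit exists (the claim includes its existence), the sum being over the $r$-mesh cubes $[j_1r,(j_1+1)r)\times\cdots\times[j_Nr,(j_N+1)r)$, $j_1,\dots,j_N\in\mathbb{Z}$, with $\nu(C)>0$. *)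

theory Defs
  imports "HOL-Probability.Probability"
begin

text \<open>
  The alphabet \<open>{1,\<dots>,m}\<close> is a finite type \<open>'m\<close> (so \<open>m = CARD('m)\<close>), finite words are lists,
  infinite codes are functions \<open>nat \<Rightarrow> 'm\<close> (indexed from 0), and \<open>N = CARD('n)\<close>.
\<close>

subsection \<open>Code space\<close>

definition cylinder :: "'m list \<Rightarrow> (nat \<Rightarrow> 'm) set" where
  "cylinder w = {x. \<forall>k<length w. x k = w ! k}"

definition code_prefix :: "(nat \<Rightarrow> 'm) \<Rightarrow> nat \<Rightarrow> 'm list" where
  "code_prefix x k = map x [0..<k]"

text \<open>Only meaningful for \<open>x \<noteq> y\<close>.\<close>

definition code_meet :: "(nat \<Rightarrow> 'm) \<Rightarrow> (nat \<Rightarrow> 'm) \<Rightarrow> 'm list" where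
  "code_meet x y = code_prefix x (LEAST k. x k \<noteq> y k)"

text \<open>
  Since the alphabet is finite and discrete, the Borel sets of the code space are those of the
  product sigma-algebra.
\<close>

definition bernoulli_measure :: "('m::finite \<Rightarrow> real) \<Rightarrow> (nat \<Rightarrow> 'm) measure \<Rightarrow> bool" where
  "bernoulli_measure p \<mu> \<longleftrightarrow>
     prob_space \<mu> \<and>
     sets \<mu> = sets (\<Pi>\<^sub>M k\<in>(UNIV :: nat set). count_space (UNIV :: 'm set)) \<and>
     (\<forall>w. measure \<mu> (cylinder w) = prod_list (map p w))"

subsection \<open>Linear contractions and the singular value function\<close>

definition linear_contraction :: "(real^'n \<Rightarrow> real^'n) \<Rightarrow> bool" where
  "linear_contraction f \<longleftrightarrow> linear f \<and> onorm f < 1"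

definition word_map :: "('m \<Rightarrow> real^'n \<Rightarrow> real^'n) \<Rightarrow> 'm list \<Rightarrow> real^'n \<Rightarrow> real^'n" where
  "word_map T w = foldr (\<lambda>i f. T i \<circ> f) w id"

text \<open>
  The non-increasing list of the non-negative square roots of the eigenvalues of \<open>f\<^sup>* f\<close>, each
  repeated according to its multiplicity (the dimension of the eigenspace, as \<open>f\<^sup>* f\<close> is
  self-adjoint).
\<close>

definition singular_values :: "(real^'n \<Rightarrow> real^'n) \<Rightarrow> real list" where
  "singular_values f = (THE xs. sorted_wrt (\<ge>) xs \<and>
     (\<forall>\<sigma>. count_list xs \<sigma> =
            (if \<sigma> \<ge> 0 then dim {v. adjoint f (f v) = \<sigma>\<^sup>2 *\<^sub>R v} else 0)))"

text \<open>
  List positions start at 0, so \<open>\<alpha>\<^sub>j\<close> is \<open>singular_values f ! (j - 1)\<close>. Only \<open>s \<ge> 0\<close> matters.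
\<close>

definition singular_value_function :: "real \<Rightarrow> (real^'n \<Rightarrow> real^'n) \<Rightarrow> real" where
  "singular_value_function s f =
     (let \<alpha> = singular_values f in
      if s \<le> 0 then 1
      else if s \<le> real CARD('n) then
        (let l = nat \<lceil>s\<rceil> in (\<Prod>j<l - 1. \<alpha> ! j) * (\<alpha> ! (l - 1)) powr (s - real l + 1))
      else (\<Prod>j<CARD('n). \<alpha> ! j) powr (s / real CARD('n)))"

subsection \<open>Almost self-affine sets and measures\<close>

definition code_point ::
    "('m \<Rightarrow> real^'n \<Rightarrow> real^'n) \<Rightarrow> ('m list \<Rightarrow> real^'n) \<Rightarrow> (nat \<Rightarrow> 'm) \<Rightarrow> real^'n" where
  "code_point T \<omega> x = (\<Sum>k. word_map T (code_prefix x k) (\<omega> (code_prefix x (Suc k))))"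

definition projected_measure ::
    "('m \<Rightarrow> real^'n \<Rightarrow> real^'n) \<Rightarrow> (nat \<Rightarrow> 'm) measure \<Rightarrow> ('m list \<Rightarrow> real^'n) \<Rightarrow> (real^'n) measure" where
  "projected_measure T \<mu> \<omega> = distr \<mu> borel (code_point T \<omega>)"

text \<open>\<open>|z|\<^sup>-\<^sup>s\<close> for \<open>s \<ge> 0\<close> with its conventional values at \<open>z = 0\<close>, which \<open>powr\<close> would set to 0.\<close>

definition norm_neg_power :: "real \<Rightarrow> real^'n \<Rightarrow> ennreal" where
  "norm_neg_power s z =
     (if s = 0 then 1 else if z = 0 then \<infinity> else ennreal (norm z powr (- s)))"

subsection \<open>The critical exponent\<close>

definition pressure ::
    "('m::finite \<Rightarrow> real^'n \<Rightarrow> real^'n) \<Rightarrow> (nat \<Rightarrow> 'm) measure \<Rightarrow> real \<Rightarrow> real" where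
  "pressure T \<mu> s = lim (\<lambda>k. 1 / real k * (\<Sum>w | length w = k.
     measure \<mu> (cylinder w) *
     ln (inverse (singular_value_function s (word_map T w)) * measure \<mu> (cylinder w))))"

definition critical_exponent ::
    "('m::finite \<Rightarrow> real^'n \<Rightarrow> real^'n) \<Rightarrow> (nat \<Rightarrow> 'm) measure \<Rightarrow> real" where
  "critical_exponent T \<mu> = (THE d. 0 \<le> d \<and> pressure T \<mu> d = 0)"

subsection \<open>Dimensions of measures\<close>

definition exact_dimensional :: "(real^'n) measure \<Rightarrow> real \<Rightarrow> bool" where
  "exact_dimensional \<nu> s \<longleftrightarrow>
     prob_space \<nu> \<and> sets \<nu> = sets borel \<and>
     (AE x in \<nu>. ((\<lambda>r. ln (measure \<nu> (cball x r)) / ln r) \<longlongrightarrow> s) (at_right 0))"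

definition mesh_cubes :: "real \<Rightarrow> (real^'n) set set" where
  "mesh_cubes r = range (\<lambda>j :: int^'n.
     {x. \<forall>i. of_int (j $ i) * r \<le> x $ i \<and> x $ i < (of_int (j $ i) + 1) * r})"

definition charged_cubes :: "(real^'n) measure \<Rightarrow> real \<Rightarrow> (real^'n) set set" where
  "charged_cubes \<nu> r = {C \<in> mesh_cubes r. measure \<nu> C > 0}"

text \<open>
  Summability is required separately because a divergent \<open>infsum\<close> has the value 0.
\<close>

definition has_information_dimension :: "(real^'n) measure \<Rightarrow> real \<Rightarrow> bool" where
  "has_information_dimension \<nu> D \<longleftrightarrow>
     (\<forall>\<^sub>F r in at_right 0. (\<lambda>C. measure \<nu> C * ln (measure \<nu> C)) summable_on charged_cubes \<nu> r) \<and>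
     ((\<lambda>r. (\<Sum>\<^sub>\<infinity>C\<in>charged_cubes \<nu> r. measure \<nu> C * ln (measure \<nu> C)) / ln r) \<longlongrightarrow> D)
       (at_right 0)"

end

theory Submission
  imports Defs
begin

text \<open>
  By a subadditive ergodic theorem for the Bernoulli measure, \<open>log \<mu>(C\<^bsub>i|k\<^esub>) / k\<close> and
  \<open>log \<phi>\<^sup>s(T\<^bsub>i|k\<^esub>) / k\<close> converge for almost all codes \<open>i\<close>, and the difference of the two limits is
  the pressure \<open>P(s, 1)\<close>. Subadditivity holds because for \<open>s \<le> N\<close> the number \<open>\<phi>\<^sup>s(T)\<close> is comparable to
  the \<open>s\<close>-dimensional Hausdorff content of the ellipsoid \<open>T(B(0, 1))\<close>.

  Lower bound. If \<open>s\<close> is below the critical exponent then \<open>\<mu>(C\<^bsub>i|k\<^esub>) / \<phi>\<^sup>s(T\<^bsub>i|k\<^esub>)\<close> decays exponentially,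
  so integrating the energy hypothesis over the code space shows that the \<open>s\<close>-potential of \<open>\<mu>\<^sup>\<omega>\<close> is
  finite almost everywhere.

  Upper bound. The image of the cylinder of \<open>i|k\<close> is covered by about \<open>\<phi>\<^sup>s(T\<^bsub>i|k\<^esub>) \<alpha>\<^sub>l\<^bsup>-s\<^esup>\<close> balls of
  radius \<open>\<alpha>\<^sub>l(T\<^bsub>i|k\<^esub>)\<close>. By Borel--Cantelli almost every point eventually avoids the balls that
  carry much less than the average mass, and at the critical exponent the average mass is
  \<open>\<alpha>\<^sub>l\<^sup>s\<close> up to subexponential factors. If the critical exponent exceeds \<open>N\<close>, the same
  argument with covers of the whole set by balls of radius \<open>2\<^bsup>-k\<^esup>\<close> bounds the dimension by \<open>N\<close>.
\<close>

section \<open>Singular values\<close>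

text \<open>The limit in the ergodic theorem is a constant because of two opposite estimates:
  exponential moments over independent blocks keep the quotients below the Fekete limit
  \<open>rate\<close> in the long run, while cutting orbits into blocks shows that the integral of
  the pointwise lower rate is at least \<open>rate\<close>. Subadditivity is available for \<phi>^s
  and not for a single singular value \<alpha>_l; its rate is the difference of the rates of
  \<phi>^l and \<phi>^(l-1). So the radii of the covering balls behave like exp (k \<gamma>) with
  \<gamma> < 0, and although covers bound ball masses only along these radii, logarithmic quotients
  can be interpolated to all radii. The estimates hold for almost all codes, whereas the claim is
  about almost all points. The transfer needs a measurable set of points, hence the detour through
  dyadic radii. The information dimension is deduced from the local dimension: the support is
  bounded, so up to a bounded error the mesh entropy is squeezed between integrals of truncated
  logarithms of ball masses at comparable radii, and dominated convergence applies to these.\<close>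

lemma sphere_maximizer_is_eigenvector:
  fixes A :: "'a::euclidean_space \<Rightarrow> 'a"
  assumes lin: "linear A" and sym: "\<And>x y. A x \<bullet> y = x \<bullet> A y"
    and V: "subspace V" "V \<noteq> {0}" and inv: "\<And>x. x \<in> V \<Longrightarrow> A x \<in> V"
  obtains e c where "e \<in> V" "norm e = 1" "A e = c *\<^sub>R e"
    "\<And>x. x \<in> V \<Longrightarrow> x \<bullet> A x \<le> c * (x \<bullet> x)"
proof -
  interpret A: linear A by (rule lin)
  let ?K = "V \<inter> sphere 0 1"
  have "compact ?K" using closed_subspace[OF V(1)] by (simp add: closed_Int_compact)
  moreover obtain v where v: "v \<in> V" "v \<noteq> 0" using V subspace_0 by blast
  then have "v /\<^sub>R norm v \<in> ?K" using subspace_mul[OF V(1) v(1)] by simp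
  hence "?K \<noteq> {}" by blast
  moreover have "continuous_on ?K (\<lambda>x. x \<bullet> A x)"
    by (intro continuous_intros linear_continuous_on_compose[OF _ lin])
  ultimately obtain e where e: "e \<in> ?K" "\<And>x. x \<in> ?K \<Longrightarrow> x \<bullet> A x \<le> e \<bullet> A e"
    using continuous_attains_sup[of ?K "\<lambda>x. x \<bullet> A x"] by blast
  define c where "c = e \<bullet> A e"
  have ne: "e \<bullet> e = 1" using e(1) by (simp add: dot_square_norm)
  have max: "x \<bullet> A x \<le> c * (x \<bullet> x)" if "x \<in> V" for x
  proof (cases "x = 0")
    case False
    have "x /\<^sub>R norm x \<in> ?K" using subspace_mul[OF V(1) that] False by simp
    from e(2)[OF this] have "(x \<bullet> A x) / (norm x)\<^sup>2 \<le> c"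
      by (simp add: c_def A.scale power2_eq_square field_simps)
    then show ?thesis using False by (simp add: dot_square_norm divide_simps mult.commute)
  qed (simp add: A.zero)
  have "A e = c *\<^sub>R e"
  proof (rule ccontr)
    define y where "y = A e - c *\<^sub>R e"
    assume "\<not> ?thesis" then have y0: "y \<bullet> y > 0" by (simp add: y_def)
    have yV: "y \<in> V" unfolding y_def using inv e(1) V(1) by (simp add: subspace_diff subspace_mul)
    define b where "b = c * (y \<bullet> y) - y \<bullet> A y"
    have b0: "b \<ge> 0" using max[OF yV] by (simp add: b_def)
    \<comment> \<open>Maximality is tested at the vector \<open>e\<close> plus \<open>t\<close>
      times the defect \<open>y\<close>: the terms of order zero cancel, leaving a linear term
      against a quadratic one, which is impossible for small \<open>t\<close> if \<open>y\<close> is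
      non-zero.\<close>
    have key: "2 * t * (y \<bullet> y) \<le> t\<^sup>2 * b" for t
    proof -
      have "e + t *\<^sub>R y \<in> V" using e(1) yV V(1) by (simp add: subspace_add subspace_mul)
      from max[OF this]
      have *: "(e + t *\<^sub>R y) \<bullet> (A e + t *\<^sub>R A y) \<le> c * ((e + t *\<^sub>R y) \<bullet> (e + t *\<^sub>R y))"
        by (simp add: A.add A.scale)
      have "e \<bullet> A y = y \<bullet> A e" using sym[of e y] by (simp add: inner_commute)
      moreover have "y \<bullet> A e = y \<bullet> y + c * (y \<bullet> e)" by (simp add: y_def algebra_simps)
      ultimately show ?thesis using * ne
        by (simp add: b_def c_def[symmetric] inner_add_left inner_add_right algebra_simps power2_eq_square inner_commute)
    qed
    define t where "t = (y \<bullet> y) / (b + 1)"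
    have t0: "t > 0" using y0 b0 by (simp add: t_def)
    have "t * (2 * (y \<bullet> y)) \<le> t * (t * b)" using key[of t] by (simp add: power2_eq_square mult_ac)
    then have "2 * (y \<bullet> y) \<le> t * b" using t0 by simp
    also have "\<dots> \<le> t * (b + 1)" using t0 by simp
    also have "\<dots> = y \<bullet> y" using b0 by (simp add: t_def)
    finally show False using y0 by simp
  qed
  then show ?thesis using that[of e c] e(1) max by auto
qed

text \<open>Induction on \<open>k\<close>: the next eigenvector maximizes the quadratic form on the
  orthogonal complement of the earlier ones, which \<open>A\<close> preserves by symmetry. The last
  conjunct carries the ordering through the induction, since it bounds the new eigenvalue by all
  earlier ones.\<close>

lemma self_adjoint_orthonormal_eigenvectors:
  fixes A :: "'a::euclidean_space \<Rightarrow> 'a"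
  assumes lin: "linear A" and sym: "\<And>x y. A x \<bullet> y = x \<bullet> A y"
  shows "k \<le> DIM('a) \<Longrightarrow> \<exists>e c. (\<forall>i<k. \<forall>j<k. e i \<bullet> e j = (if i = j then 1 else 0)) \<and>
    (\<forall>i<k. A (e i) = c i *\<^sub>R e i) \<and> (\<forall>i j. i \<le> j \<longrightarrow> j < k \<longrightarrow> c j \<le> (c i :: real)) \<and>
    (\<forall>i<k. \<forall>x. (\<forall>j<k. x \<bullet> e j = 0) \<longrightarrow> x \<bullet> A x \<le> c i * (x \<bullet> x))"
proof (induction k)
  case 0 then show ?case by auto
next
  case (Suc k)
  then obtain e c where IH: "\<And>i j. i < k \<Longrightarrow> j < k \<Longrightarrow> e i \<bullet> e j = (if i = j then 1 else 0)"
    "\<And>i. i < k \<Longrightarrow> A (e i) = c i *\<^sub>R e i" "\<And>i j. i \<le> j \<Longrightarrow> j < k \<Longrightarrow> c j \<le> (c i :: real)"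
    "\<And>i x. i < k \<Longrightarrow> \<forall>j<k. x \<bullet> e j = 0 \<Longrightarrow> x \<bullet> A x \<le> c i * (x \<bullet> x)"
    using Suc_leD by (smt (verit, best))
  define V where "V = {x. \<forall>j<k. x \<bullet> e j = 0}"
  have "subspace V" unfolding V_def by (auto simp: subspace_def inner_add_left)
  have "dim (e ` {..<k}) \<le> card (e ` {..<k})" by (rule dim_le_card') simp
  also have "\<dots> \<le> k" using card_image_le[of "{..<k}" e] by simp
  finally have "dim (e ` {..<k}) < DIM('a)" using Suc.prems by simp
  then obtain v where "v \<noteq> 0" "\<And>y. y \<in> span (e ` {..<k}) \<Longrightarrow> orthogonal v y"
    using orthogonal_to_subspace_exists by blast
  then have "v \<in> V" "v \<noteq> 0" by (auto simp: V_def orthogonal_def span_base)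
  then have "V \<noteq> {0}" by blast
  have inv: "A x \<in> V" if "x \<in> V" for x
    using that IH(2) by (auto simp: V_def sym)
  obtain u d where u: "u \<in> V" "norm u = 1" "A u = d *\<^sub>R u" "\<And>x. x \<in> V \<Longrightarrow> x \<bullet> A x \<le> d * (x \<bullet> x)"
    by (rule sphere_maximizer_is_eigenvector[OF lin sym \<open>subspace V\<close> \<open>V \<noteq> {0}\<close> inv], assumption, rule that)
  have uu: "u \<bullet> u = 1" using u(2) by (simp add: dot_square_norm)
  have du: "d \<le> c i" if "i < k" for i
    using IH(4)[OF that, of u] u uu by (auto simp: V_def)
  show ?case
  proof (intro exI[of _ "e(k := u)"] exI[of _ "c(k := d)"] conjI allI impI)
    fix i j assume "i < Suc k" "j < Suc k"
    then show "(e(k := u)) i \<bullet> (e(k := u)) j = (if i = j then 1 else 0)"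
      using IH(1)[of i j] u(1) uu by (auto simp: V_def inner_commute less_Suc_eq)
  next
    fix i assume "i < Suc k" then show "A ((e(k := u)) i) = (c(k := d)) i *\<^sub>R (e(k := u)) i"
      using IH(2) u(3) by (auto simp: less_Suc_eq)
  next
    fix i j assume "i \<le> j" "j < Suc k" then show "(c(k := d)) j \<le> (c(k := d)) i"
      using IH(3)[of i j] du by (auto simp: less_Suc_eq)
  next
    fix i x assume i: "i < Suc k" and x: "\<forall>j<Suc k. x \<bullet> (e(k := u)) j = 0"
    have "x \<bullet> e j = 0" if "j < k" for j using x[rule_format, of j] that by simp
    then have "x \<in> V" by (auto simp: V_def)
    then show "x \<bullet> A x \<le> (c(k := d)) i * (x \<bullet> x)"
      using u(4) IH(4)[of i x] i by (auto simp: V_def less_Suc_eq)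
  qed
qed

lemma orthonormal_expansion:
  fixes e :: "nat \<Rightarrow> 'a::euclidean_space"
  assumes on: "\<And>i j. i < DIM('a) \<Longrightarrow> j < DIM('a) \<Longrightarrow> e i \<bullet> e j = (if i = j then 1 else 0)"
  shows "x = (\<Sum>j<DIM('a). (x \<bullet> e j) *\<^sub>R e j)"
proof -
  let ?n = "DIM('a)" let ?E = "e ` {..<?n}"
  have inj: "inj_on e {..<?n}" by (rule inj_onI) (metis lessThan_iff on zero_neq_one)
  have "pairwise orthogonal ?E" by (auto simp: pairwise_def orthogonal_def on)
  moreover have "0 \<notin> ?E" using on by force
  ultimately have ind: "independent ?E" by (rule pairwise_orthogonal_independent)
  have "card ?E = ?n" using inj by (simp add: card_image)
  then have sp: "span ?E = UNIV" using ind by (metis dim_UNIV dim_eq_card_independent dim_eq_full)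
  define y where "y = x - (\<Sum>j<?n. (x \<bullet> e j) *\<^sub>R e j)"
  have "y \<bullet> e i = 0" if "i < ?n" for i
  proof -
    have "(\<Sum>j<?n. (x \<bullet> e j) * (e j \<bullet> e i)) = (\<Sum>j<?n. if j = i then x \<bullet> e j else 0)"
      by (rule sum.cong) (auto simp: on that)
    then show ?thesis using that by (simp add: y_def inner_diff_left inner_sum_left)
  qed
  then have "orthogonal y z" if "z \<in> span ?E" for z
    using orthogonal_to_span[OF that, of y] by (auto simp: orthogonal_def)
  then have "orthogonal y y" using sp by auto
  then show ?thesis by (simp add: y_def orthogonal_self)
qed

text \<open>The \<open>e i\<close> are eigenvectors of f* f. The definite description in
  \<open>singular_values\<close> is resolved by showing that the square roots of the eigenvalues
  satisfy it and that a sorted list is determined by its multiplicities. Bijectivity makes every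
  eigenvalue positive.\<close>

lemma singular_value_decomposition:
  fixes f :: "real^'n \<Rightarrow> real^'n"
  assumes lin: "linear f" and bij: "bij f"
  obtains e where "\<And>i j. i < CARD('n) \<Longrightarrow> j < CARD('n) \<Longrightarrow> e i \<bullet> e j = (if i = j then 1 else 0)"
    "\<And>i j. i < CARD('n) \<Longrightarrow> j < CARD('n) \<Longrightarrow>
       f (e i) \<bullet> f (e j) = (if i = j then (singular_values f ! i)\<^sup>2 else 0)"
    "\<And>i. i < CARD('n) \<Longrightarrow> singular_values f ! i > 0"
    "\<And>i j. i \<le> j \<Longrightarrow> j < CARD('n) \<Longrightarrow> singular_values f ! j \<le> singular_values f ! i"
proof -
  interpret f: linear f by (rule lin)
  let ?N = "CARD('n)"
  define A where "A = (\<lambda>x. adjoint f (f x))"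
  have adj: "x \<bullet> adjoint f y = f x \<bullet> y" for x y by (rule adjoint_works[OF lin])
  have adj': "adjoint f y \<bullet> x = y \<bullet> f x" for x y using adj[of x y] by (simp add: inner_commute)
  have linA: "linear A"
    using linear_compose[OF lin adjoint_linear[OF lin]] by (simp add: A_def o_def)
  have symA: "A x \<bullet> y = x \<bullet> A y" for x y by (simp add: A_def adj adj')
  obtain e c where on: "\<And>i j. i < ?N \<Longrightarrow> j < ?N \<Longrightarrow> e i \<bullet> e j = (if i = j then 1 else 0)"
    and eig: "\<And>i. i < ?N \<Longrightarrow> A (e i) = c i *\<^sub>R e i"
    and mono: "\<And>i j. i \<le> j \<Longrightarrow> j < ?N \<Longrightarrow> c j \<le> (c i :: real)"
    using self_adjoint_orthonormal_eigenvectors[OF linA symA, of ?N] by auto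
  have ff: "f (e i) \<bullet> f (e j) = (if i = j then c i else 0)" if "i < ?N" "j < ?N" for i j
  proof -
    have "f (e i) \<bullet> f (e j) = e i \<bullet> A (e j)" by (simp add: A_def adj)
    then show ?thesis using eig on that by simp
  qed
  have cpos: "c i > 0" if "i < ?N" for i
  proof -
    have "e i \<noteq> 0" using on[OF that that] by auto
    then have "f (e i) \<noteq> 0" using bij by (metis bij_is_inj f.zero injD)
    then show ?thesis using ff[OF that that] by (metis inner_gt_zero_iff)
  qed
  define xs where "xs = map (\<lambda>i. sqrt (c i)) [0..<?N]"
  have sorted: "sorted_wrt (\<ge>) xs"
    unfolding xs_def sorted_wrt_map by (auto simp: sorted_wrt_iff_nth_less intro: mono)
  have dimE: "dim {v. A v = \<sigma>\<^sup>2 *\<^sub>R v} = card {i. i < ?N \<and> c i = \<sigma>\<^sup>2}" for \<sigma> :: real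
  proof -
    let ?I = "{i. i < ?N \<and> c i = \<sigma>\<^sup>2}"
    have inj: "inj_on e ?I" by (rule inj_onI) (metis (no_types, lifting) mem_Collect_eq on zero_neq_one)
    have "pairwise orthogonal (e ` ?I)" by (auto simp: pairwise_def orthogonal_def on)
    moreover have "0 \<notin> e ` ?I" using on by force
    ultimately have ind: "independent (e ` ?I)" by (rule pairwise_orthogonal_independent)
    have "v \<in> span (e ` ?I)" if v: "A v = \<sigma>\<^sup>2 *\<^sub>R v" for v
    proof -
      \<comment> \<open>By symmetry of \<open>A\<close>, eigenvectors for different eigenvalues are
        orthogonal, so only the \<open>e i\<close> with the right eigenvalue occur in the expansion
        of \<open>v\<close>.\<close>
      have z: "v \<bullet> e i = 0" if "i < ?N" "i \<notin> ?I" for i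
      proof -
        have "\<sigma>\<^sup>2 * (v \<bullet> e i) = c i * (v \<bullet> e i)" using symA[of v "e i"] v eig that by simp
        then show ?thesis using that by auto
      qed
      have "v = (\<Sum>j<?N. (v \<bullet> e j) *\<^sub>R e j)" using orthonormal_expansion[of e v] on by simp
      also have "\<dots> = (\<Sum>j\<in>?I. (v \<bullet> e j) *\<^sub>R e j)"
        by (rule sum.mono_neutral_right) (auto simp: z)
      also have "\<dots> \<in> span (e ` ?I)" by (intro span_sum span_scale span_base) auto
      finally show ?thesis .
    qed
    then have "dim {v. A v = \<sigma>\<^sup>2 *\<^sub>R v} = card (e ` ?I)"
      using eig by (intro dim_unique[OF _ _ ind]) auto
    then show ?thesis using inj by (simp add: card_image)
  qed
  have cnt: "count_list xs \<sigma> = (if \<sigma> \<ge> 0 then dim {v. adjoint f (f v) = \<sigma>\<^sup>2 *\<^sub>R v} else 0)" for \<sigma>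
  proof -
    have "count_list xs \<sigma> = card {i. i < length xs \<and> xs ! i = \<sigma>}"
      by (simp add: count_list_eq_length_filter length_filter_conv_card eq_commute[of _ \<sigma>])
    also have "{i. i < length xs \<and> xs ! i = \<sigma>} = {i. i < ?N \<and> \<sigma> \<ge> 0 \<and> c i = \<sigma>\<^sup>2}"
    proof -
      have "sqrt (c i) = \<sigma> \<longleftrightarrow> \<sigma> \<ge> 0 \<and> c i = \<sigma>\<^sup>2" if "i < ?N" for i
        using cpos[OF that] by (auto simp: real_sqrt_unique)
      then have "xs ! i = \<sigma> \<longleftrightarrow> \<sigma> \<ge> 0 \<and> c i = \<sigma>\<^sup>2" if "i < ?N" for i using that by (simp add: xs_def)
      moreover have "length xs = ?N" by (simp add: xs_def)
      ultimately show ?thesis by (intro Collect_cong) (simp cong: conj_cong)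
    qed
    finally show ?thesis using dimE[of \<sigma>] by (simp add: A_def)
  qed
  have "singular_values f = xs"
    unfolding singular_values_def
  proof (rule the_equality)
    show "sorted_wrt (\<ge>) xs \<and> (\<forall>\<sigma>. count_list xs \<sigma> =
        (if \<sigma> \<ge> 0 then dim {v. adjoint f (f v) = \<sigma>\<^sup>2 *\<^sub>R v} else 0))" using sorted cnt by auto
  next
    fix ys assume "sorted_wrt (\<ge>) ys \<and> (\<forall>\<sigma>. count_list ys \<sigma> =
        (if \<sigma> \<ge> 0 then dim {v. adjoint f (f v) = \<sigma>\<^sup>2 *\<^sub>R v} else 0))"
    then have ys: "sorted_wrt (\<ge>) ys" "\<And>\<sigma>. count_list ys \<sigma> = count_list xs \<sigma>" using cnt by auto
    \<comment> \<open>Both lists are non-increasing and have the same multiplicities; they are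
      reversed because uniqueness of sorting refers to non-decreasing lists.\<close>
    have "mset ys = mset xs" by (rule multiset_eqI) (simp add: count_mset ys(2))
    then have "mset (rev ys) = mset (rev xs)" by simp
    moreover have "sorted (rev ys)" "sorted (rev xs)"
      using ys(1) sorted by (auto simp: sorted_wrt_rev)
    ultimately have "rev ys = rev xs" by (metis properties_for_sort)
    then show "ys = xs" by simp
  qed
  then have sv: "singular_values f ! i = sqrt (c i)" if "i < ?N" for i using that by (simp add: xs_def)
  show ?thesis
    using cpos mono sv by (intro that[of e] on) (auto simp: ff less_imp_le[OF cpos])
qed

text \<open>
  The weights \<open>w\<^sub>j(s)\<close> for which \<open>\<phi>\<^sup>s(T) = \<Prod>\<^sub>j \<alpha>\<^sub>j\<close> \<open>powr\<close> \<open>w\<^sub>j(s)\<close>, with \<open>j\<close> counted from 0. They add up to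
  \<open>s\<close> and increase with \<open>s\<close>, which makes the dependence of \<open>\<phi>\<^sup>s\<close> on \<open>s\<close> transparent.
\<close>

definition sv_weight :: "nat \<Rightarrow> real \<Rightarrow> nat \<Rightarrow> real" where
  "sv_weight n s j = (if s \<le> real n then min 1 (max 0 (s - real j)) else s / real n)"

lemma sv_weight_nonneg: "0 \<le> s \<Longrightarrow> 0 \<le> sv_weight n s j"
  by (simp add: sv_weight_def)

lemma sv_weight_le_1: "s \<le> real n \<Longrightarrow> sv_weight n s j \<le> 1"
  by (simp add: sv_weight_def)

lemma sv_weight_mono:
  assumes "s \<le> t" "n > 0" shows "sv_weight n s j \<le> sv_weight n t j"
proof (cases "s \<le> real n \<and> real n < t")
  case True
  then have "sv_weight n s j \<le> 1" by (simp add: sv_weight_le_1)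
  also have "1 \<le> sv_weight n t j" using True assms by (simp add: sv_weight_def)
  finally show ?thesis .
qed (use assms in \<open>auto simp: sv_weight_def divide_right_mono\<close>)

lemma sum_sv_weight:
  assumes "0 \<le> s" "n > 0" shows "(\<Sum>j<n. sv_weight n s j) = s"
proof (cases "s \<le> real n")
  case True
  have "(\<Sum>j<k. min 1 (max 0 (s - real j))) = min s (real k)" for k
    using assms by (induction k) (auto simp: min_def max_def)
  then show ?thesis using True by (simp add: sv_weight_def)
qed (use assms in \<open>simp add: sv_weight_def\<close>)

section \<open>Formulas and estimates for the singular value function of one invertible map\<close>

locale nonsingular_map =
  fixes f :: "real^'n \<Rightarrow> real^'n"
  assumes lin: "linear f" and bij: "bij f"
begin

abbreviation "\<alpha> j \<equiv> singular_values f ! j"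

lemma sv_pos: "j < CARD('n) \<Longrightarrow> \<alpha> j > 0"
  by (rule singular_value_decomposition[OF lin bij]) auto

lemma sv_mono: "i \<le> j \<Longrightarrow> j < CARD('n) \<Longrightarrow> \<alpha> j \<le> \<alpha> i"
  by (rule singular_value_decomposition[OF lin bij]) auto

text \<open>This turns norm estimates for a map into estimates for all of its singular values at
  once.\<close>

lemma sv_attained:
  assumes "j < CARD('n)" obtains v where "norm v = 1" "norm (f v) = \<alpha> j"
proof (rule singular_value_decomposition[OF lin bij])
  fix e assume e: "\<And>i j. i < CARD('n) \<Longrightarrow> j < CARD('n) \<Longrightarrow> e i \<bullet> e j = (if i = j then 1 else 0)"
    "\<And>i j. i < CARD('n) \<Longrightarrow> j < CARD('n) \<Longrightarrow> f (e i) \<bullet> f (e j) = (if i = j then (\<alpha> i)\<^sup>2 else 0)"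
  have "norm (e j) = 1" using e(1)[OF assms assms] by (simp add: norm_eq_1)
  moreover have "norm (f (e j)) = \<alpha> j"
    using e(2)[OF assms assms] sv_pos[OF assms] by (simp add: norm_eq_sqrt_inner)
  ultimately show thesis by (rule that)
qed

text \<open>For s <= N and l = ceiling s, the weights are 1 at the positions below l - 1, s - l + 1
  at l - 1, and 0 beyond; for s > N all of them equal s / N. This removes the case distinctions of
  the definition.\<close>

lemma svf_eq_exp:
  assumes s: "0 \<le> s"
  shows "singular_value_function s f = exp (\<Sum>j<CARD('n). sv_weight CARD('n) s j * ln (\<alpha> j))"
proof -
  consider "s = 0" | "0 < s" "s \<le> CARD('n)" | "s > CARD('n)" using s by linarith
  then show ?thesis
  proof cases
    case 1
    then show ?thesis by (simp add: singular_value_function_def sv_weight_def)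
  next
    case 2
    define l where "l = nat \<lceil>s\<rceil>"
    have l: "1 \<le> l" "l \<le> CARD('n)" "real l - 1 < s" "s \<le> real l"
      using 2 by (auto simp: l_def) linarith+
    have "(\<Sum>j<CARD('n). sv_weight CARD('n) s j * ln (\<alpha> j)) = (\<Sum>j<l. sv_weight CARD('n) s j * ln (\<alpha> j))"
      using l 2 by (intro sum.mono_neutral_right) (auto simp: sv_weight_def)
    also have "\<dots> = (\<Sum>j<l - 1. sv_weight CARD('n) s j * ln (\<alpha> j)) + sv_weight CARD('n) s (l - 1) * ln (\<alpha> (l - 1))"
      using l sum.lessThan_Suc[of "\<lambda>j. sv_weight CARD('n) s j * ln (\<alpha> j)" "l - 1"] by simp
    also have "(\<Sum>j<l - 1. sv_weight CARD('n) s j * ln (\<alpha> j)) = (\<Sum>j<l - 1. ln (\<alpha> j))"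
      using l 2 by (intro sum.cong) (auto simp: sv_weight_def min_def max_def)
    also have "sv_weight CARD('n) s (l - 1) = s - real l + 1"
      using l 2 by (auto simp: sv_weight_def min_def max_def of_nat_diff)
    finally have "exp (\<Sum>j<CARD('n). sv_weight CARD('n) s j * ln (\<alpha> j))
        = (\<Prod>j<l - 1. exp (ln (\<alpha> j))) * exp ((s - real l + 1) * ln (\<alpha> (l - 1)))"
      by (simp add: exp_add exp_sum)
    also have "(\<Prod>j<l - 1. exp (ln (\<alpha> j))) = (\<Prod>j<l - 1. \<alpha> j)"
      using l sv_pos by (intro prod.cong) auto
    also have "exp ((s - real l + 1) * ln (\<alpha> (l - 1))) = \<alpha> (l - 1) powr (s - real l + 1)"
    proof -
      have "l - 1 < CARD('n)" using l by linarith
      from sv_pos[OF this] show ?thesis by (simp add: powr_def)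
    qed
    finally show ?thesis using 2 by (simp add: singular_value_function_def Let_def l_def)
  next
    case 3
    have pos: "(\<Prod>j<CARD('n). \<alpha> j) > 0" by (intro prod_pos) (auto intro: sv_pos)
    have "ln (\<Prod>j<CARD('n). \<alpha> j) = (\<Sum>j<CARD('n). ln (\<alpha> j))"
      by (intro ln_prod) (auto dest: sv_pos)
    moreover have "(\<Prod>j<CARD('n). \<alpha> j) \<noteq> 0" using pos by (rule less_imp_neq[symmetric])
    ultimately show ?thesis using 3
      by (simp add: singular_value_function_def Let_def powr_def sv_weight_def sum_distrib_left
          del: prod_zero_iff)
  qed
qed

lemma svf_pos: "0 \<le> s \<Longrightarrow> singular_value_function s f > 0"
  by (simp add: svf_eq_exp)

lemma ln_svf: "0 \<le> s \<Longrightarrow> ln (singular_value_function s f) = (\<Sum>j<CARD('n). sv_weight CARD('n) s j * ln (\<alpha> j))"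
  by (simp add: svf_eq_exp)

text \<open>The weights increase with the exponent and sum to it, so the difference is a combination
  of the \<open>ln (\<alpha> j)\<close> with non-negative coefficients of total
  \<open>t - s\<close>.\<close>

lemma ln_svf_diff_le:
  assumes "0 \<le> s" "s \<le> t" "\<And>j. j < CARD('n) \<Longrightarrow> ln (\<alpha> j) \<le> b"
  shows "ln (singular_value_function t f) - ln (singular_value_function s f) \<le> (t - s) * b"
proof -
  have "(\<Sum>j<CARD('n). (sv_weight CARD('n) t j - sv_weight CARD('n) s j) * ln (\<alpha> j)) \<le> (\<Sum>j<CARD('n). (sv_weight CARD('n) t j - sv_weight CARD('n) s j) * b)"
    using assms by (intro sum_mono mult_left_mono) (auto intro: sv_weight_mono)
  also have "\<dots> = (t - s) * b"
    using assms by (simp add: sum_distrib_right[symmetric] sum_subtractf sum_sv_weight)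
  finally show ?thesis using assms by (simp add: ln_svf left_diff_distrib sum_subtractf)
qed

lemma ln_svf_diff_ge:
  assumes "0 \<le> s" "s \<le> t" "\<And>j. j < CARD('n) \<Longrightarrow> ln (\<alpha> j) \<ge> a"
  shows "ln (singular_value_function t f) - ln (singular_value_function s f) \<ge> (t - s) * a"
proof -
  have "(\<Sum>j<CARD('n). (sv_weight CARD('n) t j - sv_weight CARD('n) s j) * ln (\<alpha> j)) \<ge> (\<Sum>j<CARD('n). (sv_weight CARD('n) t j - sv_weight CARD('n) s j) * a)"
    using assms by (intro sum_mono mult_left_mono) (auto intro: sv_weight_mono)
  moreover have "(\<Sum>j<CARD('n). (sv_weight CARD('n) t j - sv_weight CARD('n) s j) * a) = (t - s) * a"
    using assms by (simp add: sum_distrib_right[symmetric] sum_subtractf sum_sv_weight)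
  ultimately show ?thesis using assms by (simp add: ln_svf left_diff_distrib sum_subtractf)
qed

lemma svf_0: "singular_value_function 0 f = 1"
  by (simp add: singular_value_function_def)

text \<open>Growth rates are obtained only for \<phi>^s; this identity transfers them to an
  individual singular value.\<close>

lemma ln_sv_eq_ln_svf_diff:
  assumes "1 \<le> l" "l \<le> CARD('n)"
  shows "ln (\<alpha> (l - 1)) =
    ln (singular_value_function (real l) f) - ln (singular_value_function (real (l - 1)) f)"
proof -
  have "(\<Sum>j<CARD('n). (sv_weight CARD('n) (real l) j - sv_weight CARD('n) (real (l - 1)) j) * ln (\<alpha> j))
      = (\<Sum>j<CARD('n). if j = l - 1 then ln (\<alpha> j) else 0)"
    using assms by (intro sum.cong) (auto simp: sv_weight_def min_def max_def of_nat_diff)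
  also have "\<dots> = ln (\<alpha> (l - 1))" using assms by simp
  finally show ?thesis using assms by (simp add: ln_svf left_diff_distrib sum_subtractf)
qed

lemma svf_eq_power:
  assumes "real CARD('n) \<le> s"
  shows "singular_value_function s f = singular_value_function (real CARD('n)) f powr (s / real CARD('n))"
proof -
  have "sv_weight CARD('n) s j = sv_weight CARD('n) (real CARD('n)) j * (s / real CARD('n))" if "j < CARD('n)" for j
    using assms that by (auto simp: sv_weight_def min_def max_def)
  then have "(\<Sum>j<CARD('n). sv_weight CARD('n) s j * ln (\<alpha> j)) = s / real CARD('n) * (\<Sum>j<CARD('n). sv_weight CARD('n) (real CARD('n)) j * ln (\<alpha> j))"
    by (simp add: sum_distrib_left mult_ac)
  then show ?thesis using assms by (simp add: svf_eq_exp powr_def)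
qed

text \<open>The scale \<open>\<rho>\<close> leaves the product as \<open>\<rho> powr s\<close>
  because the weights sum to \<open>s\<close>.\<close>

lemma sv_powr_prod:
  assumes "0 \<le> s" "\<rho> > 0"
  shows "(\<Prod>j<CARD('n). (\<alpha> j / \<rho>) powr sv_weight CARD('n) s j) = singular_value_function s f / \<rho> powr s"
proof -
  have "(\<Prod>j<CARD('n). (\<alpha> j / \<rho>) powr sv_weight CARD('n) s j)
      = (\<Prod>j<CARD('n). \<alpha> j powr sv_weight CARD('n) s j) / (\<Prod>j<CARD('n). \<rho> powr sv_weight CARD('n) s j)"
    by (simp add: prod_dividef[symmetric] powr_divide)
  also have "(\<Prod>j<CARD('n). \<alpha> j powr sv_weight CARD('n) s j) = singular_value_function s f"
    unfolding svf_eq_exp[OF assms(1)] exp_sum[OF finite_lessThan]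
    by (intro prod.cong) (auto simp: powr_def dest: sv_pos)
  also have "(\<Prod>j<CARD('n). \<rho> powr sv_weight CARD('n) s j) = \<rho> powr s"
    using assms by (simp add: powr_sum[symmetric] sum_sv_weight)
  finally show ?thesis .
qed

text \<open>The left side is the covering number of the ellipsoid at scale
  \<open>\<alpha> (l - 1)\<close>, up to a constant. At this scale the maximum switches exactly
  where the weights drop from 1 to 0; at \<open>l - 1\<close> itself the quotient is 1, so the
  fractional weight does no harm.\<close>

lemma prod_max_sv_eq:
  assumes l: "1 \<le> l" "l \<le> CARD('n)" "real l - 1 \<le> s" "s \<le> real l"
  shows "(\<Prod>j<CARD('n). max 1 (\<alpha> j / \<alpha> (l - 1))) = singular_value_function s f / \<alpha> (l - 1) powr s"
proof -
  have "max 1 (\<alpha> j / \<alpha> (l - 1)) = (\<alpha> j / \<alpha> (l - 1)) powr sv_weight CARD('n) s j" if j: "j < CARD('n)" for j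
  proof -
    have pos: "\<alpha> (l - 1) > 0" "\<alpha> j > 0" using l j by (auto intro: sv_pos)
    consider "j < l - 1" | "j = l - 1" | "j > l - 1" by linarith
    then show ?thesis
    proof cases
      case 1
      then have "sv_weight CARD('n) s j = 1" using l by (auto simp: sv_weight_def min_def max_def)
      moreover have "\<alpha> (l - 1) \<le> \<alpha> j" using 1 l by (intro sv_mono) auto
      ultimately show ?thesis using pos by (simp add: max_def)
    next
      case 3
      then have "sv_weight CARD('n) s j = 0" using l by (auto simp: sv_weight_def min_def max_def)
      moreover have "\<alpha> j \<le> \<alpha> (l - 1)" using 3 j by (intro sv_mono) auto
      ultimately show ?thesis using pos by (simp add: max_def)
    qed (use pos in auto)
  qed
  then have "(\<Prod>j<CARD('n). max 1 (\<alpha> j / \<alpha> (l - 1))) = (\<Prod>j<CARD('n). (\<alpha> j / \<alpha> (l - 1)) powr sv_weight CARD('n) s j)" by simp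
  then show ?thesis using sv_powr_prod[of s "\<alpha> (l - 1)"] sv_pos[of "l - 1"] l by simp
qed

text \<open>Holds factor by factor: min 1 u <= u^w for u > 0 and w in [0, 1], and the condition
  \<open>s <= N\<close> keeps the weights in that range. The left side is the fraction of a cube cut
  out by a box of half-widths \<open>r / \<alpha> j\<close>.\<close>

lemma prod_min_sv_le:
  assumes s: "0 \<le> s" "s \<le> real CARD('n)" and r: "r > 0"
  shows "(\<Prod>j<CARD('n). min 1 (r / \<alpha> j)) \<le> r powr s / singular_value_function s f"
proof -
  have "(\<Prod>j<CARD('n). min 1 (r / \<alpha> j)) \<le> (\<Prod>j<CARD('n). (r / \<alpha> j) powr sv_weight CARD('n) s j)"
  proof (rule prod_mono, safe)
    fix j assume j: "j < CARD('n)"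
    let ?u = "r / \<alpha> j" let ?w = "sv_weight CARD('n) s j"
    have u: "?u > 0" using sv_pos[OF j] r by simp
    then show "0 \<le> min 1 ?u" by simp
    have w: "0 \<le> ?w" "?w \<le> 1" using s sv_weight_nonneg sv_weight_le_1 by auto
    show "min 1 ?u \<le> ?u powr ?w"
    proof (cases "?u \<le> 1")
      case True
      then have "?u powr 1 \<le> ?u powr ?w" using w u by (intro powr_mono') auto
      then show ?thesis using u True by (metis min.cobounded2 order_trans powr_one less_imp_le)
    next
      case False
      then show ?thesis using w ge_one_powr_ge_zero[of ?u ?w] by simp
    qed
  qed
  also have "\<dots> = (\<Prod>j<CARD('n). inverse ((\<alpha> j / r) powr sv_weight CARD('n) s j))"
  proof (rule prod.cong)
    fix j assume "j \<in> {..<CARD('n)}"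
    then have "\<alpha> j > 0" using sv_pos by simp
    then show "(r / \<alpha> j) powr sv_weight CARD('n) s j = inverse ((\<alpha> j / r) powr sv_weight CARD('n) s j)"
      using r by (simp add: powr_divide)
  qed simp
  also have "\<dots> = r powr s / singular_value_function s f"
    using sv_powr_prod[OF s(1) r] prod_inversef[of "\<lambda>j. (\<alpha> j / r) powr sv_weight CARD('n) s j" "{..<CARD('n)}"]
    by (simp add: o_def)
  finally show ?thesis .
qed

end

section \<open>Covers of ellipsoids and submultiplicativity of the singular value function\<close>

context nonsingular_map
begin

text \<open>The centres form a grid of spacing \<open>\<rho>\<close> along the orthogonal axes
  \<open>f (e j)\<close>, whose lengths are \<open>\<alpha> j\<close>. Rounding down costs at most
  \<open>\<rho>\<close> per axis, which gives the factor N in the radius. Axis j needs at most 2 t +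
  2 <= 4 max 1 t grid values for t = \<open>\<alpha> j / \<rho>\<close>, whence the 4.\<close>

lemma cover_image_unit_ball:
  assumes \<rho>: "\<rho> > 0"
  obtains Z where "finite Z" "Z \<noteq> {}" "f ` cball 0 1 \<subseteq> (\<Union>z\<in>Z. cball z (real CARD('n) * \<rho>))"
    "real (card Z) \<le> 4 ^ CARD('n) * (\<Prod>j<CARD('n). max 1 (\<alpha> j / \<rho>))"
proof (rule singular_value_decomposition[OF lin bij])
  interpret f: linear f by (rule lin)
  fix e assume on: "\<And>i j. i < CARD('n) \<Longrightarrow> j < CARD('n) \<Longrightarrow> e i \<bullet> e j = (if i = j then 1 else 0)"
    and fe: "\<And>i j. i < CARD('n) \<Longrightarrow> j < CARD('n) \<Longrightarrow> f (e i) \<bullet> f (e j) = (if i = j then (\<alpha> i)\<^sup>2 else 0)"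
  define t where "t j = \<alpha> j / \<rho>" for j
  have t: "t j > 0" if "j < CARD('n)" for j using sv_pos[OF that] \<rho> by (simp add: t_def)
  define K where "K = PiE {..<CARD('n)} (\<lambda>j. {\<lfloor>- t j\<rfloor>..\<lfloor>t j\<rfloor>})"
  define \<psi> where "\<psi> k = (\<Sum>j<CARD('n). (\<rho> * real_of_int (k j) / \<alpha> j) *\<^sub>R f (e j))" for k :: "nat \<Rightarrow> int"
  have norm_e: "norm (e j) = 1" if "j < CARD('n)" for j
    using on[OF that that] by (simp add: norm_eq_1)
  have norm_fe: "norm (f (e j)) = \<alpha> j" if "j < CARD('n)" for j
    using fe[OF that that] sv_pos[OF that] by (simp add: norm_eq_sqrt_inner)
  have fin: "finite K" unfolding K_def by (intro finite_PiE) auto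
  have cov: "\<exists>k\<in>K. dist (f x) (\<psi> k) \<le> real CARD('n) * \<rho>" if x: "norm x \<le> 1" for x
  proof -
    define k where "k = (\<lambda>j\<in>{..<CARD('n)}. \<lfloor>(x \<bullet> e j) * t j\<rfloor>)"
    have "\<bar>x \<bullet> e j\<bar> \<le> 1" if "j < CARD('n)" for j
      using Cauchy_Schwarz_ineq2[of x "e j"] x norm_e[OF that] by simp
    then have xe: "- 1 \<le> x \<bullet> e j" "x \<bullet> e j \<le> 1" if "j < CARD('n)" for j using that by (auto simp: abs_le_iff)
    have "- t j \<le> (x \<bullet> e j) * t j" "(x \<bullet> e j) * t j \<le> t j" if "j < CARD('n)" for j
      using mult_right_mono[OF xe(1)[OF that] less_imp_le[OF t[OF that]]]
        mult_right_mono[OF xe(2)[OF that] less_imp_le[OF t[OF that]]] by auto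
    then have "k \<in> K" by (auto simp: K_def k_def intro!: floor_mono)
    have fx: "f x = (\<Sum>j<CARD('n). (x \<bullet> e j) *\<^sub>R f (e j))"
      by (subst orthonormal_expansion[of e x]) (auto simp: on f.sum f.scale)
    have "norm (f x - \<psi> k) \<le> (\<Sum>j<CARD('n). norm ((x \<bullet> e j - \<rho> * real_of_int (k j) / \<alpha> j) *\<^sub>R f (e j)))"
      unfolding fx \<psi>_def sum_subtractf[symmetric] scaleR_left_diff_distrib[symmetric] by (rule norm_sum)
    also have "\<dots> \<le> (\<Sum>j<CARD('n). \<rho>)"
    proof (rule sum_mono)
      fix j assume "j \<in> {..<CARD('n)}"
      then have j: "j < CARD('n)" by simp
      note aj = sv_pos[OF j]
      have "norm ((x \<bullet> e j - \<rho> * real_of_int (k j) / \<alpha> j) *\<^sub>R f (e j))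
          = \<bar>(x \<bullet> e j - \<rho> * real_of_int (k j) / \<alpha> j) * \<alpha> j\<bar>"
        using aj by (simp add: norm_fe[OF j] abs_mult)
      also have "(x \<bullet> e j - \<rho> * real_of_int (k j) / \<alpha> j) * \<alpha> j = \<rho> * ((x \<bullet> e j) * t j - of_int (k j))"
        using aj \<rho> by (simp add: t_def field_simps)
      also have "\<bar>\<dots>\<bar> = \<rho> * \<bar>(x \<bullet> e j) * t j - of_int (k j)\<bar>" using \<rho> by (simp add: abs_mult)
      also have "\<dots> \<le> \<rho> * 1" using \<rho> j by (intro mult_left_mono) (simp_all add: k_def abs_if, linarith+)
      finally show "norm ((x \<bullet> e j - \<rho> * real_of_int (k j) / \<alpha> j) *\<^sub>R f (e j)) \<le> \<rho>" by simp
    qed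
    finally show ?thesis using \<open>k \<in> K\<close> by (auto simp: dist_norm)
  qed
  have "real (card (\<psi> ` K)) \<le> real (card K)" using fin by (simp add: card_image_le)
  also have "\<dots> = (\<Prod>j<CARD('n). real (card {\<lfloor>- t j\<rfloor>..\<lfloor>t j\<rfloor>}))"
    by (simp add: K_def card_PiE)
  also have "\<dots> \<le> (\<Prod>j<CARD('n). 4 * max 1 (t j))"
  proof (rule prod_mono, safe)
    fix j assume "j < CARD('n)"
    note t = t[OF this]
    have "\<lfloor>- t j\<rfloor> \<le> \<lfloor>t j\<rfloor>" using t by (intro floor_mono) auto
    then have "real (card {\<lfloor>- t j\<rfloor>..\<lfloor>t j\<rfloor>}) = of_int \<lfloor>t j\<rfloor> - of_int \<lfloor>- t j\<rfloor> + 1" by simp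
    also have "\<dots> \<le> t j - (- t j - 1) + 1" by linarith
    also have "\<dots> \<le> 4 * max 1 (t j)" by simp
    finally show "real (card {\<lfloor>- t j\<rfloor>..\<lfloor>t j\<rfloor>}) \<le> 4 * max 1 (t j)" .
  qed simp
  also have "\<dots> = 4 ^ CARD('n) * (\<Prod>j<CARD('n). max 1 (t j))" by (simp add: prod.distrib)
  finally have card: "real (card (\<psi> ` K)) \<le> \<dots>" .
  have "\<psi> ` K \<noteq> {}" using cov[of 0] by auto
  show thesis
  proof (rule that)
    show "f ` cball 0 1 \<subseteq> (\<Union>z\<in>\<psi> ` K. cball z (real CARD('n) * \<rho>))"
    proof
      fix y assume "y \<in> f ` cball 0 1"
      then obtain x where "norm x \<le> 1" "y = f x" by auto
      with cov[of x] show "y \<in> (\<Union>z\<in>\<psi> ` K. cball z (real CARD('n) * \<rho>))" by (auto simp: dist_commute)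
    qed
  qed (use fin \<open>\<psi> ` K \<noteq> {}\<close> card in \<open>auto simp: t_def\<close>)
qed

text \<open>
  A cover of \<open>f ` cball 0 1\<close> pulls back, in coordinates with respect to the singular vectors, to a
  cover of a fixed cube by boxes; comparing volumes bounds \<open>\<phi>\<^sup>s\<close> by the Hausdorff content.
\<close>

lemma svf_le_cover_sum:
  assumes s: "0 \<le> s" "s \<le> real CARD('n)" and fin: "finite I" and r: "\<And>i. i \<in> I \<Longrightarrow> r i > 0"
    and cov: "f ` cball 0 1 \<subseteq> (\<Union>i\<in>I. cball (z i) (r i))"
  shows "singular_value_function s f \<le> real CARD('n) powr s * (\<Sum>i\<in>I. r i powr s)"
proof (rule singular_value_decomposition[OF lin bij])
  interpret f: linear f by (rule lin)
  fix e assume on: "\<And>i j. i < CARD('n) \<Longrightarrow> j < CARD('n) \<Longrightarrow> e i \<bullet> e j = (if i = j then 1 else 0)"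
    and fe: "\<And>i j. i < CARD('n) \<Longrightarrow> j < CARD('n) \<Longrightarrow> f (e i) \<bullet> f (e j) = (if i = j then (\<alpha> i)\<^sup>2 else 0)"
  define M where "M = real CARD('n)"
  have M: "M \<ge> 1" "M > 0" by (auto simp: M_def Suc_le_eq)
  \<comment> \<open>The singular vectors are numbered by naturals and the coordinates by the index
    type; \<open>h\<close> translates between them.\<close>
  obtain h where h: "bij_betw h (UNIV :: 'n set) {..<CARD('n)}"
    using ex_bij_betw_finite_nat[of "UNIV :: 'n set"] by (auto simp: atLeast0LessThan)
  have hN: "h j < CARD('n)" for j using bij_betwE[OF h] by auto
  have inj: "h i = h j \<longleftrightarrow> i = j" for i j using bij_betw_imp_inj_on[OF h] by (auto simp: inj_on_def)
  define L where "L x = (\<Sum>i\<in>UNIV. (x $ i) *\<^sub>R e (h i))" for x :: "real^'n"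
  have fL: "f (L x) \<bullet> f (e (h j)) = x $ j * (\<alpha> (h j))\<^sup>2" for x j
  proof -
    have "f (L x) \<bullet> f (e (h j)) = (\<Sum>i\<in>UNIV. x $ i * (f (e (h i)) \<bullet> f (e (h j))))"
      by (simp add: L_def f.sum f.scale inner_sum_left)
    also have "\<dots> = (\<Sum>i\<in>UNIV. if i = j then x $ i * (\<alpha> (h i))\<^sup>2 else 0)"
      by (intro sum.cong) (auto simp: fe hN inj)
    finally show ?thesis by simp
  qed
  \<comment> \<open>The half-width 1 / N makes \<open>L\<close> map \<open>Q\<close> into the unit
    ball, by the triangle inequality over the N coordinates.\<close>
  define Q :: "(real^'n) set" where "Q = cbox (\<chi> i. - (1 / M)) (\<chi> i. 1 / M)"
  \<comment> \<open>\<open>cbox (a i) (b i)\<close> contains the points of \<open>Q\<close> that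
    ball \<open>i\<close> can account for: pairing with \<open>f (e (h j))\<close>, a vector of
    length \<open>\<alpha> (h j)\<close> orthogonal to the other axes, fixes coordinate
    \<open>j\<close> up to \<open>r i / \<alpha> (h j)\<close>. Clipping to \<open>Q\<close> also
    bounds each side by 2 / M.\<close>
  define a where "a i = (\<chi> j. max (- (1 / M)) ((z i \<bullet> f (e (h j)) - r i * \<alpha> (h j)) / (\<alpha> (h j))\<^sup>2))" for i
  define b where "b i = (\<chi> j. min (1 / M) ((z i \<bullet> f (e (h j)) + r i * \<alpha> (h j)) / (\<alpha> (h j))\<^sup>2))" for i
  have norm_e: "norm (e j) = 1" if "j < CARD('n)" for j
    using on[OF that that] by (simp add: norm_eq_1)
  have norm_fe: "norm (f (e j)) = \<alpha> j" if "j < CARD('n)" for j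
    using fe[OF that that] sv_pos[OF that] by (simp add: norm_eq_sqrt_inner)
  have "Q \<subseteq> (\<Union>i\<in>I. cbox (a i) (b i))"
  proof
    fix x assume "x \<in> Q"
    then have x: "- (1 / M) \<le> x $ j" "x $ j \<le> 1 / M" for j by (auto simp: Q_def mem_box_cart)
    have "norm (L x) \<le> (\<Sum>i\<in>UNIV. norm ((x $ i) *\<^sub>R e (h i)))" unfolding L_def by (rule norm_sum)
    also have "\<dots> \<le> (\<Sum>i\<in>(UNIV :: 'n set). 1 / M)"
    proof (rule sum_mono)
      fix i show "norm ((x $ i) *\<^sub>R e (h i)) \<le> 1 / M" using x[of i] by (simp add: norm_e hN abs_le_iff)
    qed
    also have "\<dots> = 1" using M by (simp add: M_def)
    finally have "f (L x) \<in> f ` cball 0 1" by auto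
    then obtain i where i: "i \<in> I" "dist (z i) (f (L x)) \<le> r i" using cov by auto
    have "\<bar>x $ j * (\<alpha> (h j))\<^sup>2 - z i \<bullet> f (e (h j))\<bar> \<le> r i * \<alpha> (h j)" for j
    proof -
      have "\<bar>x $ j * (\<alpha> (h j))\<^sup>2 - z i \<bullet> f (e (h j))\<bar> = \<bar>(f (L x) - z i) \<bullet> f (e (h j))\<bar>"
        by (simp add: inner_diff_left fL)
      also have "\<dots> \<le> norm (f (L x) - z i) * norm (f (e (h j)))" by (rule Cauchy_Schwarz_ineq2)
      also have "\<dots> \<le> r i * \<alpha> (h j)"
        using i(2) sv_pos[OF hN] by (intro mult_mono) (auto simp: norm_fe hN dist_norm norm_minus_commute less_imp_le r[OF i(1)])
      finally show ?thesis .
    qed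
    then have bd: "z i \<bullet> f (e (h j)) - r i * \<alpha> (h j) \<le> x $ j * (\<alpha> (h j))\<^sup>2"
      "x $ j * (\<alpha> (h j))\<^sup>2 \<le> z i \<bullet> f (e (h j)) + r i * \<alpha> (h j)" for j
      by (simp_all add: abs_le_iff algebra_simps)
    have "(\<alpha> (h j))\<^sup>2 > 0" for j using sv_pos[OF hN[of j]] by simp
    then have "x \<in> cbox (a i) (b i)"
      using x bd by (auto simp: a_def b_def mem_box_cart pos_divide_le_eq pos_le_divide_eq)
    then show "x \<in> (\<Union>i\<in>I. cbox (a i) (b i))" using i(1) by blast
  qed
  then have "measure lborel Q \<le> measure lborel (\<Union>i\<in>I. cbox (a i) (b i))"
    using fin by (intro measure_mono_fmeasurable) (auto simp: Q_def intro!: fmeasurable.finite_UN)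
  also have "\<dots> \<le> (\<Sum>i\<in>I. measure lborel (cbox (a i) (b i)))"
    using fin by (intro measure_UNION_le) auto
  also have "\<dots> \<le> (\<Sum>i\<in>I. (\<Prod>j\<in>UNIV. 2 / M * min 1 (M * r i / \<alpha> (h j))))"
  proof (rule sum_mono)
    fix i assume i: "i \<in> I"
    have nn: "0 \<le> 2 / M * min 1 (M * r i / \<alpha> (h j))" for j
      using M r[OF i] sv_pos[OF hN] by (simp add: less_imp_le)
    show "measure lborel (cbox (a i) (b i)) \<le> (\<Prod>j\<in>UNIV. 2 / M * min 1 (M * r i / \<alpha> (h j)))"
    proof (cases "cbox (a i) (b i) = {}")
      case False
      have "measure lborel (cbox (a i) (b i)) = (\<Prod>j\<in>UNIV. b i $ j - a i $ j)"
        by (rule content_cbox_cart[OF False])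
      also have "\<dots> \<le> (\<Prod>j\<in>UNIV. 2 / M * min 1 (M * r i / \<alpha> (h j)))"
      proof (rule prod_mono, safe)
        fix j
        show "0 \<le> b i $ j - a i $ j" using False by (auto simp: interval_ne_empty_cart)
        have "b i $ j - a i $ j \<le> 2 / M" by (simp add: a_def b_def field_simps)
        moreover have "b i $ j - a i $ j \<le> (z i \<bullet> f (e (h j)) + r i * \<alpha> (h j)) / (\<alpha> (h j))\<^sup>2
            - (z i \<bullet> f (e (h j)) - r i * \<alpha> (h j)) / (\<alpha> (h j))\<^sup>2"
          unfolding a_def b_def by simp
        moreover have "\<dots> = 2 / M * (M * r i / \<alpha> (h j))"
          using M sv_pos[OF hN[of j]] by (simp add: field_simps power2_eq_square)
        moreover have "2 / M * min 1 (M * r i / \<alpha> (h j)) = min (2 / M) (2 / M * (M * r i / \<alpha> (h j)))"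
          using M by (subst min_mult_distrib_left) auto
        ultimately show "b i $ j - a i $ j \<le> 2 / M * min 1 (M * r i / \<alpha> (h j))" by linarith
      qed
      finally show ?thesis .
    next
      case True
      then show ?thesis using prod_nonneg[of UNIV "\<lambda>j. 2 / M * min 1 (M * r i / \<alpha> (h j))"] nn by simp
    qed
  qed
  also have "\<dots> = (\<Sum>i\<in>I. (2 / M) ^ CARD('n) * (\<Prod>j<CARD('n). min 1 (M * r i / \<alpha> j)))"
    unfolding prod.distrib prod_constant
    by (intro sum.cong refl arg_cong2[of _ _ _ _ "(*)"] prod.reindex_bij_betw[OF h])
  also have "\<dots> = (2 / M) ^ CARD('n) * (\<Sum>i\<in>I. \<Prod>j<CARD('n). min 1 (M * r i / \<alpha> j))"
    by (simp add: sum_distrib_left)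
  also have "measure lborel Q = (2 / M) ^ CARD('n)"
    using M by (simp add: Q_def content_cbox_if_cart interval_eq_empty_cart)
  \<comment> \<open>The volume of \<open>Q\<close> cancels against the factor pulled out of every
    box, which leaves volume fractions that add up to at least 1.\<close>
  finally have "1 \<le> (\<Sum>i\<in>I. \<Prod>j<CARD('n). min 1 (M * r i / \<alpha> j))"
    using M by simp
  also have "\<dots> \<le> (\<Sum>i\<in>I. (M * r i) powr s / singular_value_function s f)"
    using M r by (intro sum_mono prod_min_sv_le[OF s]) auto
  also have "\<dots> = M powr s * (\<Sum>i\<in>I. r i powr s) / singular_value_function s f"
    using M r by (simp add: powr_mult sum_divide_distrib[symmetric] sum_distrib_left[symmetric] less_imp_le)
  finally show ?thesis using svf_pos[OF s(1)] by (simp add: M_def)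
qed

end

lemma nonsingular_map_compose:
  "nonsingular_map f \<Longrightarrow> nonsingular_map g \<Longrightarrow> nonsingular_map (f \<circ> g)"
  unfolding nonsingular_map_def by (auto intro: linear_compose bij_comp)

lemma ceiling_level:
  assumes "0 < s" "s \<le> real n"
  obtains l where "1 \<le> l" "l \<le> n" "real l - 1 \<le> s" "s \<le> real l"
  using assms by (intro that[of "nat \<lceil>s\<rceil>"]) linarith+

text \<open>For exponents between l - 1 and l, the singular value \<alpha>_l is the radius at which
  a cover by equal balls attains the size \<phi>^s up to a constant.\<close>

lemma (in nonsingular_map) svf_cover:
  assumes l: "1 \<le> l" "l \<le> CARD('n)" "real l - 1 \<le> s" "s \<le> real l"
  obtains Z where "finite Z" "Z \<noteq> {}" "f ` cball 0 1 \<subseteq> (\<Union>z\<in>Z. cball z (real CARD('n) * \<alpha> (l - 1)))"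
    "real (card Z) * \<alpha> (l - 1) powr s \<le> 4 ^ CARD('n) * singular_value_function s f"
proof -
  have pos: "\<alpha> (l - 1) > 0" using l by (intro sv_pos) linarith
  obtain Z where Z: "finite Z" "Z \<noteq> {}" "f ` cball 0 1 \<subseteq> (\<Union>z\<in>Z. cball z (real CARD('n) * \<alpha> (l - 1)))"
    "real (card Z) \<le> 4 ^ CARD('n) * (\<Prod>j<CARD('n). max 1 (\<alpha> j / \<alpha> (l - 1)))"
    using cover_image_unit_ball[OF pos] .
  from Z(4)[unfolded prod_max_sv_eq[OF l]]
  have "real (card Z) * \<alpha> (l - 1) powr s \<le> 4 ^ CARD('n) * singular_value_function s f"
    using pos by (simp add: pos_le_divide_eq)
  with Z that show thesis by blast
qed

text \<open>
  The Hausdorff content of the image of a ball is submultiplicative up to constants: cover \<open>g(B)\<close>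
  by balls, and the image under \<open>f\<close> of each of them by a rescaled cover of \<open>f(B)\<close>.
\<close>

lemma svf_compose_le_explicit:
  fixes f g :: "real^'n \<Rightarrow> real^'n"
  assumes f: "nonsingular_map f" and g: "nonsingular_map g" and s: "0 < s" "s \<le> real CARD('n)"
  shows "singular_value_function s (f \<circ> g) \<le>
    (16 ^ CARD('n) * real CARD('n) powr (3 * s)) * (singular_value_function s f * singular_value_function s g)"
proof -
  interpret f: nonsingular_map f by (rule f)
  interpret g: nonsingular_map g by (rule g)
  interpret fg: nonsingular_map "f \<circ> g"
    by (rule nonsingular_map_compose[OF f g])
  interpret lf: linear f by (rule f.lin)
  define M where "M = real CARD('n)"
  have M: "M > 0" by (simp add: M_def)
  obtain l where l: "1 \<le> l" "l \<le> CARD('n)" "real l - 1 \<le> s" "s \<le> real l"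
    using ceiling_level[OF s] .
  define p where "p = f.\<alpha> (l - 1)"
  define q where "q = g.\<alpha> (l - 1)"
  have "l - 1 < CARD('n)" using l by linarith
  then have pq: "p > 0" "q > 0" using f.sv_pos g.sv_pos by (auto simp: p_def q_def)
  obtain Y where Y: "finite Y" "Y \<noteq> {}" "f ` cball 0 1 \<subseteq> (\<Union>z\<in>Y. cball z (M * p))"
    "real (card Y) * p powr s \<le> 4 ^ CARD('n) * singular_value_function s f"
    using f.svf_cover[OF l, folded M_def p_def] .
  obtain Z where Z: "finite Z" "Z \<noteq> {}" "g ` cball 0 1 \<subseteq> (\<Union>z\<in>Z. cball z (M * q))"
    "real (card Z) * q powr s \<le> 4 ^ CARD('n) * singular_value_function s g"
    using g.svf_cover[OF l, folded M_def q_def] .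
  \<comment> \<open>A ball of radius \<open>M * q\<close> about \<open>z\<close> is a translate of a
    dilated unit ball, so \<open>f\<close> maps it into the cover of the unit image dilated by
    \<open>M * q\<close> and moved to \<open>f z\<close>.\<close>
  have "(f \<circ> g) ` cball 0 1 \<subseteq> (\<Union>i\<in>Z \<times> Y. cball (f (fst i) + (M * q) *\<^sub>R snd i) (M * q * (M * p)))"
  proof
    fix v assume "v \<in> (f \<circ> g) ` cball 0 1"
    then obtain x where "x \<in> cball 0 1" "v = f (g x)" by auto
    then obtain z where z: "z \<in> Z" "dist z (g x) \<le> M * q" using Z(3) by fastforce
    define u where "u = (g x - z) /\<^sub>R (M * q)"
    have "u \<in> cball 0 1" using z(2) M pq
      by (simp add: u_def dist_norm norm_minus_commute inverse_eq_divide pos_divide_le_eq)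
    then obtain y where y: "y \<in> Y" "dist y (f u) \<le> M * p" using Y(3) by fastforce
    have "M * q \<noteq> 0" using M pq by simp
    then have "(M * q) *\<^sub>R u = g x - z" by (simp only: u_def scaleR_scaleR right_inverse[OF \<open>M * q \<noteq> 0\<close>] scaleR_one)
    then have "g x = z + (M * q) *\<^sub>R u" by simp
    then have "f (g x) = f z + (M * q) *\<^sub>R f u" by (simp only: lf.add lf.scale)
    then have "dist (f z + (M * q) *\<^sub>R y) v = M * q * dist y (f u)"
      using M pq \<open>v = f (g x)\<close> by (simp add: dist_norm scaleR_diff_right[symmetric])
    also have "\<dots> \<le> M * q * (M * p)" using y M pq by (intro mult_left_mono) auto
    finally show "v \<in> (\<Union>i\<in>Z \<times> Y. cball (f (fst i) + (M * q) *\<^sub>R snd i) (M * q * (M * p)))"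
      using z y by (intro UN_I[of "(z, y)"]) auto
  qed
  then have "singular_value_function s (f \<circ> g) \<le> M powr s * (\<Sum>i\<in>Z \<times> Y. (M * q * (M * p)) powr s)"
    unfolding M_def using s Y(1) Z(1) pq by (intro fg.svf_le_cover_sum) auto
  \<comment> \<open>One power of M comes from comparing \<phi>^s with a cover and one from each of
    the two radii; the two cardinalities contribute 4 ^ N each, hence 16 ^ N.\<close>
  also have "\<dots> = M powr s * M powr s * M powr s * ((real (card Z) * q powr s) * (real (card Y) * p powr s))"
    using M pq by (simp add: card_cartesian_product powr_mult less_imp_le)
  also have "\<dots> \<le> M powr s * M powr s * M powr s * ((4 ^ CARD('n) * singular_value_function s g) * (4 ^ CARD('n) * singular_value_function s f))"
    using s g.svf_pos[of s] by (intro mult_left_mono mult_mono[OF Z(4) Y(4)]) (auto simp: less_imp_le)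
  also have "M powr s * M powr s * M powr s = M powr (3 * s)" by (simp add: powr_add[symmetric])
  also have "M powr (3 * s) * ((4 ^ CARD('n) * singular_value_function s g) * (4 ^ CARD('n) * singular_value_function s f))
     = (16 ^ CARD('n) * M powr (3 * s)) * (singular_value_function s f * singular_value_function s g)"
    using power_mult_distrib[of "4 :: real" 4 "CARD('n)"] by simp
  finally show ?thesis by (simp only: M_def)
qed

text \<open>The constant depends only on \<open>s\<close> and the dimension. For s > N the
  inequality at N is raised to the power s / N.\<close>

lemma svf_compose_le:
  fixes s :: real
  assumes s: "0 \<le> s"
  obtains C where "C \<ge> 1" "\<And>f g :: real^'n \<Rightarrow> real^'n. nonsingular_map f \<Longrightarrow> nonsingular_map g \<Longrightarrow>
    singular_value_function s (f \<circ> g) \<le> C * (singular_value_function s f * singular_value_function s g)"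
proof -
  define D where "D t = 16 ^ CARD('n) * real CARD('n) powr (3 * t)" for t
  have "real CARD('n) powr (3 * t) \<ge> 1" if "t > 0" for t
    using that by (intro ge_one_powr_ge_zero) (auto simp: Suc_le_eq)
  then have D1: "D t \<ge> 1" if "t > 0" for t
    using that mult_mono[of 1 "16 ^ CARD('n)" 1 "real CARD('n) powr (3 * t)"] by (simp add: D_def)
  consider "s = 0" | "0 < s" "s \<le> CARD('n)" | "s > CARD('n)" using s by linarith
  then show thesis
  proof cases
    case 1
    then show thesis by (intro that[of 1]) (auto simp: singular_value_function_def)
  next
    case 2
    then show thesis using D1[of s] by (intro that[of "D s"]) (auto simp: D_def intro: svf_compose_le_explicit)
  next
    case 3
    let ?n = "real CARD('n)"
    have n: "0 < ?n" by simp
    show thesis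
    proof (rule that[of "D ?n powr (s / ?n)"])
      show "1 \<le> D ?n powr (s / ?n)" using 3 D1[OF n] by (intro ge_one_powr_ge_zero) auto
      fix f g :: "real^'n \<Rightarrow> real^'n" assume f: "nonsingular_map f" and g: "nonsingular_map g"
      interpret f: nonsingular_map f by (rule f)
      interpret g: nonsingular_map g by (rule g)
      interpret fg: nonsingular_map "f \<circ> g"
        by (rule nonsingular_map_compose[OF f g])
      have pos: "singular_value_function ?n f > 0" "singular_value_function ?n g > 0"
        using f.svf_pos[of ?n] g.svf_pos[of ?n] by auto
      have "singular_value_function s (f \<circ> g) = singular_value_function ?n (f \<circ> g) powr (s / ?n)"
        using 3 by (intro fg.svf_eq_power) auto
      also have "\<dots> \<le> (D ?n * (singular_value_function ?n f * singular_value_function ?n g)) powr (s / ?n)"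
        using 3 svf_compose_le_explicit[OF f g n] fg.svf_pos[of ?n] by (intro powr_mono2) (auto simp: D_def)
      also have "\<dots> = D ?n powr (s / ?n) * (singular_value_function s f * singular_value_function s g)"
        using 3 pos D1[OF n] by (simp add: powr_mult f.svf_eq_power[of s] g.svf_eq_power[of s])
      finally show "singular_value_function s (f \<circ> g) \<le> \<dots>" .
    qed
  qed
qed

section \<open>Words and the Bernoulli measure\<close>

lemma finite_words: "finite {w :: 'm::finite list. length w = n}"
  using finite_lists_length_eq[of "UNIV :: 'm set" n] by simp

lemma sum_words_append:
  fixes g :: "'m::finite list \<Rightarrow> 'b::comm_monoid_add"
  shows "(\<Sum>w | length w = m + n. g w) = (\<Sum>u | length u = m. \<Sum>v | length v = n. g (u @ v))"
proof -
  have "(\<Sum>u | length u = m. \<Sum>v | length v = n. g (u @ v))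
      = (\<Sum>(u, v) \<in> {u. length u = m} \<times> {v. length v = n}. g (u @ v))"
    by (simp add: sum.cartesian_product)
  also have "\<dots> = (\<Sum>w | length w = m + n. g w)"
    by (rule sum.reindex_bij_witness[of _ "\<lambda>w. (take m w, drop m w)" "\<lambda>(u, v). u @ v"]) auto
  finally show ?thesis ..
qed

text \<open>Extends a bound per block of length \<open>q\<close> to all lengths: the incomplete last
  block changes the linear term by at most one \<open>c\<close> in absolute value.\<close>

lemma linear_bound_of_blocks:
  fixes c D u :: real and n q :: nat
  assumes "q > 0" and u: "u \<le> real (n div q) * c + D"
  shows "u \<le> real n * (c / real q) + (\<bar>c\<bar> + D)"
proof -
  have "real n = real (n div q) * real q + real (n mod q)"
    by (metis div_mult_mod_eq of_nat_add of_nat_mult)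
  then have "real (n div q) * c = real n * (c / real q) - real (n mod q) / real q * c"
    using assms by (simp add: field_simps)
  moreover have "\<bar>real (n mod q) / real q * c\<bar> \<le> 1 * \<bar>c\<bar>"
    unfolding abs_mult using assms by (intro mult_right_mono) (auto simp: divide_le_eq less_imp_le)
  ultimately show ?thesis using u by linarith
qed

lemma eventually_linear_bound:
  fixes b c D :: real
  assumes "b < c" shows "eventually (\<lambda>n. real n * b + D \<le> real n * c) sequentially"
proof -
  have "eventually (\<lambda>n. real n > D / (c - b)) sequentially"
    using filterlim_real_sequentially unfolding filterlim_at_top_dense by blast
  then show ?thesis
  proof eventually_elim
    case (elim n)
    then have "D < real n * (c - b)" using assms by (simp add: pos_divide_less_eq)
    then show ?case by (simp add: right_diff_distrib)
  qed
qed

lemma code_prefix_add: "code_prefix x (m + n) = code_prefix x m @ code_prefix (\<lambda>k. x (k + m)) n"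
  by (rule nth_equalityI) (auto simp: code_prefix_def nth_append)

lemma length_code_prefix [simp]: "length (code_prefix x n) = n"
  by (simp add: code_prefix_def)

lemma code_prefix_0 [simp]: "code_prefix x 0 = []"
  by (simp add: code_prefix_def)

lemma code_prefix_Suc: "code_prefix x (Suc n) = code_prefix x n @ [x n]"
  by (simp add: code_prefix_def)

lemma mem_cylinder_iff: "x \<in> cylinder w \<longleftrightarrow> code_prefix x (length w) = w"
proof -
  have "code_prefix x (length w) = w \<longleftrightarrow> (\<forall>k<length w. code_prefix x (length w) ! k = w ! k)"
    by (simp add: list_eq_iff_nth_eq)
  then show ?thesis by (simp add: cylinder_def code_prefix_def)
qed

locale bernoulli =
  fixes p :: "'m::finite \<Rightarrow> real" and \<mu> :: "(nat \<Rightarrow> 'm) measure"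
  assumes p_pos: "\<And>i. p i > 0" and p_sum: "(\<Sum>i\<in>UNIV. p i) = 1" and mu: "bernoulli_measure p \<mu>"
begin

definition weight :: "'m list \<Rightarrow> real" where "weight w = prod_list (map p w)"

definition average :: "('m list \<Rightarrow> real) \<Rightarrow> nat \<Rightarrow> real" where
  "average a n = (\<Sum>w | length w = n. weight w * a w)"

definition shift :: "(nat \<Rightarrow> 'm) \<Rightarrow> (nat \<Rightarrow> 'm)" where "shift x = (\<lambda>k. x (Suc k))"

sublocale prob_space \<mu> using mu by (simp add: bernoulli_measure_def)

lemma sets_mu: "sets \<mu> = sets (\<Pi>\<^sub>M k\<in>(UNIV :: nat set). count_space (UNIV :: 'm set))"
  using mu by (simp add: bernoulli_measure_def)

lemma space_mu [simp]: "space \<mu> = UNIV"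
  using sets_eq_imp_space_eq[OF sets_mu] by (simp add: space_PiM)

lemma measure_cylinder: "measure \<mu> (cylinder w) = weight w"
  using mu by (simp add: bernoulli_measure_def weight_def)

lemma weight_append: "weight (u @ v) = weight u * weight v"
  by (simp add: weight_def)

lemma weight_pos: "weight w > 0"
  by (induction w) (auto simp: weight_def p_pos)

lemma weight_nonneg: "weight w \<ge> 0"
  using weight_pos[of w] by simp

lemma sum_weight: "(\<Sum>w | length w = n. weight w) = 1"
proof (induction n)
  case 0 then show ?case by (simp add: weight_def)
next
  case (Suc n)
  have "(\<Sum>w | length w = 1 + n. weight w) = (\<Sum>u | length u = 1. weight u) * (\<Sum>v | length v = n. weight v)"
    unfolding sum_words_append weight_append by (simp add: sum_product)
  also have "(\<Sum>u | length u = (1::nat). weight u) = (\<Sum>i\<in>UNIV. p i)"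
    by (rule sum.reindex_bij_witness[of _ "\<lambda>i. [i]" hd]) (auto simp: weight_def length_Suc_conv)
  finally show ?case using Suc p_sum by simp
qed

section \<open>Measurability, generation by cylinders and shift invariance\<close>

lemma coordinate_measurable [measurable]: "(\<lambda>x. x k) \<in> \<mu> \<rightarrow>\<^sub>M count_space UNIV"
  unfolding measurable_cong_sets[OF sets_mu refl] by measurable

lemma code_prefix_measurable [measurable]: "(\<lambda>x. code_prefix x n) \<in> \<mu> \<rightarrow>\<^sub>M count_space UNIV"
proof (induction n)
  case (Suc n)
  have "(\<lambda>x. (\<lambda>(u, i). u @ [i]) (code_prefix x n, x n)) \<in> \<mu> \<rightarrow>\<^sub>M count_space UNIV"
    using Suc by (intro measurable_compose[OF measurable_Pair[of _ _ "count_space UNIV" _ "count_space UNIV"]])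
      (auto simp: pair_measure_countable)
  then show ?case by (simp add: code_prefix_Suc)
qed simp

lemma cylinder_sets [measurable]: "cylinder w \<in> sets \<mu>"
proof -
  have "cylinder w = (\<lambda>x. code_prefix x (length w)) -` {w} \<inter> space \<mu>" by (auto simp: mem_cylinder_iff)
  moreover have "\<dots> \<in> sets \<mu>" by (rule measurable_sets[OF code_prefix_measurable]) simp
  ultimately show ?thesis by simp
qed

lemma integral_code_prefix:
  fixes g :: "'m list \<Rightarrow> real"
  shows "(\<integral>x. g (code_prefix x n) \<partial>\<mu>) = (\<Sum>w | length w = n. weight w * g w)"
proof -
  have "g (code_prefix x n) = (\<Sum>w | length w = n. indicator (cylinder w) x * g w)" for x
  proof -
    have "(\<Sum>w | length w = n. indicator (cylinder w) x * g w)
        = (\<Sum>w | length w = n. if w = code_prefix x n then g w else 0)"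
      by (intro sum.cong) (auto simp: mem_cylinder_iff indicator_def)
    then show ?thesis by (simp add: finite_words)
  qed
  then have "(\<integral>x. g (code_prefix x n) \<partial>\<mu>) = (\<integral>x. (\<Sum>w | length w = n. indicator (cylinder w) x * g w) \<partial>\<mu>)"
    by simp
  also have "\<dots> = (\<Sum>w | length w = n. \<integral>x. indicator (cylinder w) x * g w \<partial>\<mu>)"
    by (intro Bochner_Integration.integral_sum integrable_mult_left integrable_real_indicator)
       (auto simp: less_top[symmetric])
  finally show ?thesis by (simp add: measure_cylinder)
qed

lemma integrable_code_prefix [simp]: "integrable \<mu> (\<lambda>x. g (code_prefix x n) :: real)"
proof (rule integrable_const_bound[where B = "\<Sum>w | length w = n. \<bar>g w\<bar>"])
  show "AE x in \<mu>. norm (g (code_prefix x n)) \<le> (\<Sum>w | length w = n. \<bar>g w\<bar>)"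
    by (intro AE_I2) (auto intro!: member_le_sum simp: finite_words)
qed simp

text \<open>A coordinate event is a finite union of cylinders, as the alphabet is finite. The empty
  set is added to the generator because it is the intersection of two incompatible
  cylinders.\<close>

lemma sigma_cylinders: "sets \<mu> = sigma_sets UNIV (insert {} (range cylinder))" (is "_ = ?S")
proof
  show "?S \<subseteq> sets \<mu>" using sigma_sets_le_sets_iff[of \<mu> "insert {} (range cylinder)"] by auto
  have "{x. x i \<in> A} \<in> ?S" for i and A :: "'m set"
  proof -
    have "{x. x i \<in> A} = (\<Union>w\<in>{w. length w = Suc i \<and> w ! i \<in> A}. cylinder w)"
    proof (intro equalityI subsetI)
      fix x assume "x \<in> {x. x i \<in> A}"
      moreover have "code_prefix x (Suc i) ! i = x i" by (simp add: code_prefix_def del: upt_Suc)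
      ultimately show "x \<in> (\<Union>w\<in>{w. length w = Suc i \<and> w ! i \<in> A}. cylinder w)"
        by (intro UN_I[of "code_prefix x (Suc i)"]) (auto simp: mem_cylinder_iff)
    next
      fix x assume "x \<in> (\<Union>w\<in>{w. length w = Suc i \<and> w ! i \<in> A}. cylinder w)"
      then show "x \<in> {x. x i \<in> A}" by (auto simp: cylinder_def)
    qed
    also have "\<dots> \<in> ?S"
      by (intro sigma_sets_UNION countable_finite finite_imageI finite_subset[OF _ finite_words[of "Suc i"]])
        (auto intro: sigma_sets.Basic)
    finally show ?thesis .
  qed
  then have gen: "{{f \<in> UNIV. f i \<in> A} |i A. i \<in> UNIV \<and> A \<in> sets (count_space UNIV)} \<subseteq> ?S" by auto
  have sp: "(UNIV \<rightarrow>\<^sub>E space (count_space UNIV)) = (UNIV :: (nat \<Rightarrow> 'm) set)"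
    by (simp add: PiE_UNIV_domain)
  show "sets \<mu> \<subseteq> ?S"
    unfolding sets_mu sets_PiM_single sp by (rule sigma_sets_mono[OF gen])
qed

text \<open>Two cylinders are nested or disjoint, so together with the empty set they form an
  intersection-stable generator.\<close>

lemma measure_eqI_cylinders:
  assumes "sets M = sets \<mu>" "\<And>w. emeasure M (cylinder w) = emeasure \<mu> (cylinder w)"
  shows "M = \<mu>"
proof (rule measure_eqI_generator_eq[of "insert {} (range cylinder)" UNIV _ _ "\<lambda>_. cylinder []"])
  have int: "cylinder u \<inter> cylinder v \<in> insert {} (range cylinder)" for u v :: "'m list"
  proof -
    have *: "cylinder u \<inter> cylinder v \<in> insert {} (range cylinder)" if l: "length u \<le> length v" for u v :: "'m list"
    proof (cases "\<forall>k<length u. u ! k = v ! k")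
      case True
      then have "cylinder u \<inter> cylinder v = cylinder v" using l by (auto simp: cylinder_def)
      then show ?thesis by simp
    next
      case False
      then have "cylinder u \<inter> cylinder v = {}" using l by (force simp: cylinder_def)
      then show ?thesis by simp
    qed
    then show ?thesis using *[of u v] *[of v u] by (cases "length u \<le> length v") (auto simp: Int_commute)
  qed
  show "Int_stable (insert {} (range cylinder) :: (nat \<Rightarrow> 'm) set set)"
  proof (rule Int_stableI)
    fix A B :: "(nat \<Rightarrow> 'm) set"
    assume "A \<in> insert {} (range cylinder)" "B \<in> insert {} (range cylinder)"
    then consider "A = {}" | "B = {}" | u v where "A = cylinder u" "B = cylinder v" by auto
    then show "A \<inter> B \<in> insert {} (range cylinder)"
    proof cases
      case 3 then show ?thesis by (simp only: int)
    qed auto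
  qed
  show "emeasure M X = emeasure \<mu> X" if "X \<in> insert {} (range cylinder)" for X
    using that assms(2) by auto
  show "sets M = sigma_sets UNIV (insert {} (range cylinder))"
    using assms(1) sigma_cylinders by simp
  show "emeasure M (cylinder []) \<noteq> \<infinity>" by (simp add: assms(2))
qed (simp_all add: sigma_cylinders, auto simp: cylinder_def)

lemma shift_measurable [measurable]: "shift \<in> \<mu> \<rightarrow>\<^sub>M \<mu>"
proof -
  have "shift \<in> \<mu> \<rightarrow>\<^sub>M (\<Pi>\<^sub>M k\<in>(UNIV :: nat set). count_space (UNIV :: 'm set))"
    unfolding shift_def[abs_def] by (intro measurable_PiM_single') auto
  then show ?thesis using measurable_cong_sets[OF refl sets_mu] by blast
qed

lemma code_prefix_Suc': "code_prefix x (Suc n) = x 0 # code_prefix (shift x) n"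
  using code_prefix_add[of x 1 n] by (simp add: shift_def code_prefix_def)

text \<open>The preimage of a cylinder is the disjoint union over its possible first letters, whose
  probabilities sum to 1.\<close>

lemma distr_shift: "distr \<mu> \<mu> shift = \<mu>"
proof (rule measure_eqI_cylinders)
  fix w
  have "shift -` cylinder w = (\<Union>i\<in>UNIV. cylinder (i # w))"
    by (auto simp: mem_cylinder_iff code_prefix_Suc')
  then have "emeasure (distr \<mu> \<mu> shift) (cylinder w) = emeasure \<mu> (\<Union>i\<in>UNIV. cylinder (i # w))"
    by (simp add: emeasure_distr)
  also have "\<dots> = (\<Sum>i\<in>UNIV. emeasure \<mu> (cylinder (i # w)))"
    by (rule sum_emeasure[symmetric]) (auto simp: disjoint_family_on_def mem_cylinder_iff)
  also have "\<dots> = emeasure \<mu> (cylinder w)"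
    using p_pos weight_nonneg[of w]
    by (simp add: emeasure_eq_measure measure_cylinder weight_def less_imp_le sum_distrib_right[symmetric] p_sum)
  finally show "emeasure (distr \<mu> \<mu> shift) (cylinder w) = emeasure \<mu> (cylinder w)" .
qed simp

lemma distr_shift_funpow: "distr \<mu> \<mu> (shift ^^ i) = \<mu>" and shift_funpow_measurable [measurable]: "shift ^^ i \<in> \<mu> \<rightarrow>\<^sub>M \<mu>"
proof (induction i)
  case (Suc i)
  {
    case 1
    have "distr \<mu> \<mu> (shift ^^ Suc i) = distr (distr \<mu> \<mu> (shift ^^ i)) \<mu> shift"
      using Suc(2) by (simp add: distr_distr)
    then show ?case by (simp only: Suc(1) distr_shift)
  next
    case 2
    show ?case using measurable_comp[OF Suc(2) shift_measurable] by simp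
  }
qed (simp_all add: distr_id2 id_def)

lemma shift_funpow: "(shift ^^ m) x = (\<lambda>k. x (k + m))"
  by (induction m arbitrary: x) (auto simp: shift_def)

end

section \<open>A subadditive ergodic theorem for Bernoulli measures\<close>

lemma tendsto_of_linear_bounds:
  fixes u :: "nat \<Rightarrow> real"
  assumes lower: "\<And>\<epsilon>. \<epsilon> > 0 \<Longrightarrow> eventually (\<lambda>n. real n * (L - \<epsilon>) \<le> u n) sequentially"
    and upper: "\<And>\<epsilon>. \<epsilon> > 0 \<Longrightarrow> eventually (\<lambda>n. u n \<le> real n * (L + \<epsilon>)) sequentially"
  shows "(\<lambda>n. u n / real n) \<longlonglongrightarrow> L"
proof (rule LIMSEQ_I)
  fix r :: real assume r: "r > 0"
  then have "eventually (\<lambda>n. real n * (L - r / 2) \<le> u n) sequentially"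
    "eventually (\<lambda>n. u n \<le> real n * (L + r / 2)) sequentially"
    by (auto intro: lower upper)
  moreover have "eventually (\<lambda>n. n > 0) sequentially" by (rule eventually_gt_at_top)
  ultimately have "eventually (\<lambda>n. norm (u n / real n - L) < r) sequentially"
  proof eventually_elim
    case (elim n)
    then have "L - r / 2 \<le> u n / real n" "u n / real n \<le> L + r / 2"
      by (simp_all add: pos_le_divide_eq pos_divide_le_eq mult.commute)
    then have "\<bar>u n / real n - L\<bar> \<le> r / 2" unfolding abs_le_iff by linarith
    then show ?case using r by simp
  qed
  then show "\<exists>N. \<forall>n\<ge>N. norm (u n / real n - L) < r" by (simp add: eventually_sequentially)
qed

text \<open>\<open>cons\<close> limits what deleting a first letter can add to \<open>a\<close>.
  Together with \<open>sub\<close> and \<open>bound\<close> it keeps \<open>X (Suc n) x\<close>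
  within a bounded distance of \<open>X n (shift x)\<close>, the source of shift invariance of the
  lower rate.\<close>

locale subadditive_cocycle = bernoulli +
  fixes a :: "'a list \<Rightarrow> real" and K :: real
  assumes sub: "\<And>u v. a (u @ v) \<le> a u + a v"
    and bound: "\<And>w. \<bar>a w\<bar> \<le> K * (real (length w) + 1)"
    and cons: "\<And>i w. a w \<le> a (i # w) + K"
begin

abbreviation X :: "nat \<Rightarrow> (nat \<Rightarrow> 'a) \<Rightarrow> real" where "X n x \<equiv> a (code_prefix x n)"

text \<open>The infimum of Fekete's lemma; it is finite by \<open>bound\<close>.\<close>

definition rate :: real where "rate = Inf ((\<lambda>n. average a n / real n) ` {1..})"

lemma K_nonneg: "K \<ge> 0"
  using bound[of "[]"] abs_ge_zero[of "a []"] by simp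

lemma average_bound: "\<bar>average a n\<bar> \<le> K * (real n + 1)"
proof -
  have "\<bar>average a n\<bar> \<le> (\<Sum>w | length w = n. \<bar>weight w * a w\<bar>)" unfolding average_def by (rule sum_abs)
  also have "\<dots> \<le> (\<Sum>w | length w = n. weight w * (K * (real n + 1)))"
    unfolding abs_mult using bound weight_nonneg by (intro sum_mono mult_mono) auto
  also have "\<dots> = K * (real n + 1)" by (simp add: sum_distrib_right[symmetric] sum_weight)
  finally show ?thesis .
qed

text \<open>Independence of the two parts of a word: weights multiply, and summing out the other
  part gives 1.\<close>

lemma average_add: "average a (m + n) \<le> average a m + average a n"
proof -
  have "average a (m + n) = (\<Sum>u | length u = m. \<Sum>v | length v = n. weight u * weight v * a (u @ v))"
    unfolding average_def sum_words_append weight_append ..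
  also have "\<dots> \<le> (\<Sum>u | length u = m. \<Sum>v | length v = n. weight v * (weight u * a u) + weight u * (weight v * a v))"
    using mult_left_mono[OF sub mult_nonneg_nonneg[OF weight_nonneg weight_nonneg]]
    by (intro sum_mono) (simp add: algebra_simps)
  also have "\<dots> = average a m + average a n"
    by (simp add: sum.distrib sum_distrib_right[symmetric] sum_distrib_left[symmetric] sum_weight average_def)
  finally show ?thesis .
qed

lemma average_mult: "average a (k * q) \<le> real k * average a q + K"
proof (induction k)
  case 0 then show ?case using average_bound[of 0] by simp
next
  case (Suc k)
  then show ?case using average_add[of q "k * q"] by (simp add: algebra_simps)
qed

lemma rate_le: "real n * rate \<le> average a n"
proof (cases "n = 0")
  case False
  have "- (2 * K) \<le> average a k / real k" if "k \<ge> 1" for k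
  proof -
    have "K * (real k + 1) \<le> K * (2 * real k)" using that K_nonneg by (intro mult_left_mono) auto
    then have "- (2 * K) * real k \<le> average a k" using average_bound[of k] by (simp add: abs_le_iff)
    then show ?thesis using that by (simp add: pos_le_divide_eq)
  qed
  then have "bdd_below ((\<lambda>n. average a n / real n) ` {1..})" by (intro bdd_belowI2) auto
  then have "rate \<le> average a n / real n" unfolding rate_def using False by (intro cInf_lower) auto
  then show ?thesis using False by (simp add: pos_le_divide_eq mult.commute)
\<comment> \<open>At \<open>n = 0\<close> the claim is that \<open>a []\<close> is non-negative,
  which is subadditivity at two empty words.\<close>
qed (use sub[of "[]" "[]"] in \<open>simp add: average_def weight_def\<close>)

lemma block_below:
  assumes "\<epsilon> > 0" obtains q where "q > 0" "average a q < real q * (rate + \<epsilon>)"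
proof -
  have "\<exists>r\<in>(\<lambda>n. average a n / real n) ` {1..}. r < rate + \<epsilon>"
    using assms unfolding rate_def by (intro cInf_lessD) auto
  then obtain q where "q \<ge> 1" "average a q / real q < rate + \<epsilon>" by auto
  then show thesis by (intro that[of q]) (auto simp: pos_divide_less_eq mult.commute)
qed

text \<open>Fekete's lemma: a block length that nearly attains the infimum controls all long words,
  and the remainder modulo \<open>q\<close> costs a constant.\<close>

lemma average_tendsto: "(\<lambda>n. average a n / real n) \<longlonglongrightarrow> rate"
proof (rule tendsto_of_linear_bounds)
  fix \<epsilon> :: real assume \<epsilon>: "\<epsilon> > 0"
  have "real n * (rate - \<epsilon>) \<le> average a n" for n
    using rate_le[of n] mult_left_mono[of "rate - \<epsilon>" rate "real n"] \<epsilon> by simp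
  then show "eventually (\<lambda>n. real n * (rate - \<epsilon>) \<le> average a n) sequentially" by simp
  obtain q where q: "q > 0" "average a q < real q * (rate + \<epsilon> / 2)" using block_below[of "\<epsilon> / 2"] \<epsilon> by auto
  define D where "D = \<bar>average a q\<bar> + (K + K * (real q + 1))"
  have "average a n \<le> real n * (average a q / real q) + D" for n
    unfolding D_def
  proof (rule linear_bound_of_blocks[OF q(1)])
    have "average a n \<le> average a (n div q * q) + average a (n mod q)"
      using average_add[of "n div q * q" "n mod q"] by simp
    moreover have "average a (n mod q) \<le> K * (real q + 1)"
    proof -
      have "real (n mod q) \<le> real q" using q(1) by (simp add: less_imp_le)
      then have "K * (real (n mod q) + 1) \<le> K * (real q + 1)" using K_nonneg by (intro mult_left_mono) auto
      then show ?thesis using average_bound[of "n mod q"] by simp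
    qed
    ultimately show "average a n \<le> real (n div q) * average a q + (K + K * (real q + 1))"
      using average_mult[of "n div q" q] by simp
  qed
  moreover have "eventually (\<lambda>n. real n * (average a q / real q) + D \<le> real n * (rate + \<epsilon>)) sequentially"
    using q \<epsilon> by (intro eventually_linear_bound) (simp add: pos_divide_less_eq mult.commute less_le_trans)
  ultimately show "eventually (\<lambda>n. average a n \<le> real n * (rate + \<epsilon>)) sequentially"
    by (auto elim!: eventually_mono intro: order_trans)
qed

lemma X_add: "X (m + n) x \<le> X m x + X n (\<lambda>k. x (k + m))"
  unfolding code_prefix_add by (rule sub)

lemma X_bound: "\<bar>X n x\<bar> \<le> K * (real n + 1)"
  using bound[of "code_prefix x n"] by simp

lemma X_bound_1: "n \<ge> 1 \<Longrightarrow> \<bar>X n x\<bar> \<le> real n * (2 * K)"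
  using X_bound[of x n] mult_left_mono[of "real n + 1" "2 * real n" K] K_nonneg by (simp add: mult_ac)

text \<open>
  Exponential moments over words of length \<open>k * q\<close> factor into blocks, so the tails of \<open>X (k * q)\<close>
  above its rate decay exponentially.
\<close>

lemma AE_X_upper:
  assumes \<epsilon>: "\<epsilon> > 0"
  shows "AE x in \<mu>. eventually (\<lambda>n. X n x \<le> real n * (rate + \<epsilon>)) sequentially"
proof -
  obtain q where q: "q > 0" "average a q < real q * (rate + \<epsilon> / 2)" using block_below[of "\<epsilon> / 2"] \<epsilon> by auto
  define c where "c = real q * (rate + \<epsilon> / 2)"
  \<comment> \<open>The centred moment generating function of one block. Its value at 0 is 1 and its
    slope there is \<open>average a q - c < 0\<close>, so it is below 1 for some small positive
    \<open>t\<close>.\<close>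
  define M where "M t = (\<Sum>u | length u = q. weight u * exp (t * (a u - c)))" for t
  have M0: "M 0 = 1" by (simp add: M_def sum_weight)
  have "(M has_real_derivative (\<Sum>u | length u = q. weight u * (a u - c))) (at 0)"
    unfolding M_def by (auto intro!: derivative_eq_intros simp: mult.commute)
  moreover have "(\<Sum>u | length u = q. weight u * (a u - c)) = average a q - c"
    by (simp add: right_diff_distrib sum_subtractf sum_distrib_right[symmetric] sum_weight average_def)
  ultimately have "\<exists>d>0. \<forall>h>0. h < d \<longrightarrow> M (0 + h) < M 0"
    using q(2) by (intro DERIV_neg_dec_right) (auto simp: c_def)
  then obtain d where d: "d > 0" "\<And>h. 0 < h \<Longrightarrow> h < d \<Longrightarrow> M h < 1" using M0 by auto
  define t where "t = d / 2"
  have t: "t > 0" "M t < 1" using d by (auto simp: t_def)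
  have Mt: "M t \<ge> 0" unfolding M_def by (intro sum_nonneg) (auto simp: weight_nonneg)
  define G where "G k = (\<Sum>w | length w = k * q. weight w * exp (t * (a w - real k * c)))" for k
  have G: "G k \<le> exp (t * a []) * M t ^ k" for k
  proof (induction k)
    case 0 then show ?case by (simp add: G_def weight_def)
  next
    case (Suc k)
    have "G (Suc k) = (\<Sum>u | length u = q. \<Sum>v | length v = k * q.
        weight u * weight v * exp (t * (a (u @ v) - real (Suc k) * c)))"
      unfolding G_def mult_Suc sum_words_append weight_append ..
    also have "\<dots> \<le> (\<Sum>u | length u = q. \<Sum>v | length v = k * q.
        weight u * weight v * (exp (t * (a u - c)) * exp (t * (a v - real k * c))))"
    proof (intro sum_mono mult_left_mono mult_nonneg_nonneg weight_nonneg)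
      fix u v
      have "t * (a (u @ v) - real (Suc k) * c) \<le> t * ((a u - c) + (a v - real k * c))"
        using sub[of u v] t by (intro mult_left_mono) (auto simp: algebra_simps)
      then show "exp (t * (a (u @ v) - real (Suc k) * c)) \<le> exp (t * (a u - c)) * exp (t * (a v - real k * c))"
        by (simp add: exp_add[symmetric] distrib_left)
    qed
    also have "\<dots> = M t * G k" unfolding M_def G_def sum_product by (simp add: mult_ac)
    also have "\<dots> \<le> M t * (exp (t * a []) * M t ^ k)" using Suc Mt by (rule mult_left_mono)
    finally show ?case by (simp add: mult_ac)
  qed
  define A where "A k = {x \<in> space \<mu>. X (k * q) x > real k * c}" for k
  have A[measurable]: "A k \<in> sets \<mu>" for k unfolding A_def by measurable
  have mA: "measure \<mu> (A k) \<le> exp (t * a []) * M t ^ k" for k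
  proof -
    have "measure \<mu> (A k) = (\<integral>x. indicator (A k) x \<partial>\<mu>)" by simp
    \<comment> \<open>Chernoff's bound: on \<open>A k\<close> the exponential is at least 1.\<close>
    also have "\<dots> \<le> (\<integral>x. exp (t * (X (k * q) x - real k * c)) \<partial>\<mu>)"
    proof (rule integral_mono)
      show "integrable \<mu> (indicator (A k) :: _ \<Rightarrow> real)"
        by (intro integrable_real_indicator) (auto simp: less_top[symmetric])
      show "integrable \<mu> (\<lambda>x. exp (t * (X (k * q) x - real k * c)))"
        using integrable_code_prefix[of "\<lambda>w. exp (t * (a w - real k * c))"] .
      show "indicator (A k) x \<le> exp (t * (X (k * q) x - real k * c))" for x
        using t by (auto simp: A_def indicator_def)
    qed
    also have "\<dots> = G k" unfolding G_def by (rule integral_code_prefix)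
    finally show ?thesis using G[of k] by linarith
  qed
  have "summable (\<lambda>k. exp (t * a []) * M t ^ k)" using t Mt by (intro summable_mult summable_geometric) simp
  then have "summable (\<lambda>k. measure \<mu> (A k))"
    by (rule summable_comparison_test[rotated]) (use mA in auto)
  then have "AE x in \<mu>. eventually (\<lambda>k. x \<in> space \<mu> - A k) sequentially"
    by (intro borel_cantelli_AE1) (auto simp: less_top[symmetric])
  then show ?thesis
  proof eventually_elim
    case (elim x)
    then have "eventually (\<lambda>k. X (k * q) x \<le> real k * c) sequentially"
      by eventually_elim (auto simp: A_def)
    moreover have "filterlim (\<lambda>n. n div q) at_top sequentially"
    proof (rule filterlim_at_top[THEN iffD2, rule_format])
      fix Z show "eventually (\<lambda>n. Z \<le> n div q) sequentially"
        using q(1) by (intro eventually_sequentiallyI[of "Z * q"]) (simp add: less_eq_div_iff_mult_less_eq)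
    qed
    ultimately have "eventually (\<lambda>n. X (n div q * q) x \<le> real (n div q) * c) sequentially"
      by (rule eventually_compose_filterlim)
    moreover have "eventually (\<lambda>n. real n * (c / real q) + (\<bar>c\<bar> + K * (real q + 1)) \<le> real n * (rate + \<epsilon>)) sequentially"
      using q(1) \<epsilon> by (intro eventually_linear_bound) (simp add: c_def)
    ultimately show ?case
    proof eventually_elim
      case (elim n)
      have "X n x \<le> X (n div q * q) x + X (n mod q) (\<lambda>k. x (k + n div q * q))"
        using X_add[of x "n div q * q" "n mod q"] by simp
      moreover have "X (n mod q) (\<lambda>k. x (k + n div q * q)) \<le> K * (real q + 1)"
      proof -
        have "real (n mod q) \<le> real q" using q(1) by (simp add: less_imp_le)
        then have "K * (real (n mod q) + 1) \<le> K * (real q + 1)" using K_nonneg by (intro mult_left_mono) auto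
        then show ?thesis using X_bound[of "\<lambda>k. x (k + n div q * q)" "n mod q"] by simp
      qed
      ultimately have "X n x \<le> real (n div q) * c + K * (real q + 1)" using elim(1) by linarith
      from linear_bound_of_blocks[OF q(1) this] elim(2) show ?case by linarith
    qed
  qed
qed

section \<open>The pointwise lower rate and the lower bound in the ergodic theorem\<close>

definition lower_rate :: "(nat \<Rightarrow> 'a) \<Rightarrow> real" where
  "lower_rate x = real_of_ereal (liminf (\<lambda>n. ereal (X n x / real n)))"

lemma X_quotient_bound: "\<bar>X n x / real n\<bar> \<le> 2 * K"
  using X_bound_1[of n] K_nonneg by (cases "n = 0") (auto simp: abs_div pos_divide_le_eq mult.commute)

text \<open>The quotients lie between -2K and 2K, so the liminf is finite and its conversion to a
  real number loses nothing.\<close>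

lemma liminf_eq_lower_rate: "liminf (\<lambda>n. ereal (X n x / real n)) = ereal (lower_rate x)"
  and lower_rate_bound: "\<bar>lower_rate x\<bar> \<le> 2 * K"
proof -
  let ?l = "liminf (\<lambda>n. ereal (X n x / real n))"
  have "- (2 * K) \<le> X n x / real n" "X n x / real n \<le> 2 * K" for n
    using X_quotient_bound[of x n] by (simp_all only: abs_le_iff) linarith+
  then have b: "ereal (- (2 * K)) \<le> ?l" "?l \<le> ereal (2 * K)"
    by (auto intro!: Liminf_bounded Liminf_le)
  then have fin: "\<bar>?l\<bar> \<noteq> \<infinity>" by (cases ?l) auto
  then show eq: "?l = ereal (lower_rate x)" by (simp add: lower_rate_def ereal_real')
  show "\<bar>lower_rate x\<bar> \<le> 2 * K" using b unfolding eq by (simp add: abs_le_iff)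
qed

lemma lower_rate_measurable [measurable]: "lower_rate \<in> borel_measurable \<mu>"
  unfolding lower_rate_def[abs_def] by measurable

lemma X_Suc_shift: "\<bar>X (Suc n) x - X n (shift x)\<bar> \<le> 2 * K"
proof -
  have "X (Suc n) x \<le> a [x 0] + X n (shift x)"
    using sub[of "[x 0]" "code_prefix (shift x) n"] by (simp add: code_prefix_Suc')
  moreover have "a [x 0] \<le> 2 * K" using bound[of "[x 0]"] by simp
  moreover have "X n (shift x) \<le> X (Suc n) x + K"
    using cons[of "code_prefix (shift x) n" "x 0"] by (simp add: code_prefix_Suc')
  ultimately show ?thesis using K_nonneg unfolding abs_le_iff by linarith
qed

text \<open>Both numerators differ by at most 2K and both quotients are bounded, so replacing
  \<open>n + 1\<close> by \<open>n\<close> and \<open>x\<close> by its shift changes the quotient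
  only by O(1/n).\<close>

lemma lower_rate_shift: "lower_rate (shift x) = lower_rate x"
proof -
  define d where "d n = X (Suc n) x / real (Suc n) - X n (shift x) / real n" for n
  have "d \<longlonglongrightarrow> 0"
  proof (rule Lim_null_comparison)
    show "eventually (\<lambda>n. norm (d n) \<le> 4 * K / real n) sequentially"
    proof (rule eventually_sequentiallyI[of 1])
      fix n :: nat assume n: "1 \<le> n"
      have "d n = (X (Suc n) x - X n (shift x)) / real n - (X (Suc n) x / real (Suc n)) / real n"
      proof -
        have "A / (m + 1) - B / m = (A - B) / m - A / (m + 1) / m" if "m > 0" for A B m :: real
          using that by (simp add: divide_simps add_pos_pos) (simp add: algebra_simps)
        from this[of "real n"] show ?thesis using n by (simp add: d_def add.commute)
      qed
      also have "norm \<dots> \<le> norm ((X (Suc n) x - X n (shift x)) / real n) + norm ((X (Suc n) x / real (Suc n)) / real n)"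
        by (rule norm_triangle_ineq4)
      also have "\<dots> = (\<bar>X (Suc n) x - X n (shift x)\<bar> + \<bar>X (Suc n) x / real (Suc n)\<bar>) / real n"
        unfolding real_norm_def abs_divide[of _ "real n"] by (simp add: add_divide_distrib)
      also have "\<dots> \<le> (2 * K + 2 * K) / real n"
        using n X_Suc_shift[of x n] X_quotient_bound[of x "Suc n"] by (intro divide_right_mono add_mono) auto
      finally show "norm (d n) \<le> 4 * K / real n" by simp
    qed
    show "(\<lambda>n. 4 * K / real n) \<longlonglongrightarrow> 0" by real_asymp
  qed
  then have d0: "(\<lambda>n. ereal (d n)) \<longlonglongrightarrow> ereal 0" by (simp add: tendsto_ereal)
  have "liminf (\<lambda>n. ereal (X n x / real n)) = liminf (\<lambda>n. ereal (X (n + 1) x / real (n + 1)))"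
    by (rule liminf_shift[symmetric])
  also have "\<dots> = liminf (\<lambda>n. ereal (d n) + ereal (X n (shift x) / real n))" by (simp add: d_def)
  also have "\<dots> = ereal 0 + liminf (\<lambda>n. ereal (X n (shift x) / real n))"
    by (rule ereal_liminf_lim_add[OF d0]) simp
  finally show ?thesis by (simp add: lower_rate_def)
qed

text \<open>The bad points of the decomposition: no block of length at most \<open>M\<close>
  starting there brings \<open>X\<close> within \<open>\<epsilon>\<close> of its lower rate.\<close>

definition late :: "real \<Rightarrow> nat \<Rightarrow> (nat \<Rightarrow> 'a) set" where
  "late \<epsilon> M = {x. \<forall>k\<in>{1..M}. X k x > real k * (lower_rate x + \<epsilon>)}"

lemma late_measurable [measurable]: "late \<epsilon> M \<in> sets \<mu>"
proof -
  have "late \<epsilon> M = {x \<in> space \<mu>. \<forall>k\<in>{1..M}. X k x > real k * (lower_rate x + \<epsilon>)}"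
    by (simp add: late_def)
  also have "\<dots> \<in> sets \<mu>" by measurable
  finally show ?thesis .
qed

text \<open>
  The Katznelson--Weiss decomposition: cut the orbit greedily into blocks of length at most \<open>M\<close> on
  which \<open>X\<close> is close to its lower rate, and into single letters where no such block starts.
\<close>

lemma X_le_visits:
  assumes \<epsilon>: "0 < \<epsilon>" "\<epsilon> \<le> 1"
  shows "X n x \<le> real n * (lower_rate x + \<epsilon>) +
    (5 * K) * (\<Sum>i<n. indicator (late \<epsilon> M) ((shift ^^ i) x)) + (5 * K) * (real M + 1)"
proof (induction n arbitrary: x rule: less_induct)
  case (less n)
  define I where "I x i = (indicator (late \<epsilon> M) ((shift ^^ i) x) :: real)" for x i
  have I0: "I x i \<ge> 0" for x i by (simp add: I_def)
  have I_shift: "I ((shift ^^ k) x) i = I x (k + i)" for k i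
    by (simp add: I_def funpow_add[symmetric] add.commute flip: o_apply[of "shift ^^ _"])
  have lr: "- (2 * K) \<le> lower_rate x" using lower_rate_bound[of x] by (simp add: abs_le_iff)
  have rest: "lower_rate ((shift ^^ k) x) = lower_rate x" for k
    by (induction k) (simp_all add: lower_rate_shift)
  have step: "X n x \<le> X k x + (real (n - k) * (lower_rate x + \<epsilon>) + (5 * K) * (\<Sum>i=k..<n. I x i) + (5 * K) * (real M + 1))"
    if k: "1 \<le> k" "k \<le> n" for k
  proof -
    have "X n x \<le> X k x + X (n - k) ((shift ^^ k) x)"
      using X_add[of x k "n - k"] k by (simp add: shift_funpow)
    moreover have "X (n - k) ((shift ^^ k) x) \<le> real (n - k) * (lower_rate x + \<epsilon>)
        + (5 * K) * (\<Sum>i<n - k. I x (k + i)) + (5 * K) * (real M + 1)"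
      using less.IH[of "n - k" "(shift ^^ k) x"] k by (simp add: I_shift rest flip: I_def)
    moreover have "(\<Sum>i<n - k. I x (k + i)) = (\<Sum>i=k..<n. I x i)"
      using k by (intro sum.reindex_bij_witness[of _ "\<lambda>i. i - k" "\<lambda>i. k + i"]) auto
    ultimately show ?thesis by simp
  qed
  have split: "(\<Sum>i<n. I x i) = (\<Sum>i<k. I x i) + (\<Sum>i=k..<n. I x i)" if "k \<le> n" for k
    using that by (simp add: lessThan_atLeast0 sum.atLeastLessThan_concat)
  have goal: "X n x \<le> real n * (lower_rate x + \<epsilon>) + (5 * K) * (\<Sum>i<n. I x i) + (5 * K) * (real M + 1)"
  proof -
    \<comment> \<open>The cases are a tail too short for a guaranteed block, a bad point, where one
      letter is removed, and a point where a good block starts. A tail exceeds its share of the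
      linear term by at most 3 K n + K, a bad letter by at most 4 K, since the lower rate is at
      least -2K; the constant 5 K covers both.\<close>
    consider "n < M \<or> n = 0" | "n \<ge> M" "n \<ge> 1" "x \<in> late \<epsilon> M" | "n \<ge> M" "n \<ge> 1" "x \<notin> late \<epsilon> M"
      by linarith
    then show ?thesis
    proof cases
      case 1
      have "X n x \<le> K * (real n + 1)" using X_bound[of x n] by simp
      moreover have "real n * (- (2 * K)) \<le> real n * (lower_rate x + \<epsilon>)"
        using lr \<epsilon> by (intro mult_left_mono) auto
      moreover have "K * real n \<le> K * real M" using 1 K_nonneg by (intro mult_left_mono) auto
      moreover have "0 \<le> K * real M" using K_nonneg by simp
      moreover have "0 \<le> (5 * K) * (\<Sum>i<n. I x i)" using K_nonneg I0 by (simp add: sum_nonneg)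
      moreover have "K * (real n + 1) = K * real n + K" "real n * (- (2 * K)) = - 2 * (K * real n)"
        "(5 * K) * (real M + 1) = 5 * (K * real M) + 5 * K" by (simp_all add: algebra_simps)
      ultimately show ?thesis using K_nonneg by linarith
    next
      case 2
      have "X 1 x \<le> 2 * K" using X_bound[of x 1] by simp
      moreover have "(\<Sum>i<n. I x i) = 1 + (\<Sum>i=1..<n. I x i)"
        using split[of 1] 2 by (simp add: I_def)
      moreover have "real (n - 1) * (lower_rate x + \<epsilon>) = real n * (lower_rate x + \<epsilon>) - (lower_rate x + \<epsilon>)"
        using 2 by (simp add: of_nat_diff algebra_simps)
      ultimately show ?thesis using step[of 1] 2(2) lr \<epsilon> K_nonneg by (simp add: algebra_simps)
    next
      case 3
      then obtain k where k: "1 \<le> k" "k \<le> M" "X k x \<le> real k * (lower_rate x + \<epsilon>)"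
        by (auto simp: late_def not_less)
      have kn: "k \<le> n" using k 3 by simp
      have "(5 * K) * (\<Sum>i=k..<n. I x i) \<le> (5 * K) * (\<Sum>i<n. I x i)"
        using split[OF kn] K_nonneg I0 by (intro mult_left_mono) (auto simp: sum_nonneg)
      moreover have "real (n - k) * (lower_rate x + \<epsilon>) = real n * (lower_rate x + \<epsilon>) - real k * (lower_rate x + \<epsilon>)"
        using kn by (simp add: of_nat_diff algebra_simps)
      ultimately show ?thesis using step[OF k(1) kn] k(3) by linarith
    qed
  qed
  then show ?case by (simp add: I_def)
qed

lemma prob_UNIV: "prob UNIV = 1"
  using prob_space by simp

lemma integrable_bounded:
  fixes g :: "(nat \<Rightarrow> 'a) \<Rightarrow> real"
  assumes "g \<in> borel_measurable \<mu>" "\<And>x. \<bar>g x\<bar> \<le> C" shows "integrable \<mu> g"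
  using assms by (intro integrable_const_bound[where B = C]) auto

text \<open>Integrate the orbit decomposition: by shift invariance every visit term has the same
  expectation. Letting \<open>n\<close> grow removes the constant, and then letting \<open>M\<close>
  grow removes the visits.\<close>

lemma rate_le_integral_lower_rate: "rate \<le> (\<integral>x. lower_rate x \<partial>\<mu>)"
proof -
  have int_lr: "integrable \<mu> lower_rate"
    using lower_rate_bound by (intro integrable_bounded) auto
  have le: "rate \<le> (\<integral>x. lower_rate x \<partial>\<mu>) + \<epsilon>" if \<epsilon>: "0 < \<epsilon>" "\<epsilon> \<le> 1" for \<epsilon>
  proof -
    define J where "J = (\<integral>x. lower_rate x \<partial>\<mu>)"
    have M: "rate \<le> J + \<epsilon> + 5 * K * measure \<mu> (late \<epsilon> M)" for M
    proof -
      have n: "real n * rate \<le> real n * (J + \<epsilon> + 5 * K * measure \<mu> (late \<epsilon> M)) + 5 * K * (real M + 1)" for n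
      proof -
        have int_I: "integrable \<mu> (\<lambda>x. indicator (late \<epsilon> M) ((shift ^^ i) x) :: real)" for i
          by (intro integrable_bounded[where C = 1]) (auto simp: indicator_def)
        have I: "(\<integral>x. indicator (late \<epsilon> M) ((shift ^^ i) x) \<partial>\<mu>) = measure \<mu> (late \<epsilon> M)" for i
        proof -
          have "(\<integral>x. (indicator (late \<epsilon> M) x :: real) \<partial>distr \<mu> \<mu> (shift ^^ i))
              = (\<integral>x. indicator (late \<epsilon> M) ((shift ^^ i) x) \<partial>\<mu>)"
            by (rule integral_distr) auto
          then show ?thesis by (simp add: distr_shift_funpow)
        qed
        have "real n * rate \<le> average a n" by (rule rate_le)
        also have "\<dots> = (\<integral>x. X n x \<partial>\<mu>)" unfolding average_def by (rule integral_code_prefix[symmetric])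
        also have "\<dots> \<le> (\<integral>x. real n * (lower_rate x + \<epsilon>) +
            (5 * K) * (\<Sum>i<n. indicator (late \<epsilon> M) ((shift ^^ i) x)) + (5 * K) * (real M + 1) \<partial>\<mu>)"
          by (intro integral_mono X_le_visits[OF \<epsilon>] integrable_code_prefix
              Bochner_Integration.integrable_add integrable_mult_right
              Bochner_Integration.integrable_sum int_I int_lr integrable_const)
        also have "\<dots> = real n * (J + \<epsilon>) + 5 * K * (\<Sum>i<n. measure \<mu> (late \<epsilon> M)) + 5 * K * (real M + 1)"
          using int_I int_lr by (simp add: I J_def prob_UNIV del: sum_constant)
        finally show ?thesis by (simp add: algebra_simps)
      qed
      show ?thesis
      proof (rule ccontr)
        assume "\<not> ?thesis"
        then have "eventually (\<lambda>n. real n * (J + \<epsilon> + 5 * K * measure \<mu> (late \<epsilon> M)) + (5 * K * (real M + 1) + 1) \<le> real n * rate) sequentially"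
          by (intro eventually_linear_bound) simp
        then obtain n where "real n * (J + \<epsilon> + 5 * K * measure \<mu> (late \<epsilon> M)) + (5 * K * (real M + 1) + 1) \<le> real n * rate"
          by (auto simp: eventually_sequentially)
        with n[of n] show False by linarith
      qed
    qed
    \<comment> \<open>A point late for every \<open>M\<close> would have all quotients above the
      lower rate plus \<open>\<epsilon>\<close>, contradicting the definition of the liminf.\<close>
    have "(\<Inter>M. late \<epsilon> M) = {}"
    proof (rule equals0I)
      fix x assume "x \<in> (\<Inter>M. late \<epsilon> M)"
      then have "real k * (lower_rate x + \<epsilon>) < X k x" if "k \<ge> 1" for k
        using that by (force simp: late_def)
      then have "eventually (\<lambda>k. ereal (lower_rate x + \<epsilon>) \<le> ereal (X k x / real k)) sequentially"
        by (intro eventually_sequentiallyI[of 1]) (simp add: pos_le_divide_eq mult.commute less_imp_le)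
      then have "ereal (lower_rate x + \<epsilon>) \<le> liminf (\<lambda>k. ereal (X k x / real k))" by (rule Liminf_bounded)
      then show False using \<epsilon> by (simp add: liminf_eq_lower_rate)
    qed
    moreover have "(\<lambda>M. measure \<mu> (late \<epsilon> M)) \<longlonglongrightarrow> measure \<mu> (\<Inter>M. late \<epsilon> M)"
      by (rule finite_Lim_measure_decseq) (auto simp: decseq_def, auto simp: late_def)
    ultimately have "(\<lambda>M. J + \<epsilon> + 5 * K * measure \<mu> (late \<epsilon> M)) \<longlonglongrightarrow> J + \<epsilon> + 5 * K * 0"
      by (intro tendsto_intros) simp
    then have "rate \<le> J + \<epsilon> + 5 * K * 0"
      by (rule LIMSEQ_le_const) (use M in auto)
    then show ?thesis by (simp add: J_def)
  qed
  show ?thesis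
  proof (rule field_le_epsilon)
    fix e :: real assume "e > 0"
    then show "rate \<le> (\<integral>x. lower_rate x \<partial>\<mu>) + e"
      using le[of "min e 1"] min.cobounded1[of e 1] by simp
  qed
qed

text \<open>The lower rate is at most \<open>rate\<close> almost everywhere by the tail estimate,
  and its integral is at least \<open>rate\<close>; hence it equals \<open>rate\<close> almost
  everywhere and meets the upper bound.\<close>

lemma AE_X_tendsto: "AE x in \<mu>. (\<lambda>n. X n x / real n) \<longlonglongrightarrow> rate"
proof -
  have "AE x in \<mu>. \<forall>j. eventually (\<lambda>n. X n x \<le> real n * (rate + 1 / real (Suc j))) sequentially"
    by (subst AE_all_countable) (auto intro: AE_X_upper)
  then have upper: "AE x in \<mu>. \<forall>\<epsilon>>0. eventually (\<lambda>n. X n x \<le> real n * (rate + \<epsilon>)) sequentially"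
  proof eventually_elim
    case (elim x)
    show ?case
    proof (intro allI impI)
      fix \<epsilon> :: real assume "\<epsilon> > 0"
      then obtain j where "1 / real (Suc j) < \<epsilon>" by (metis nat_approx_posE)
      then have "real n * (rate + 1 / real (Suc j)) \<le> real n * (rate + \<epsilon>)" for n
        by (intro mult_left_mono) auto
      then show "eventually (\<lambda>n. X n x \<le> real n * (rate + \<epsilon>)) sequentially"
        using eventually_mono[OF elim[rule_format, of j]] by (meson order_trans)
    qed
  qed
  have le: "AE x in \<mu>. lower_rate x \<le> rate"
    using upper
  proof eventually_elim
    case (elim x)
    show ?case
    proof (rule field_le_epsilon)
      fix e :: real assume "e > 0"
      then have "eventually (\<lambda>n. X n x \<le> real n * (rate + e)) sequentially" using elim by blast
      moreover have "eventually (\<lambda>n. n > 0) sequentially" by (rule eventually_gt_at_top)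
      ultimately have "eventually (\<lambda>n. ereal (X n x / real n) \<le> ereal (rate + e)) sequentially"
        by eventually_elim (simp add: pos_divide_le_eq mult.commute)
      then have "limsup (\<lambda>n. ereal (X n x / real n)) \<le> ereal (rate + e)" by (rule Limsup_bounded)
      moreover have "liminf (\<lambda>n. ereal (X n x / real n)) \<le> limsup (\<lambda>n. ereal (X n x / real n))"
        by (rule Liminf_le_Limsup) simp
      ultimately show "lower_rate x \<le> rate + e"         by (metis liminf_eq_lower_rate order_trans ereal_less_eq(3))
    qed
  qed
  have int_lr: "integrable \<mu> lower_rate"
    by (rule integrable_bounded[OF lower_rate_measurable lower_rate_bound])
  then have int: "integrable \<mu> (\<lambda>x. rate - lower_rate x)" by simp
  have "(\<integral>x. rate - lower_rate x \<partial>\<mu>) = rate - (\<integral>x. lower_rate x \<partial>\<mu>)"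
    using int_lr
    by (subst Bochner_Integration.integral_diff) (auto intro: integrable_bounded simp: prob_UNIV)
  then have "(\<integral>x. rate - lower_rate x \<partial>\<mu>) \<le> 0" using rate_le_integral_lower_rate by simp
  moreover have "(\<integral>x. rate - lower_rate x \<partial>\<mu>) \<ge> 0"
    using le by (intro integral_nonneg_AE) auto
  ultimately have "(\<integral>x. rate - lower_rate x \<partial>\<mu>) = 0" by simp
  then have "AE x in \<mu>. rate - lower_rate x = 0"
    using integral_nonneg_eq_0_iff_AE[OF int] le by auto
  with upper show ?thesis
  proof eventually_elim
    case (elim x)
    show ?case
    proof (rule tendsto_of_linear_bounds)
      fix \<epsilon> :: real assume "\<epsilon> > 0"
      then show "eventually (\<lambda>n. X n x \<le> real n * (rate + \<epsilon>)) sequentially" using elim by blast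
      have "ereal (rate - \<epsilon>) < liminf (\<lambda>n. ereal (X n x / real n))"
        using elim \<open>\<epsilon> > 0\<close> by (simp add: liminf_eq_lower_rate)
      then have "eventually (\<lambda>n. ereal (rate - \<epsilon>) < ereal (X n x / real n)) sequentially"
        by (rule less_LiminfD)
      moreover have "eventually (\<lambda>n. n > 0) sequentially" by (rule eventually_gt_at_top)
      ultimately show "eventually (\<lambda>n. real n * (rate - \<epsilon>) \<le> X n x) sequentially"
        by eventually_elim (simp add: pos_less_divide_eq mult.commute less_imp_le)
    qed
  qed
qed

end

section \<open>Information dimension of exact dimensional measures\<close>

lemma card_vec_bounded:
  fixes A :: "'n::finite \<Rightarrow> 'b set"
  assumes "\<And>i. finite (A i)"
  shows "finite {j :: 'b^'n. \<forall>i. j $ i \<in> A i}" "card {j :: 'b^'n. \<forall>i. j $ i \<in> A i} \<le> (\<Prod>i\<in>UNIV. card (A i))"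
proof -
  have "{j :: 'b^'n. \<forall>i. j $ i \<in> A i} \<subseteq> (\<lambda>f. \<chi> i. f i) ` PiE UNIV A"
  proof
    fix j :: "'b^'n" assume "j \<in> {j. \<forall>i. j $ i \<in> A i}"
    then have "(\<lambda>i. j $ i) \<in> PiE UNIV A" "j = (\<chi> i. j $ i)" by auto
    then show "j \<in> (\<lambda>f. \<chi> i. f i) ` PiE UNIV A" by (intro image_eqI[of _ _ "\<lambda>i. j $ i"])
  qed
  moreover have fin: "finite (PiE UNIV A)" using assms by (intro finite_PiE) auto
  ultimately show "finite {j :: 'b^'n. \<forall>i. j $ i \<in> A i}" by (meson finite_imageI finite_subset)
  have "card {j :: 'b^'n. \<forall>i. j $ i \<in> A i} \<le> card (PiE UNIV A)"
    using fin \<open>_ \<subseteq> _\<close> by (rule surj_card_le)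
  then show "card {j :: 'b^'n. \<forall>i. j $ i \<in> A i} \<le> (\<Prod>i\<in>UNIV. card (A i))" by (simp add: card_PiE)
qed

text \<open>The ball is the section over its centre of the closed set of pairs at distance at most
  \<open>r\<close>, and measures of sections depend measurably on the base point.\<close>

lemma measurable_measure_cball:
  fixes \<nu> :: "'a::euclidean_space measure"
  assumes "finite_measure \<nu>" and sets: "sets \<nu> = sets borel"
  shows "(\<lambda>x. measure \<nu> (cball x r)) \<in> borel_measurable borel"
proof -
  interpret finite_measure \<nu> by fact
  have "{z :: 'a \<times> 'a. dist (fst z) (snd z) \<le> r} \<in> sets borel"
    by (intro borel_closed closed_Collect_le continuous_intros)
  moreover have "sets ((borel :: 'a measure) \<Otimes>\<^sub>M \<nu>) = sets (borel :: ('a \<times> 'a) measure)"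
    unfolding borel_prod[symmetric] by (rule sets_pair_measure_cong[OF refl sets])
  ultimately have "{z :: 'a \<times> 'a. dist (fst z) (snd z) \<le> r} \<in> sets (borel \<Otimes>\<^sub>M \<nu>)" by simp
  from measurable_emeasure_Pair[OF this]
  have "(\<lambda>x. emeasure \<nu> (cball x r)) \<in> borel_measurable borel"
    by (simp add: cball_def vimage_def)
  then show ?thesis unfolding measure_def by measurable
qed

text \<open>A member of \<open>mesh_cubes r\<close> addressed by its integer vector, so that sums
  over cubes become sums over indices.\<close>

definition mesh_cube :: "real \<Rightarrow> int^'n \<Rightarrow> (real^'n) set" where
  "mesh_cube r j = {x. \<forall>i. of_int (j $ i) * r \<le> x $ i \<and> x $ i < (of_int (j $ i) + 1) * r}"

definition mesh_index :: "real \<Rightarrow> real^'n \<Rightarrow> int^'n" where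
  "mesh_index r x = (\<chi> i. \<lfloor>x $ i / r\<rfloor>)"

lemma mem_mesh_cube_iff: "r > 0 \<Longrightarrow> x \<in> mesh_cube r j \<longleftrightarrow> j = mesh_index r x"
  by (auto simp: mesh_cube_def mesh_index_def vec_eq_iff eq_commute[of "_ $ _" "\<lfloor>_\<rfloor>"] floor_eq_iff
    pos_le_divide_eq pos_divide_less_eq)

lemma mesh_cube_borel [measurable]: "mesh_cube r j \<in> sets borel"
  unfolding mesh_cube_def by measurable

lemma inj_mesh_cube: "r > 0 \<Longrightarrow> inj (mesh_cube r :: int^'n \<Rightarrow> (real^'n) set)"
proof (rule injI)
  fix i j :: "int^'n" assume r: "r > 0" and eq: "mesh_cube r i = mesh_cube r j"
  have "(\<chi> k. of_int (i $ k) * r) \<in> mesh_cube r i" using r by (simp add: mesh_cube_def)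
  then show "i = j" using eq mem_mesh_cube_iff[OF r] by metis
qed

lemma mesh_cube_subset_cball:
  fixes x :: "real^'n"
  assumes "x \<in> mesh_cube r j" shows "mesh_cube r j \<subseteq> cball x (real CARD('n) * r)"
proof
  fix y assume y: "y \<in> mesh_cube r j"
  have "dist x y \<le> (\<Sum>i\<in>UNIV. \<bar>(x - y) $ i\<bar>)" unfolding dist_norm by (rule norm_le_l1_cart)
  also have "\<dots> \<le> (\<Sum>i\<in>(UNIV :: 'n set). r)"
  proof (rule sum_mono)
    fix i
    have "of_int (j $ i) * r \<le> x $ i" "x $ i < of_int (j $ i) * r + r"
      "of_int (j $ i) * r \<le> y $ i" "y $ i < of_int (j $ i) * r + r"
      using assms y by (auto simp: mesh_cube_def algebra_simps)
    then show "\<bar>(x - y) $ i\<bar> \<le> r" unfolding abs_le_iff by simp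
  qed
  finally show "y \<in> cball x (real CARD('n) * r)" by simp
qed

text \<open>The mesh cube \<open>j\<close> together with all its neighbours, 3 ^ N cubes in
  total.\<close>

definition fat_cube :: "real \<Rightarrow> int^'n \<Rightarrow> (real^'n) set" where
  "fat_cube r j = {x. \<forall>i. mesh_index r x $ i \<in> {j $ i - 1..j $ i + 1}}"

lemma fat_cube_borel [measurable]: "fat_cube r j \<in> sets borel"
  by (simp add: fat_cube_def mesh_index_def)

lemma cball_subset_fat_cube:
  fixes x :: "real^'n"
  assumes r: "r > 0" and x: "x \<in> mesh_cube r j" shows "cball x r \<subseteq> fat_cube r j"
proof
  fix y assume "y \<in> cball x r"
  then have *: "\<bar>(x - y) $ i\<bar> \<le> r" for i
    using component_le_norm_cart[of "x - y" i] by (simp add: dist_norm)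
  have "mesh_index r y $ i \<in> {j $ i - 1..j $ i + 1}" for i
  proof -
    have "y $ i / r \<le> x $ i / r + 1" "x $ i / r - 1 \<le> y $ i / r"
    proof -
      have "y $ i / r \<le> (x $ i + r) / r" "(x $ i - r) / r \<le> y $ i / r"
        using *[of i] r unfolding abs_le_iff by (intro divide_right_mono; simp)+
      then show "y $ i / r \<le> x $ i / r + 1" "x $ i / r - 1 \<le> y $ i / r"
        using r by (simp_all add: add_divide_distrib diff_divide_distrib)
    qed
    moreover have "j = mesh_index r x" using mem_mesh_cube_iff[OF r] x by blast
    ultimately show ?thesis by (simp add: mesh_index_def) linarith
  qed
  then show "y \<in> fat_cube r j" by (simp add: fat_cube_def)
qed

locale bounded_prob = prob_space \<nu> for \<nu> :: "(real^'n) measure" +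
  fixes R :: real
  assumes sets_nu [measurable_cong]: "sets \<nu> = sets borel" and R: "measure \<nu> (cball 0 R) = 1"
begin

lemma space_nu [simp]: "space \<nu> = UNIV"
  using sets_eq_imp_space_eq[OF sets_nu] by simp

definition charged :: "real \<Rightarrow> (int^'n) set" where
  "charged r = {j. measure \<nu> (mesh_cube r j) > 0}"

lemma R_nonneg: "R \<ge> 0"
proof (rule ccontr)
  assume "\<not> ?thesis" then have "cball (0 :: real^'n) R = {}" by simp
  with R show False by simp
qed

lemma charged_subset:
  assumes r: "r > 0"
  shows "charged r \<subseteq> {j. \<forall>i. j $ i \<in> {\<lfloor>- R / r\<rfloor>..\<lfloor>R / r\<rfloor>}}"
proof
  fix j assume j: "j \<in> charged r"
  have "mesh_cube r j \<inter> cball 0 R \<noteq> {}"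
  proof
    assume "mesh_cube r j \<inter> cball 0 R = {}"
    then have "measure \<nu> (mesh_cube r j \<union> cball 0 R) = measure \<nu> (mesh_cube r j) + 1"
      using finite_measure_Union[of "mesh_cube r j" "cball 0 R"] R by simp
    then show False using j prob_le_1[of "mesh_cube r j \<union> cball 0 R"] by (simp add: charged_def)
  qed
  then obtain x where x: "x \<in> mesh_cube r j" "norm x \<le> R" by auto
  have "j $ i \<in> {\<lfloor>- R / r\<rfloor>..\<lfloor>R / r\<rfloor>}" for i
  proof -
    have "\<bar>x $ i\<bar> \<le> R" using component_le_norm_cart[of x i] x(2) by simp
    then have "- R / r \<le> x $ i / r" "x $ i / r \<le> R / r"
      using r unfolding abs_le_iff by (intro divide_right_mono; simp)+
    then show ?thesis using x(1) by (auto simp: mem_mesh_cube_iff[OF r] mesh_index_def intro: floor_mono)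
  qed
  then show "j \<in> {j. \<forall>i. j $ i \<in> {\<lfloor>- R / r\<rfloor>..\<lfloor>R / r\<rfloor>}}" by simp
qed

lemma finite_charged: "r > 0 \<Longrightarrow> finite (charged r)"
  by (rule finite_subset[OF charged_subset card_vec_bounded(1)]) auto

lemma card_charged_le:
  assumes r: "0 < r" "r \<le> 1"
  shows "real (card (charged r)) * r ^ CARD('n) \<le> (2 * R + 2) ^ CARD('n)"
proof -
  have "card (charged r) \<le> card {j :: int^'n. \<forall>i. j $ i \<in> {\<lfloor>- R / r\<rfloor>..\<lfloor>R / r\<rfloor>}}"
    using r by (intro card_mono card_vec_bounded(1) charged_subset) auto
  also have "\<dots> \<le> (\<Prod>i\<in>(UNIV :: 'n set). card {\<lfloor>- R / r\<rfloor>..\<lfloor>R / r\<rfloor>})"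
    by (rule card_vec_bounded(2)) simp
  also have "\<dots> = card {\<lfloor>- R / r\<rfloor>..\<lfloor>R / r\<rfloor>} ^ CARD('n)" by (simp only: prod_constant)
  finally have "real (card (charged r)) \<le> real (card {\<lfloor>- R / r\<rfloor>..\<lfloor>R / r\<rfloor>}) ^ CARD('n)"
    by (metis of_nat_le_iff of_nat_power)
  also have "\<dots> \<le> ((2 * R + 2) / r) ^ CARD('n)"
  proof (rule power_mono)
    have "\<lfloor>- R / r\<rfloor> \<le> \<lfloor>R / r\<rfloor>" using R_nonneg r by (intro floor_mono divide_right_mono) auto
    then have "real (card {\<lfloor>- R / r\<rfloor>..\<lfloor>R / r\<rfloor>}) = of_int \<lfloor>R / r\<rfloor> - of_int \<lfloor>- R / r\<rfloor> + 1" by simp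
    also have "\<dots> \<le> 2 * (R / r) + 2" by (simp add: minus_divide_left[symmetric]) linarith
    also have "\<dots> \<le> (2 * R + 2) / r" using r by (simp add: field_simps)
    finally show "real (card {\<lfloor>- R / r\<rfloor>..\<lfloor>R / r\<rfloor>}) \<le> (2 * R + 2) / r" .
  qed simp
  finally show ?thesis using r by (simp add: power_divide pos_le_divide_eq)
qed

text \<open>A point lies in at most 3 ^ N fat cubes; integrate the number of those containing
  it.\<close>

lemma sum_fat_cubes_le:
  assumes r: "r > 0"
  shows "(\<Sum>j\<in>charged r. measure \<nu> (fat_cube r j)) \<le> 3 ^ CARD('n)"
proof -
  have "(\<Sum>j\<in>charged r. measure \<nu> (fat_cube r j)) = (\<integral>x. (\<Sum>j\<in>charged r. indicator (fat_cube r j) x :: real) \<partial>\<nu>)"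
    by (subst Bochner_Integration.integral_sum) (auto simp: less_top[symmetric])
  also have "\<dots> \<le> (\<integral>x. (3 :: real) ^ CARD('n) \<partial>\<nu>)"
  proof (rule integral_mono)
    show "integrable \<nu> (\<lambda>x. \<Sum>j\<in>charged r. indicator (fat_cube r j) x :: real)"
      by (intro Bochner_Integration.integrable_sum integrable_real_indicator) (auto simp: less_top[symmetric])
    fix x :: "real^'n"
    let ?A = "\<lambda>i. {mesh_index r x $ i - 1..mesh_index r x $ i + 1}"
    have "(\<Sum>j\<in>charged r. indicator (fat_cube r j) x) = real (card {j \<in> charged r. x \<in> fat_cube r j})"
      using finite_charged[OF r] by (simp add: indicator_def sum.If_cases Int_def)
    also have "\<dots> \<le> real (card {j :: int^'n. \<forall>i. j $ i \<in> ?A i})"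
    proof -
      have "{j \<in> charged r. x \<in> fat_cube r j} \<subseteq> {j. \<forall>i. j $ i \<in> ?A i}"
        by (auto simp: fat_cube_def) (smt (verit))+
      then show ?thesis by (intro of_nat_mono card_mono card_vec_bounded(1)) auto
    qed
    also have "\<dots> \<le> real (\<Prod>i\<in>UNIV. card (?A i))"
      by (intro of_nat_mono card_vec_bounded(2)) auto
    also have "\<dots> = 3 ^ CARD('n)" by simp
    finally show "(\<Sum>j\<in>charged r. indicator (fat_cube r j) x) \<le> (3 ^ CARD('n) :: real)" .
  qed simp
  also have "\<dots> = 3 ^ CARD('n)" using prob_space by simp
  finally show ?thesis .
qed

lemma AE_charged: "AE x in \<nu>. mesh_index r x \<in> charged r" if r: "r > 0"
proof -
  have "AE x in \<nu>. \<forall>j. j \<notin> charged r \<longrightarrow> x \<notin> mesh_cube r j"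
  proof (subst AE_all_countable, rule allI)
    fix j
    show "AE x in \<nu>. j \<notin> charged r \<longrightarrow> x \<notin> mesh_cube r j"
    proof (cases "j \<in> charged r")
      case False
      then have "measure \<nu> (mesh_cube r j) = 0" using measure_nonneg[of \<nu> "mesh_cube r j"] by (simp add: charged_def)
      then have "mesh_cube r j \<in> null_sets \<nu>" by (auto simp: null_sets_def emeasure_eq_measure sets_nu)
      from AE_not_in[OF this] show ?thesis by eventually_elim simp
    qed simp
  qed
  then show ?thesis by eventually_elim (use mem_mesh_cube_iff[OF r] in blast)
qed

lemma integral_step:
  assumes r: "r > 0"
  shows "(\<integral>x. (\<Sum>j\<in>charged r. b j * indicator (mesh_cube r j) x) \<partial>\<nu>) = (\<Sum>j\<in>charged r. measure \<nu> (mesh_cube r j) * (b j :: real))"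
    and "integrable \<nu> (\<lambda>x. \<Sum>j\<in>charged r. b j * indicator (mesh_cube r j) x)"
  by (subst Bochner_Integration.integral_sum) (auto simp: less_top[symmetric] mult.commute)

lemma step_eq:
  assumes r: "r > 0" and "mesh_index r x \<in> charged r"
  shows "(\<Sum>j\<in>charged r. b j * indicator (mesh_cube r j) x) = (b (mesh_index r x) :: real)"
proof -
  have "(\<Sum>j\<in>charged r. b j * indicator (mesh_cube r j) x) = (\<Sum>j\<in>charged r. if j = mesh_index r x then b j else 0)"
    by (intro sum.cong) (auto simp: mem_mesh_cube_iff[OF r] indicator_def)
  then show ?thesis using assms finite_charged[OF r] by simp
qed

definition entropy_sum :: "real \<Rightarrow> real" where
  "entropy_sum r = (\<Sum>j\<in>charged r. measure \<nu> (mesh_cube r j) * ln (measure \<nu> (mesh_cube r j)))"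

definition ball_weight :: "real \<Rightarrow> real^'n \<Rightarrow> real" where
  "ball_weight r x = max (measure \<nu> (cball x r)) (r ^ CARD('n))"

lemma ball_weight_measurable [measurable]: "ball_weight r \<in> borel_measurable \<nu>"
proof -
  have "(\<lambda>x. measure \<nu> (cball x r)) \<in> borel_measurable \<nu>"
    using measurable_measure_cball[OF finite_measure_axioms sets_nu] measurable_cong_sets[OF sets_nu refl] by blast
  then show ?thesis unfolding ball_weight_def[abs_def] by measurable
qed

lemma ball_weight_pos: "r > 0 \<Longrightarrow> ball_weight r x > 0"
  by (simp add: ball_weight_def less_max_iff_disj)

lemma ln_ball_weight_bounds:
  assumes "0 < r" "r < 1"
  shows "real CARD('n) * ln r \<le> ln (ball_weight r x)" "ln (ball_weight r x) \<le> 0"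
proof -
  have "r ^ CARD('n) \<le> ball_weight r x" by (simp add: ball_weight_def)
  then have "ln (r ^ CARD('n)) \<le> ln (ball_weight r x)" using assms ball_weight_pos[of r x] by simp
  then show "real CARD('n) * ln r \<le> ln (ball_weight r x)" using assms by (simp add: ln_realpow)
  have "ball_weight r x \<le> 1" using assms by (simp add: ball_weight_def power_le_one)
  then show "ln (ball_weight r x) \<le> 0" using assms ball_weight_pos[of r x] by simp
qed

lemma integrable_ln_ball_weight:
  assumes "0 < r" "r < 1" shows "integrable \<nu> (\<lambda>x. ln (ball_weight r x))"
proof (rule integrable_const_bound[where B = "- (real CARD('n) * ln r)"])
  show "AE x in \<nu>. norm (ln (ball_weight r x)) \<le> - (real CARD('n) * ln r)"
    using ln_ball_weight_bounds[OF assms] by (intro AE_I2) (simp add: abs_le_iff)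
qed measurable

text \<open>
  Gibbs' inequality compares the entropy of the mesh with the logarithm of the measures of balls;
  truncation at \<open>r\<^sup>N\<close> keeps the normalised logarithms bounded.
\<close>

lemma integral_ln_ball_weight_le:
  assumes r: "0 < r" "r < 1"
  shows "(\<integral>x. ln (ball_weight r x) \<partial>\<nu>) \<le> entropy_sum r + (3 ^ CARD('n) + (2 * R + 2) ^ CARD('n))"
proof -
  let ?q = "\<lambda>j. measure \<nu> (mesh_cube r j)"
  \<comment> \<open>The sum dominates the maximum in \<open>ball_weight\<close>, and its total over
    the charged cubes stays bounded as \<open>r\<close> tends to 0: the first terms by bounded
    overlap, the second by counting cubes.\<close>
  let ?b = "\<lambda>j. measure \<nu> (fat_cube r j) + r ^ CARD('n)"
  have b: "?b j > 0" for j using r by (simp add: add_nonneg_pos)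
  have "(\<integral>x. ln (ball_weight r x) \<partial>\<nu>) \<le> (\<integral>x. (\<Sum>j\<in>charged r. ln (?b j) * indicator (mesh_cube r j) x) \<partial>\<nu>)"
  proof (rule integral_mono_AE[OF integrable_ln_ball_weight[OF r] integral_step(2)[OF r(1)]])
    show "AE x in \<nu>. ln (ball_weight r x) \<le> (\<Sum>j\<in>charged r. ln (?b j) * indicator (mesh_cube r j) x)"
      using AE_charged[OF r(1)]
    proof eventually_elim
      case (elim x)
      have "measure \<nu> (cball x r) \<le> measure \<nu> (fat_cube r (mesh_index r x))"
        using cball_subset_fat_cube[OF r(1), of x "mesh_index r x"] mem_mesh_cube_iff[OF r(1)]
        by (intro finite_measure_mono) auto
      then have "ball_weight r x \<le> ?b (mesh_index r x)" using r by (simp add: ball_weight_def add_increasing2)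
      then have "ln (ball_weight r x) \<le> ln (?b (mesh_index r x))" using ball_weight_pos[OF r(1), of x] by simp
      then show ?case by (simp only: step_eq[OF r(1) elim])
    qed
  qed
  also have "\<dots> = (\<Sum>j\<in>charged r. ?q j * ln (?b j))" by (rule integral_step(1)[OF r(1)])
  also have "\<dots> \<le> (\<Sum>j\<in>charged r. ?q j * ln (?q j) + ?b j)"
  proof (rule sum_mono)
    fix j assume "j \<in> charged r"
    then have q: "?q j > 0" by (simp add: charged_def)
    \<comment> \<open>This is Gibbs' inequality in its weak form: ln t <= t - 1, weighted by the
      cube masses.\<close>
    have "ln (?b j) - ln (?q j) \<le> ?b j / ?q j"
      using ln_le_minus_one[of "?b j / ?q j"] q b[of j] by (simp add: ln_div)
    then have "?q j * (ln (?b j) - ln (?q j)) \<le> ?q j * (?b j / ?q j)" using q by (intro mult_left_mono) auto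
    then show "?q j * ln (?b j) \<le> ?q j * ln (?q j) + ?b j" using q by (simp add: right_diff_distrib)
  qed
  also have "\<dots> = entropy_sum r + ((\<Sum>j\<in>charged r. measure \<nu> (fat_cube r j)) + real (card (charged r)) * r ^ CARD('n))"
    by (simp add: sum.distrib entropy_sum_def)
  also have "\<dots> \<le> entropy_sum r + (3 ^ CARD('n) + (2 * R + 2) ^ CARD('n))"
    using sum_fat_cubes_le[OF r(1)] card_charged_le[of r] r by (intro add_left_mono add_mono) auto
  finally show ?thesis .
qed

text \<open>A cube of side \<open>r\<close> lies in the ball of radius N r about any of its
  points.\<close>

lemma entropy_sum_le:
  assumes r: "0 < r" "real CARD('n) * r < 1"
  shows "entropy_sum r \<le> (\<integral>x. ln (ball_weight (real CARD('n) * r) x) \<partial>\<nu>)"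
proof -
  let ?q = "\<lambda>j. measure \<nu> (mesh_cube r j)"
  let ?s = "real CARD('n) * r"
  have s: "0 < ?s" using r by simp
  have "entropy_sum r = (\<integral>x. (\<Sum>j\<in>charged r. ln (?q j) * indicator (mesh_cube r j) x) \<partial>\<nu>)"
    unfolding entropy_sum_def by (rule integral_step(1)[OF r(1), symmetric])
  also have "\<dots> \<le> (\<integral>x. ln (ball_weight ?s x) \<partial>\<nu>)"
  proof (rule integral_mono_AE[OF integral_step(2)[OF r(1)] integrable_ln_ball_weight[OF s r(2)]])
    show "AE x in \<nu>. (\<Sum>j\<in>charged r. ln (?q j) * indicator (mesh_cube r j) x) \<le> ln (ball_weight ?s x)"
      using AE_charged[OF r(1)]
    proof eventually_elim
      case (elim x)
      have "?q (mesh_index r x) \<le> measure \<nu> (cball x ?s)"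
        using mesh_cube_subset_cball[of x r "mesh_index r x"] mem_mesh_cube_iff[OF r(1)]
        by (intro finite_measure_mono) auto
      also have "\<dots> \<le> ball_weight ?s x" by (simp add: ball_weight_def)
      finally have "ln (?q (mesh_index r x)) \<le> ln (ball_weight ?s x)"
        using elim by (simp add: charged_def)
      then show ?case by (simp only: step_eq[OF r(1) elim])
    qed
  qed
  finally show ?thesis .
qed

definition normalized_log :: "real \<Rightarrow> real" where
  "normalized_log r = (\<integral>x. ln (ball_weight r x) / ln r \<partial>\<nu>)"

text \<open>Division by \<open>ln r < 0\<close> turns the truncation from below into a minimum with
  N, which leaves a limit \<open>d <= N\<close> unchanged.\<close>

lemma tendsto_ball_weight_quotient:
  assumes d: "d \<le> real CARD('n)" and pos: "\<And>r. r > 0 \<Longrightarrow> measure \<nu> (cball x r) > 0"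
    and lim: "((\<lambda>r. ln (measure \<nu> (cball x r)) / ln r) \<longlongrightarrow> d) (at_right 0)"
  shows "((\<lambda>r. ln (ball_weight r x) / ln r) \<longlongrightarrow> d) (at_right 0)"
proof -
  have "((\<lambda>r. min (ln (measure \<nu> (cball x r)) / ln r) (real CARD('n))) \<longlongrightarrow> min d (real CARD('n))) (at_right 0)"
    by (intro tendsto_min lim tendsto_const)
  moreover have "eventually (\<lambda>r. min (ln (measure \<nu> (cball x r)) / ln r) (real CARD('n)) = ln (ball_weight r x) / ln r) (at_right 0)"
  proof -
    have "eventually (\<lambda>r. r \<in> {0<..<1}) (at_right (0 :: real))" by (rule eventually_at_right_real) simp
    then show ?thesis
    proof eventually_elim
      case (elim r)
      then have r: "0 < r" "ln r < 0" by auto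
      define m where "m = measure \<nu> (cball x r)"
      have m: "m > 0" using pos[OF r(1)] by (simp add: m_def)
      have "ln (max m (r ^ CARD('n))) = max (ln m) (real CARD('n) * ln r)"
        using m r by (auto simp: max_def ln_realpow[symmetric])
      moreover have "max (ln m) (real CARD('n) * ln r) / ln r = min (ln m / ln r) (real CARD('n))"
        using r by (auto simp: max_def min_def neg_le_divide_eq neg_divide_le_eq mult.commute)
      ultimately show ?case by (simp add: ball_weight_def m_def)
    qed
  qed
  ultimately show ?thesis using d by (simp add: min_def Lim_transform_eventually)
qed

text \<open>Dominated convergence along arbitrary sequences of radii; the truncation bounds the
  normalised logarithms by N.\<close>

lemma normalized_log_tendsto:
  assumes d: "d \<le> real CARD('n)"
    and lim: "AE x in \<nu>. (\<forall>r>0. measure \<nu> (cball x r) > 0) \<and>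
      ((\<lambda>r. ln (measure \<nu> (cball x r)) / ln r) \<longlongrightarrow> d) (at_right 0)"
  shows "(normalized_log \<longlongrightarrow> d) (at_right 0)"
proof -
  \<comment> \<open>The value 0 outside (0, 1) makes the bound by N valid for every radius.\<close>
  define g where "g r x = (if 0 < r \<and> r < 1 then ln (ball_weight r x) / ln r else 0)" for r x
  have g_bound: "norm (g r x) \<le> real CARD('n)" for r x
  proof (cases "0 < r \<and> r < 1")
    case True
    then have "ln r < 0" by simp
    then have "0 \<le> ln (ball_weight r x) / ln r" "ln (ball_weight r x) / ln r \<le> real CARD('n)"
      using ln_ball_weight_bounds[of r x] True by (auto simp: neg_divide_le_eq divide_nonpos_neg)
    then show ?thesis using True by (simp add: g_def)
  qed (auto simp: g_def)
  have g_meas [measurable]: "g r \<in> borel_measurable \<nu>" for r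
    unfolding g_def[abs_def] by (cases "0 < r \<and> r < 1") auto
  have "((\<lambda>r. \<integral>x. g r x \<partial>\<nu>) \<longlongrightarrow> d) (at_right 0)"
    unfolding tendsto_at_iff_sequentially
  proof (intro allI impI)
    fix S :: "nat \<Rightarrow> real" assume S: "\<forall>i. S i \<in> {0<..} - {0}" "S \<longlonglongrightarrow> 0"
    have S0: "filterlim S (at_right 0) sequentially"
    proof -
      have "S i > 0" "S i \<noteq> 0" for i using S(1) by (metis DiffD1 greaterThan_iff, metis DiffD2 singletonI)
      then show ?thesis using S(2) unfolding filterlim_at by simp
    qed
    have ev: "eventually (\<lambda>r. r \<in> {0<..<1}) (at_right (0 :: real))" by (rule eventually_at_right_real) simp
    have "(\<lambda>i. \<integral>x. g (S i) x \<partial>\<nu>) \<longlonglongrightarrow> (\<integral>x. d \<partial>\<nu>)"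
    proof (rule integral_dominated_convergence[where w = "\<lambda>_. real CARD('n)"])
      show "AE x in \<nu>. (\<lambda>i. g (S i) x) \<longlonglongrightarrow> d"
        using lim
      proof eventually_elim
        case (elim x)
        then have "((\<lambda>r. ln (ball_weight r x) / ln r) \<longlongrightarrow> d) (at_right 0)"
          by (intro tendsto_ball_weight_quotient d) auto
        moreover have "eventually (\<lambda>r. ln (ball_weight r x) / ln r = g r x) (at_right 0)"
          using ev by eventually_elim (simp add: g_def)
        ultimately have "((\<lambda>r. g r x) \<longlongrightarrow> d) (at_right 0)" by (rule Lim_transform_eventually)
        then show ?case using S0 by (rule filterlim_compose)
      qed
    qed (use g_bound in auto)
    then show "((\<lambda>r. \<integral>x. g r x \<partial>\<nu>) \<circ> S) \<longlonglongrightarrow> d" using prob_space by (simp add: o_def)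
  qed
  moreover have "eventually (\<lambda>r. (\<integral>x. g r x \<partial>\<nu>) = normalized_log r) (at_right 0)"
  proof -
    have "eventually (\<lambda>r. r \<in> {0<..<1}) (at_right (0 :: real))" by (rule eventually_at_right_real) simp
    then show ?thesis by eventually_elim (simp add: g_def normalized_log_def)
  qed
  ultimately show ?thesis by (rule Lim_transform_eventually)
qed

text \<open>Division by the negative \<open>ln r\<close> reverses the two entropy estimates and
  places the quotient between \<open>normalized_log\<close> at N r, times a factor tending to 1, and
  \<open>normalized_log\<close> at r, up to an error D / ln r. Only finitely many cubes are charged,
  so the infinite sum is finite.\<close>

lemma has_information_dimension_of_local_dimension:
  assumes d: "d \<le> real CARD('n)"
    and lim: "AE x in \<nu>. (\<forall>r>0. measure \<nu> (cball x r) > 0) \<and>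
      ((\<lambda>r. ln (measure \<nu> (cball x r)) / ln r) \<longlongrightarrow> d) (at_right 0)"
  shows "has_information_dimension \<nu> d"
proof -
  let ?M = "real CARD('n)"
  have cubes: "charged_cubes \<nu> r = mesh_cube r ` charged r" for r
    unfolding charged_cubes_def mesh_cubes_def charged_def mesh_cube_def[symmetric] by auto
  have sum_eq: "(\<Sum>\<^sub>\<infinity>C\<in>charged_cubes \<nu> r. measure \<nu> C * ln (measure \<nu> C)) = entropy_sum r" if "r > 0" for r
  proof -
    have "(\<Sum>\<^sub>\<infinity>C\<in>charged_cubes \<nu> r. measure \<nu> C * ln (measure \<nu> C))
        = (\<Sum>C\<in>mesh_cube r ` charged r. measure \<nu> C * ln (measure \<nu> C))"
      unfolding cubes by (rule infsum_finite) (simp add: finite_charged[OF that])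
    also have "\<dots> = entropy_sum r"
      unfolding entropy_sum_def using inj_mesh_cube[OF that]
      by (subst sum.reindex) (auto simp: inj_on_def)
    finally show ?thesis .
  qed
  have pos: "eventually (\<lambda>r. r > 0) (at_right (0 :: real))" by (rule eventually_at_right_less)
  define D where "D = 3 ^ CARD('n) + (2 * R + 2) ^ CARD('n)"
  have ln_lim: "filterlim ln at_bot (at_right (0 :: real))" by (rule ln_at_0)
  have "((\<lambda>r. normalized_log r - D / ln r) \<longlongrightarrow> d - 0) (at_right 0)"
    by (intro tendsto_diff normalized_log_tendsto[OF d lim] tendsto_divide_0[OF tendsto_const]
       filterlim_at_bot_imp_at_infinity ln_lim)
  then have up: "((\<lambda>r. normalized_log r - D / ln r) \<longlongrightarrow> d) (at_right 0)" by simp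
  have "filterlim (\<lambda>r. ?M * r) (at_right 0) (at_right 0)"
  proof -
    have "((\<lambda>r. ?M * r) \<longlongrightarrow> ?M * 0) (at_right 0)" by (intro tendsto_intros)
    then show ?thesis unfolding filterlim_at using pos by (auto elim!: eventually_mono)
  qed
  then have "((\<lambda>r. normalized_log (?M * r)) \<longlongrightarrow> d) (at_right 0)"
    by (rule filterlim_compose[OF normalized_log_tendsto[OF d lim]])
  moreover have "((\<lambda>r. ln (?M * r) / ln r) \<longlongrightarrow> 1) (at_right 0)"
  proof -
    have "((\<lambda>r. ln ?M / ln r + 1) \<longlongrightarrow> 0 + 1) (at_right 0)"
      by (intro tendsto_add tendsto_const tendsto_divide_0[OF tendsto_const] filterlim_at_bot_imp_at_infinity ln_lim)
    moreover have "eventually (\<lambda>r. r \<in> {0<..<1}) (at_right (0 :: real))" by (rule eventually_at_right_real) simp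
    then have "eventually (\<lambda>r. ln ?M / ln r + 1 = ln (?M * r) / ln r) (at_right 0)"
      by eventually_elim (simp add: ln_mult add_divide_distrib)
    ultimately show ?thesis by (simp add: Lim_transform_eventually)
  qed
  ultimately have low: "((\<lambda>r. normalized_log (?M * r) * (ln (?M * r) / ln r)) \<longlongrightarrow> d * 1) (at_right 0)"
    by (rule tendsto_mult)
  have small: "eventually (\<lambda>r. r \<in> {0<..<1 / ?M}) (at_right (0 :: real))" by (rule eventually_at_right_real) simp
  have "((\<lambda>r. entropy_sum r / ln r) \<longlongrightarrow> d) (at_right 0)"
  proof (rule tendsto_sandwich[OF _ _ low[unfolded mult_1_right] up])
    show "eventually (\<lambda>r. normalized_log (?M * r) * (ln (?M * r) / ln r) \<le> entropy_sum r / ln r) (at_right 0)"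
      using small
    proof eventually_elim
      case (elim r)
      have "?M \<ge> 1" by (simp add: Suc_le_eq)
      with elim have r: "0 < r" "?M * r < 1" "r \<le> ?M * r" by (auto simp: pos_less_divide_eq mult.commute)
      then have "r < 1" by linarith
      with r have neg: "ln r < 0" "ln (?M * r) < 0" by auto
      have "entropy_sum r \<le> (\<integral>x. ln (ball_weight (?M * r) x) \<partial>\<nu>)" by (rule entropy_sum_le[OF r(1,2)])
      also have "\<dots> = normalized_log (?M * r) * ln (?M * r)"
        using neg(2) by (simp add: normalized_log_def)
      finally have "normalized_log (?M * r) * ln (?M * r) / ln r \<le> entropy_sum r / ln r"
        using neg(1) by (intro divide_right_mono_neg) auto
      then show ?case by simp
    qed
    show "eventually (\<lambda>r. entropy_sum r / ln r \<le> normalized_log r - D / ln r) (at_right 0)"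
    proof -
      have "eventually (\<lambda>r. r \<in> {0<..<1}) (at_right (0 :: real))" by (rule eventually_at_right_real) simp
      then show ?thesis
      proof eventually_elim
        case (elim r)
        then have neg: "ln r < 0" by simp
        have "normalized_log r * ln r = (\<integral>x. ln (ball_weight r x) \<partial>\<nu>)"
          using neg by (simp add: normalized_log_def)
        also have "\<dots> \<le> entropy_sum r + D" unfolding D_def
          by (rule integral_ln_ball_weight_le) (use elim in auto)
        finally have "normalized_log r * ln r - D \<le> entropy_sum r" by simp
        then have "entropy_sum r / ln r \<le> (normalized_log r * ln r - D) / ln r"
          using neg by (simp add: divide_right_mono_neg)
        then show ?case using neg by (simp add: diff_divide_distrib)
      qed
    qed
  qed
  moreover have "eventually (\<lambda>r. entropy_sum r / ln r =
      (\<Sum>\<^sub>\<infinity>C\<in>charged_cubes \<nu> r. measure \<nu> C * ln (measure \<nu> C)) / ln r) (at_right 0)"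
    using pos by eventually_elim (simp add: sum_eq)
  ultimately have "((\<lambda>r. (\<Sum>\<^sub>\<infinity>C\<in>charged_cubes \<nu> r. measure \<nu> C * ln (measure \<nu> C)) / ln r) \<longlongrightarrow> d) (at_right 0)"
    by (rule Lim_transform_eventually)
  moreover have "eventually (\<lambda>r. (\<lambda>C. measure \<nu> C * ln (measure \<nu> C)) summable_on charged_cubes \<nu> r) (at_right 0)"
    using pos by eventually_elim (simp add: cubes finite_charged)
  ultimately show ?thesis by (simp add: has_information_dimension_def)
qed

end

section \<open>Lyapunov exponents and the critical exponent\<close>

lemma word_map_Nil [simp]: "word_map T [] = id"
  by (simp add: word_map_def)

lemma word_map_Cons: "word_map T (i # w) = T i \<circ> word_map T w"
  by (simp add: word_map_def)

lemma word_map_append: "word_map T (u @ v) = word_map T u \<circ> word_map T v"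
  by (induction u) (simp_all add: word_map_Cons o_assoc)

locale self_affine_system = bernoulli p \<mu> for p :: "'m::finite \<Rightarrow> real" and \<mu> +
  fixes T :: "'m \<Rightarrow> real^'n \<Rightarrow> real^'n"
  assumes contraction: "\<And>i. linear_contraction (T i)" and nonsingular: "\<And>i. bij (T i)"
    and card_ge_2: "CARD('m) \<ge> 2"
begin

abbreviation \<phi> :: "real \<Rightarrow> 'm list \<Rightarrow> real" where
  "\<phi> s w \<equiv> singular_value_function s (word_map T w)"

lemma linear_T: "linear (T i)" and onorm_T: "onorm (T i) < 1"
  using contraction[of i] by (auto simp: linear_contraction_def)

lemma nonsingular_T: "nonsingular_map (T i)"
  by (simp add: nonsingular_map_def linear_T nonsingular)

lemma nonsingular_word_map: "nonsingular_map (word_map T w)"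
proof (induction w)
  case Nil then show ?case unfolding word_map_Nil nonsingular_map_def by (intro conjI linear_id bij_id)
next
  case (Cons i w) then show ?case unfolding word_map_Cons by (rule nonsingular_map_compose[OF nonsingular_T])
qed

sublocale wm: nonsingular_map "word_map T w" for w by (rule nonsingular_word_map)

lemma linear_word_map: "linear (word_map T w)"
  by (rule wm.lin)

lemma expansion_bounds:
  obtains a b :: real where "0 < a" "a \<le> b" "b < 1"
    "\<And>w v. norm (word_map T w v) \<le> b ^ length w * norm v"
    "\<And>w v. a ^ length w * norm v \<le> norm (word_map T w v)"
proof -
  define b where "b = Max (range (\<lambda>i. onorm (T i)))"
  have b1: "b < 1" unfolding b_def using onorm_T by (subst Max_less_iff) auto
  have Tb: "norm (T i v) \<le> b * norm v" for i v
  proof -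
    have "norm (T i v) \<le> onorm (T i) * norm v"
      by (rule onorm) (simp add: linear_conv_bounded_linear[symmetric] linear_T)
    also have "\<dots> \<le> b * norm v" unfolding b_def by (intro mult_right_mono Max_ge) auto
    finally show ?thesis .
  qed
  have "\<exists>c>0. \<forall>v. c * norm v \<le> norm (T i v)" for i
    using linear_inj_bounded_below_pos[OF linear_T bij_is_inj[OF nonsingular], of i] by metis
  then obtain c where c: "\<And>i. c i > 0" "\<And>i v. c i * norm v \<le> norm (T i v)" by metis
  define a where "a = Min (range c)"
  have a0: "a > 0" unfolding a_def using c(1) by (subst Min_gr_iff) auto
  have Ta: "a * norm v \<le> norm (T i v)" for i v
  proof -
    have "a * norm v \<le> c i * norm v" unfolding a_def by (intro mult_right_mono Min_le) auto
    then show ?thesis using c(2)[of i v] by simp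
  qed
  obtain v :: "real^'n" where v: "norm v = 1" using vector_choose_size[of 1] by auto
  have ab: "a \<le> b" using Ta[of v undefined] Tb[of undefined v] v by simp
  have "norm (word_map T w v) \<le> b ^ length w * norm v" for w v
  proof (induction w)
    case (Cons i w)
    have "norm (T i (word_map T w v)) \<le> b * norm (word_map T w v)" by (rule Tb)
    also have "\<dots> \<le> b * (b ^ length w * norm v)" using Cons a0 ab by (intro mult_left_mono) auto
    finally show ?case by (simp add: word_map_Cons mult_ac)
  qed simp
  moreover have "a ^ length w * norm v \<le> norm (word_map T w v)" for w v
  proof (induction w)
    case (Cons i w)
    have "a * (a ^ length w * norm v) \<le> a * norm (word_map T w v)" using Cons a0 by (intro mult_left_mono) auto
    also have "\<dots> \<le> norm (T i (word_map T w v))" by (rule Ta)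
    finally show ?case by (simp add: word_map_Cons mult_ac)
  qed simp
  ultimately show thesis using that a0 ab b1 by blast
qed

lemma ln_sv_bounds:
  obtains A B where "A \<le> B" "B < 0" "\<And>w j. j < CARD('n) \<Longrightarrow> real (length w) * A \<le> ln (wm.\<alpha> w j)"
    "\<And>w j. j < CARD('n) \<Longrightarrow> ln (wm.\<alpha> w j) \<le> real (length w) * B"
proof -
  obtain a b :: real where ab: "0 < a" "a \<le> b" "b < 1"
    and upper: "\<And>w v. norm (word_map T w v) \<le> b ^ length w * norm v"
    and lower: "\<And>w v. a ^ length w * norm v \<le> norm (word_map T w v)" using expansion_bounds by metis
  have *: "a ^ length w \<le> wm.\<alpha> w j" "wm.\<alpha> w j \<le> b ^ length w" if j: "j < CARD('n)" for w j
  proof -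
    obtain v where "norm v = 1" "norm (word_map T w v) = wm.\<alpha> w j" using wm.sv_attained[OF j] .
    then show "a ^ length w \<le> wm.\<alpha> w j" "wm.\<alpha> w j \<le> b ^ length w"
      using upper[of w v] lower[of w v] by auto
  qed
  show thesis
  proof (rule that[of "ln a" "ln b"])
    fix w j assume j: "j < CARD('n)"
    have "ln (a ^ length w) \<le> ln (wm.\<alpha> w j)" "ln (wm.\<alpha> w j) \<le> ln (b ^ length w)"
      using *[OF j, of w] wm.sv_pos[OF j, of w] ab by auto
    then show "real (length w) * ln a \<le> ln (wm.\<alpha> w j)" "ln (wm.\<alpha> w j) \<le> real (length w) * ln b"
      using ab by (simp_all add: ln_realpow)
  qed (use ab in auto)
qed

text \<open>Per letter and per unit of the exponent, ln \<phi> drops by an amount bounded above and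
  away from 0, uniformly over words. In the limit this yields continuity and strict monotonicity of
  the pressure.\<close>

lemma ln_\<phi>_diff:
  obtains A B where "A \<le> B" "B < 0"
    "\<And>s t w. 0 \<le> s \<Longrightarrow> s \<le> t \<Longrightarrow> real (length w) * ((t - s) * A) \<le> ln (\<phi> t w) - ln (\<phi> s w)"
    "\<And>s t w. 0 \<le> s \<Longrightarrow> s \<le> t \<Longrightarrow> ln (\<phi> t w) - ln (\<phi> s w) \<le> real (length w) * ((t - s) * B)"
proof -
  obtain A B where AB: "A \<le> B" "B < 0" "\<And>w j. j < CARD('n) \<Longrightarrow> real (length w) * A \<le> ln (wm.\<alpha> w j)"
    "\<And>w j. j < CARD('n) \<Longrightarrow> ln (wm.\<alpha> w j) \<le> real (length w) * B" using ln_sv_bounds by metis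
  show thesis
  proof (rule that[OF AB(1,2)])
    fix s t :: real and w :: "'m list" assume st: "0 \<le> s" "s \<le> t"
    show "real (length w) * ((t - s) * A) \<le> ln (\<phi> t w) - ln (\<phi> s w)"
      using wm.ln_svf_diff_ge[OF st AB(3), of w] by (simp add: mult_ac)
    show "ln (\<phi> t w) - ln (\<phi> s w) \<le> real (length w) * ((t - s) * B)"
      using wm.ln_svf_diff_le[OF st AB(4), of w] by (simp add: mult_ac)
  qed
qed

section \<open>Growth rates of \<phi>^s and of cylinder weights, pressure and critical
  exponent\<close>

lemma average_add_const: "average (\<lambda>w. g w + c) n = average g n + c"
  by (simp add: average_def distrib_left sum.distrib sum_distrib_right[symmetric] sum_weight)

lemma average_diff: "average (\<lambda>w. g w - h w) n = average g n - average h n"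
  by (simp add: average_def right_diff_distrib sum_subtractf)

lemma average_mono: "(\<And>w. length w = n \<Longrightarrow> g w \<le> h w) \<Longrightarrow> average g n \<le> average h n"
  unfolding average_def by (intro sum_mono mult_left_mono weight_nonneg) auto

lemma average_const: "average (\<lambda>w. c * f (length w)) n = c * f n" for c :: real
proof -
  have "average (\<lambda>w. c * f (length w)) n = (\<Sum>w | length w = n. weight w * (c * f n))"
    unfolding average_def by (intro sum.cong) auto
  then show ?thesis by (simp add: sum_distrib_right[symmetric] sum_weight)
qed

lemma subadditive_rate_exists:
  assumes s: "0 \<le> s"
  shows "\<exists>L. (\<lambda>n. average (\<lambda>w. ln (\<phi> s w)) n / real n) \<longlonglongrightarrow> L \<and>
    (AE x in \<mu>. (\<lambda>n. ln (\<phi> s (code_prefix x n)) / real n) \<longlonglongrightarrow> L)"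
proof -
  obtain C where C: "C \<ge> 1" "\<And>f g :: real^'n \<Rightarrow> real^'n. nonsingular_map f \<Longrightarrow> nonsingular_map g \<Longrightarrow>
    singular_value_function s (f \<circ> g) \<le> C * (singular_value_function s f * singular_value_function s g)"
    using svf_compose_le[OF s] by metis
  have lnC: "ln C \<ge> 0" using C(1) by simp
  have ln_le: "ln (singular_value_function s (f \<circ> g)) \<le>
      ln C + ln (singular_value_function s f) + ln (singular_value_function s g)"
    if f: "nonsingular_map f" and g: "nonsingular_map g" for f g :: "real^'n \<Rightarrow> real^'n"
  proof -
    have pos: "singular_value_function s f > 0" "singular_value_function s g > 0"
        "singular_value_function s (f \<circ> g) > 0"
      using nonsingular_map.svf_pos[OF _ s] f g nonsingular_map_compose[OF f g] by auto
    have "ln (singular_value_function s (f \<circ> g)) \<le> ln (C * (singular_value_function s f * singular_value_function s g))"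
      using C(2)[OF f g] pos C(1) by simp
    then show ?thesis using pos C(1) by (simp add: ln_mult)
  qed
  have inv: "nonsingular_map (inv (T i))" for i
    unfolding nonsingular_map_def
    by (intro conjI inj_linear_imp_inv_linear linear_T bij_imp_bij_inv nonsingular bij_is_inj)
  define E where "E = (\<Sum>i\<in>UNIV. \<bar>ln (singular_value_function s (inv (T i)))\<bar>)"
  have E: "ln (singular_value_function s (inv (T i))) \<le> E" for i
  proof -
    have "\<bar>ln (singular_value_function s (inv (T i)))\<bar> \<le> E" unfolding E_def by (rule member_le_sum) auto
    then show ?thesis by simp
  qed
  have E0: "E \<ge> 0" unfolding E_def by (rule sum_nonneg) simp
  obtain A B where AB: "A \<le> B" "B < 0"
    "\<And>s t w. 0 \<le> s \<Longrightarrow> s \<le> t \<Longrightarrow> real (length w) * ((t - s) * A) \<le> ln (\<phi> t w) - ln (\<phi> s w)"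
    "\<And>s t w. 0 \<le> s \<Longrightarrow> s \<le> t \<Longrightarrow> ln (\<phi> t w) - ln (\<phi> s w) \<le> real (length w) * ((t - s) * B)"
    using ln_\<phi>_diff by metis
  define K where "K = s * (- A) + ln C + E"
  \<comment> \<open>Adding \<open>ln C\<close> turns submultiplicativity up to the factor
    \<open>C\<close> into exact subadditivity; after division by \<open>n\<close> it
    disappears.\<close>
  let ?a = "\<lambda>w. ln (\<phi> s w) + ln C"
  interpret c: subadditive_cocycle p \<mu> ?a K
  proof
    fix u v
    show "ln (\<phi> s (u @ v)) + ln C \<le> ln (\<phi> s u) + ln C + (ln (\<phi> s v) + ln C)"
      unfolding word_map_append using ln_le[OF nonsingular_word_map nonsingular_word_map, of u v] by simp
  next
    fix w
    have l: "real (length w) * (s * A) \<le> ln (\<phi> s w)" "ln (\<phi> s w) \<le> real (length w) * (s * B)"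
      using AB(3)[of 0 s w] AB(4)[of 0 s w] s by (simp_all add: wm.svf_0)
    have "real (length w) * (s * B) \<le> 0" using AB s by (simp add: mult_nonneg_nonpos)
    then have "\<bar>ln (\<phi> s w) + ln C\<bar> \<le> real (length w) * (s * (- A)) + ln C"
      using l lnC unfolding abs_le_iff by (simp add: algebra_simps)
    also have "\<dots> \<le> real (length w) * K + K"
    proof (rule add_mono)
      show "real (length w) * (s * (- A)) \<le> real (length w) * K"
        unfolding K_def using lnC E0 by (intro mult_left_mono) auto
      have "0 \<le> s * (- A)" using AB s by (intro mult_nonneg_nonneg) auto
      then show "ln C \<le> K" using E0 by (simp add: K_def)
    qed
    finally show "\<bar>ln (\<phi> s w) + ln C\<bar> \<le> K * (real (length w) + 1)" by (simp add: algebra_simps)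
  next
    fix i w
    \<comment> \<open>The first letter is removed by composing with the inverse of
      \<open>T i\<close>, whose singular value function enters the constant through
      \<open>E\<close>.\<close>
    have "word_map T w = inv (T i) \<circ> word_map T (i # w)"
      by (simp add: word_map_Cons o_assoc bij_is_inj[OF nonsingular] fun_eq_iff inv_f_f)
    then have "ln (\<phi> s w) \<le> ln C + ln (singular_value_function s (inv (T i))) + ln (\<phi> s (i # w))"
      using ln_le[OF inv nonsingular_word_map, of i "i # w"] by simp
    moreover have "0 \<le> s * (- A)" using AB s by (intro mult_nonneg_nonneg) auto
    ultimately show "ln (\<phi> s w) + ln C \<le> ln (\<phi> s (i # w)) + ln C + K" using E[of i] by (simp add: K_def)
  qed
  have null: "(\<lambda>n. ln C / real n) \<longlonglongrightarrow> 0" by (rule lim_const_over_n)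
  have "(\<lambda>n. average ?a n / real n - ln C / real n) \<longlonglongrightarrow> c.rate - 0"
    by (intro tendsto_diff c.average_tendsto null)
  then have "(\<lambda>n. average (\<lambda>w. ln (\<phi> s w)) n / real n) \<longlonglongrightarrow> c.rate"
    by (simp add: average_add_const add_divide_distrib)
  moreover have "AE x in \<mu>. (\<lambda>n. ln (\<phi> s (code_prefix x n)) / real n) \<longlonglongrightarrow> c.rate"
    using c.AE_X_tendsto
  proof eventually_elim
    case (elim x)
    then have "(\<lambda>n. ?a (code_prefix x n) / real n - ln C / real n) \<longlonglongrightarrow> c.rate - 0"
      by (intro tendsto_diff null)
    then show ?case by (simp add: add_divide_distrib)
  qed
  ultimately show ?thesis by blast
qed

text \<open>For an integer s = l <= N this is the sum of the l largest Lyapunov exponents of the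
  random product; other exponents up to N interpolate.\<close>

definition lyapunov :: "real \<Rightarrow> real" where
  "lyapunov s = lim (\<lambda>n. average (\<lambda>w. ln (\<phi> s w)) n / real n)"

lemma lyapunov_tendsto: "0 \<le> s \<Longrightarrow> (\<lambda>n. average (\<lambda>w. ln (\<phi> s w)) n / real n) \<longlonglongrightarrow> lyapunov s"
  using subadditive_rate_exists[of s] limI unfolding lyapunov_def by blast

lemma AE_lyapunov:
  assumes "0 \<le> s" shows "AE x in \<mu>. (\<lambda>n. ln (\<phi> s (code_prefix x n)) / real n) \<longlonglongrightarrow> lyapunov s"
proof -
  obtain L where L: "(\<lambda>n. average (\<lambda>w. ln (\<phi> s w)) n / real n) \<longlonglongrightarrow> L"
    "AE x in \<mu>. (\<lambda>n. ln (\<phi> s (code_prefix x n)) / real n) \<longlonglongrightarrow> L" using subadditive_rate_exists[OF assms] by blast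
  then show ?thesis unfolding lyapunov_def by (simp add: limI)
qed

text \<open>Equal to the sum of the p_i log p_i, the negative of the entropy of the Bernoulli
  measure. As a limit of averages it has the same form as \<open>lyapunov\<close>, and its almost
  sure version comes from the same theorem.\<close>

definition log_weight_rate :: real where
  "log_weight_rate = lim (\<lambda>n. average (\<lambda>w. ln (weight w)) n / real n)"

lemma log_weight_rate_tendsto: "(\<lambda>n. average (\<lambda>w. ln (weight w)) n / real n) \<longlonglongrightarrow> log_weight_rate"
  and AE_log_weight_rate: "AE x in \<mu>. (\<lambda>n. ln (weight (code_prefix x n)) / real n) \<longlonglongrightarrow> log_weight_rate"
proof -
  define K where "K = (\<Sum>i\<in>UNIV. \<bar>ln (p i)\<bar>)"
  have K: "\<bar>ln (p i)\<bar> \<le> K" for i unfolding K_def by (rule member_le_sum) auto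
  have K0: "K \<ge> 0" unfolding K_def by (rule sum_nonneg) simp
  have cons: "ln (weight (i # w)) = ln (p i) + ln (weight w)" for i w
    using p_pos[of i] weight_pos[of w] by (simp add: ln_mult weight_def)
  interpret c: subadditive_cocycle p \<mu> "\<lambda>w. ln (weight w)" K
  proof
    show "ln (weight (u @ v)) \<le> ln (weight u) + ln (weight v)" for u v
      using weight_pos[of u] weight_pos[of v] by (simp add: weight_append ln_mult)
    show "\<bar>ln (weight w)\<bar> \<le> K * (real (length w) + 1)" for w
    proof (induction w)
      case Nil then show ?case using K0 by (simp add: weight_def)
    next
      case (Cons i w) then show ?case using K[of i] by (simp add: cons algebra_simps)
    qed
    show "ln (weight w) \<le> ln (weight (i # w)) + K" for i w using K[of i] by (simp add: cons abs_le_iff)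
  qed
  show lim: "(\<lambda>n. average (\<lambda>w. ln (weight w)) n / real n) \<longlonglongrightarrow> log_weight_rate"
    using c.average_tendsto unfolding log_weight_rate_def by (simp add: limI)
  show "AE x in \<mu>. (\<lambda>n. ln (weight (code_prefix x n)) / real n) \<longlonglongrightarrow> log_weight_rate"
    using c.AE_X_tendsto LIMSEQ_unique[OF lim c.average_tendsto] by simp
qed

text \<open>As there are two letters of positive probability, every \<open>p i\<close> is below 1.
  This gives positive entropy and the absence of atoms.\<close>

lemma weight_le_power:
  obtains q where "0 < q" "q < 1" "\<And>w. weight w \<le> q ^ length w"
proof -
  define q where "q = Max (range p)"
  have pq: "p i \<le> q" for i unfolding q_def by (rule Max_ge) auto
  have "p i < 1" for i
  proof -
    obtain j where j: "j \<noteq> i"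
    proof (rule ccontr)
      assume "\<not> thesis"
      then have "UNIV = {i}" using that by auto
      then have "CARD('m) = 1" by (metis card_1_singleton_iff One_nat_def)
      with card_ge_2 show False by simp
    qed
    have "p i + p j = (\<Sum>k\<in>{i, j}. p k)" using j by simp
    also have "\<dots> \<le> (\<Sum>k\<in>UNIV. p k)" using p_pos by (intro sum_mono2) (auto simp: less_imp_le)
    finally show ?thesis using p_pos[of j] p_sum by simp
  qed
  then have "q < 1" unfolding q_def by (subst Max_less_iff) auto
  moreover have "q > 0" using pq[of undefined] p_pos[of undefined] by simp
  moreover have "weight w \<le> q ^ length w" for w
  proof (induction w)
    case (Cons i w)
    then show ?case using pq[of i] p_pos[of i] weight_nonneg[of w] mult_mono[of "p i" q "weight w" "q ^ length w"] \<open>q > 0\<close>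
      by (simp add: weight_def)
  qed (simp add: weight_def)
  ultimately show thesis by (intro that[of q])
qed

lemma log_weight_rate_neg: "log_weight_rate < 0"
proof -
  obtain q where q: "0 < q" "q < 1" "\<And>w. weight w \<le> q ^ length w" using weight_le_power by metis
  have "average (\<lambda>w. ln (weight w)) n / real n \<le> ln q" if "n \<ge> 1" for n
  proof -
    have "average (\<lambda>w. ln (weight w)) n \<le> average (\<lambda>w. ln q * real (length w)) n"
    proof (rule average_mono)
      fix w
      have "ln (weight w) \<le> ln (q ^ length w)" using q weight_pos[of w] by simp
      then show "ln (weight w) \<le> ln q * real (length w)" using q by (simp add: ln_realpow mult.commute)
    qed
    then show ?thesis using that by (simp add: average_const pos_divide_le_eq)
  qed
  then have "log_weight_rate \<le> ln q"
    by (intro LIMSEQ_le_const2[OF log_weight_rate_tendsto]) auto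
  moreover have "ln q < 0" using q by simp
  ultimately show ?thesis by simp
qed

text \<open>Splitting the logarithm reduces every question about the pressure, including the
  existence of its limit, to the two rates.\<close>

lemma pressure_eq:
  assumes s: "0 \<le> s" shows "pressure T \<mu> s = log_weight_rate - lyapunov s"
proof -
  have "1 / real k * (\<Sum>w | length w = k. measure \<mu> (cylinder w) * ln (inverse (\<phi> s w) * measure \<mu> (cylinder w)))
      = average (\<lambda>w. ln (weight w)) k / real k - average (\<lambda>w. ln (\<phi> s w)) k / real k" for k
  proof -
    have "(\<Sum>w | length w = k. measure \<mu> (cylinder w) * ln (inverse (\<phi> s w) * measure \<mu> (cylinder w)))
        = average (\<lambda>w. ln (weight w) - ln (\<phi> s w)) k"
      unfolding average_def measure_cylinder
    proof (intro sum.cong refl)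
      fix w show "weight w * ln (inverse (\<phi> s w) * weight w) = weight w * (ln (weight w) - ln (\<phi> s w))"
        using weight_pos[of w] wm.svf_pos[OF s, of w] by (simp add: ln_mult ln_inverse)
    qed
    then show ?thesis by (simp add: average_diff diff_divide_distrib)
  qed
  then show ?thesis unfolding pressure_def
    by (intro limI) (simp add: tendsto_diff log_weight_rate_tendsto lyapunov_tendsto s)
qed

lemma lyapunov_0: "lyapunov 0 = 0"
proof -
  have "(\<lambda>n. average (\<lambda>w. ln (\<phi> 0 w)) n / real n) \<longlonglongrightarrow> 0" by (simp add: wm.svf_0 average_def)
  then show ?thesis using lyapunov_tendsto[of 0] LIMSEQ_unique by blast
qed

lemma lyapunov_diff:
  obtains A B where "A \<le> B" "B < 0"
    "\<And>s t. 0 \<le> s \<Longrightarrow> s \<le> t \<Longrightarrow> (t - s) * A \<le> lyapunov t - lyapunov s"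
    "\<And>s t. 0 \<le> s \<Longrightarrow> s \<le> t \<Longrightarrow> lyapunov t - lyapunov s \<le> (t - s) * B"
proof -
  obtain A B where AB: "A \<le> B" "B < 0"
    "\<And>s t w. 0 \<le> s \<Longrightarrow> s \<le> t \<Longrightarrow> real (length w) * ((t - s) * A) \<le> ln (\<phi> t w) - ln (\<phi> s w)"
    "\<And>s t w. 0 \<le> s \<Longrightarrow> s \<le> t \<Longrightarrow> ln (\<phi> t w) - ln (\<phi> s w) \<le> real (length w) * ((t - s) * B)"
    using ln_\<phi>_diff by metis
  show thesis
  proof (rule that[OF AB(1,2)])
    fix s t :: real assume st: "0 \<le> s" "s \<le> t"
    have lim: "(\<lambda>n. average (\<lambda>w. ln (\<phi> t w) - ln (\<phi> s w)) n / real n) \<longlonglongrightarrow> lyapunov t - lyapunov s"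
      unfolding average_diff diff_divide_distrib using st by (intro tendsto_diff lyapunov_tendsto) auto
    have "(t - s) * A \<le> average (\<lambda>w. ln (\<phi> t w) - ln (\<phi> s w)) n / real n" if "n \<ge> 1" for n
    proof -
      have "average (\<lambda>w. (t - s) * A * real (length w)) n \<le> average (\<lambda>w. ln (\<phi> t w) - ln (\<phi> s w)) n"
      proof (rule average_mono)
        fix w show "(t - s) * A * real (length w) \<le> ln (\<phi> t w) - ln (\<phi> s w)"
          using AB(3)[OF st, of w] by (simp add: mult_ac)
      qed
      then show ?thesis using that by (simp add: average_const pos_le_divide_eq)
    qed
    then show "(t - s) * A \<le> lyapunov t - lyapunov s" by (intro LIMSEQ_le_const[OF lim]) auto
    have "average (\<lambda>w. ln (\<phi> t w) - ln (\<phi> s w)) n / real n \<le> (t - s) * B" if "n \<ge> 1" for n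
    proof -
      have "average (\<lambda>w. ln (\<phi> t w) - ln (\<phi> s w)) n \<le> average (\<lambda>w. (t - s) * B * real (length w)) n"
      proof (rule average_mono)
        fix w show "ln (\<phi> t w) - ln (\<phi> s w) \<le> (t - s) * B * real (length w)"
          using AB(4)[OF st, of w] by (simp add: mult_ac)
      qed
      then show ?thesis using that by (simp add: average_const pos_divide_le_eq)
    qed
    then show "lyapunov t - lyapunov s \<le> (t - s) * B" by (intro LIMSEQ_le_const2[OF lim]) auto
  qed
qed

lemma lyapunov_strict_antimono: "0 \<le> s \<Longrightarrow> s < t \<Longrightarrow> lyapunov t < lyapunov s"
proof -
  assume st: "0 \<le> s" "s < t"
  obtain A B where "B < 0" "\<And>s t. 0 \<le> s \<Longrightarrow> s \<le> t \<Longrightarrow> lyapunov t - lyapunov s \<le> (t - s) * B"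
    using lyapunov_diff by metis
  then have "lyapunov t - lyapunov s \<le> (t - s) * B" "(t - s) * B < 0" using st by (auto simp: mult_pos_neg)
  then show ?thesis by simp
qed

text \<open>The root exists by the intermediate value theorem, as \<open>lyapunov\<close> is
  Lipschitz, and is unique by strict monotonicity, so the definite description applies. It is not 0
  because \<open>lyapunov 0 = 0\<close> exceeds \<open>log_weight_rate\<close>.\<close>

lemma critical_exponent_pos: "critical_exponent T \<mu> > 0"
  and lyapunov_critical_exponent: "lyapunov (critical_exponent T \<mu>) = log_weight_rate"
proof -
  obtain A B where AB: "A \<le> B" "B < 0"
    "\<And>s t. 0 \<le> s \<Longrightarrow> s \<le> t \<Longrightarrow> (t - s) * A \<le> lyapunov t - lyapunov s"
    "\<And>s t. 0 \<le> s \<Longrightarrow> s \<le> t \<Longrightarrow> lyapunov t - lyapunov s \<le> (t - s) * B"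
    using lyapunov_diff by metis
  \<comment> \<open>Chosen so that the bound \<open>lyapunov S <= S * B\<close> ends exactly at
    \<open>log_weight_rate\<close>.\<close>
  define S where "S = log_weight_rate / B"
  have S: "S > 0" using log_weight_rate_neg AB(2) by (simp add: S_def divide_neg_neg)
  have "continuous_on {0..S} (\<lambda>s. - lyapunov s)"
  proof (rule continuous_on_minus, rule lipschitz_on_continuous_on)
    have *: "\<bar>lyapunov t - lyapunov s\<bar> \<le> - A * (t - s)" if "0 \<le> s" "s \<le> t" for s t
    proof -
      have "(t - s) * B \<le> 0" using AB(2) that by (intro mult_nonneg_nonpos) auto
      moreover have "- A * (t - s) = - ((t - s) * A)" by simp
      moreover have "(t - s) * A \<le> (t - s) * B" using AB(1) that by (intro mult_left_mono) auto
      ultimately show ?thesis using AB(3,4)[OF that] unfolding abs_le_iff by linarith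
    qed
    show "(- A)-lipschitz_on {0..S} lyapunov"
    proof (rule lipschitz_onI)
      fix s t assume "s \<in> {0..S}" "t \<in> {0..S}"
      then show "dist (lyapunov s) (lyapunov t) \<le> - A * dist s t"
        using *[of s t] *[of t s] by (cases "s \<le> t") (auto simp: dist_real_def abs_minus_commute)
    qed (use AB in auto)
  qed
  moreover have "- lyapunov 0 \<le> - log_weight_rate" using log_weight_rate_neg by (simp add: lyapunov_0)
  moreover have "- log_weight_rate \<le> - lyapunov S"
    using AB(4)[of 0 S] S AB(2) by (simp add: lyapunov_0 S_def)
  ultimately have "\<exists>d. 0 \<le> d \<and> d \<le> S \<and> - lyapunov d = - log_weight_rate"
    using S by (intro IVT') auto
  then obtain d where d: "0 \<le> d" "lyapunov d = log_weight_rate" by auto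
  have "critical_exponent T \<mu> = d" unfolding critical_exponent_def
  proof (rule the_equality)
    show "0 \<le> d \<and> pressure T \<mu> d = 0" using d by (simp add: pressure_eq)
    fix e assume "0 \<le> e \<and> pressure T \<mu> e = 0"
    then show "e = d" using d lyapunov_strict_antimono[of e d] lyapunov_strict_antimono[of d e]
      by (cases e d rule: linorder_cases) (auto simp: pressure_eq)
  qed
  moreover have "d \<noteq> 0" using d log_weight_rate_neg lyapunov_0 by auto
  ultimately show "critical_exponent T \<mu> > 0" "lyapunov (critical_exponent T \<mu>) = log_weight_rate"
    using d by auto
qed

end

section \<open>Almost self-affine measures and their potentials\<close>

context self_affine_system
begin

text \<open>The partial sum of the series shared by all codes in the cylinder of
  \<open>w\<close>.\<close>

definition base_point :: "('m list \<Rightarrow> real^'n) \<Rightarrow> 'm list \<Rightarrow> real^'n" where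
  "base_point \<omega> w = (\<Sum>i<length w. word_map T (take i w) (\<omega> (take (Suc i) w)))"

text \<open>Beyond the first \<open>n\<close> terms the series factors through the map of the
  prefix, leaving a series \<open>y\<close> bounded geometrically. As \<open>R\<close> depends on
  neither \<open>x\<close> nor \<open>n\<close>, the image of every cylinder lies in a translate of
  the linear image of one fixed ball. The empty word is exempt because its translation never occurs
  in the series.\<close>

lemma code_point_decomposition:
  fixes D :: real
  obtains R where "R > 0"
    "\<And>\<omega> x n. (\<And>w. w \<noteq> [] \<Longrightarrow> norm (\<omega> w) \<le> D) \<Longrightarrow> \<exists>y. norm y \<le> R \<and>
       code_point T \<omega> x = base_point \<omega> (code_prefix x n) + word_map T (code_prefix x n) y"
proof -
  obtain a b :: real where ab: "0 < a" "a \<le> b" "b < 1"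
    and upper: "\<And>w v. norm (word_map T w v) \<le> b ^ length w * norm v" using expansion_bounds by metis
  define R where "R = \<bar>D\<bar> / (1 - b) + 1"
  have "R > 0" using ab by (simp add: R_def add_nonneg_pos)
  moreover have "\<exists>y. norm y \<le> R \<and> code_point T \<omega> x = base_point \<omega> (code_prefix x n) + word_map T (code_prefix x n) y"
    if \<omega>: "\<And>w. w \<noteq> [] \<Longrightarrow> norm (\<omega> w) \<le> D" for \<omega> x n
  proof -
    define t where "t k = word_map T (code_prefix x k) (\<omega> (code_prefix x (Suc k)))" for k
    define u where "u j = word_map T (code_prefix (\<lambda>k. x (k + n)) j) (\<omega> (code_prefix x (Suc (n + j))))" for j
    have ne: "code_prefix x (Suc k) \<noteq> []" for k by (simp add: code_prefix_Suc)
    have bound: "norm (word_map T v (\<omega> (code_prefix x (Suc k)))) \<le> \<bar>D\<bar> * b ^ length v" for v k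
    proof -
      have "norm (word_map T v (\<omega> (code_prefix x (Suc k)))) \<le> b ^ length v * norm (\<omega> (code_prefix x (Suc k)))"
        by (rule upper)
      also have "\<dots> \<le> b ^ length v * \<bar>D\<bar>" using \<omega>[OF ne, of k] ab by (intro mult_left_mono) auto
      finally show ?thesis by (simp add: mult.commute)
    qed
    have geo: "summable (\<lambda>k. \<bar>D\<bar> * b ^ k)" using ab by (intro summable_mult summable_geometric) simp
    have "norm (t k) \<le> \<bar>D\<bar> * b ^ k" for k using bound[of "code_prefix x k" k] by (simp add: t_def)
    then have t: "summable t" by (intro summable_comparison_test'[OF geo, of 0]) auto
    have u_le: "norm (u j) \<le> \<bar>D\<bar> * b ^ j" for j
      using bound[of "code_prefix (\<lambda>k. x (k + n)) j" "n + j"] by (simp add: u_def)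
    have nu: "summable (\<lambda>j. norm (u j))" by (rule summable_comparison_test'[OF geo, of 0]) (use u_le in auto)
    then have u: "summable u" by (rule summable_norm_cancel)
    have "norm (suminf u) \<le> (\<Sum>j. norm (u j))" by (rule summable_norm[OF nu])
    also have "\<dots> \<le> (\<Sum>j. \<bar>D\<bar> * b ^ j)" by (rule suminf_le[OF u_le nu geo])
    also have "\<dots> = \<bar>D\<bar> / (1 - b)" using ab by (subst suminf_mult) (auto simp: suminf_geometric)
    finally have uR: "norm (suminf u) \<le> R" by (simp add: R_def)
    have tu: "t (j + n) = word_map T (code_prefix x n) (u j)" for j
    proof -
      have "code_prefix x (j + n) = code_prefix x n @ code_prefix (\<lambda>k. x (k + n)) j"
        using code_prefix_add[of x n j] by (simp add: add.commute)
      then show ?thesis by (simp add: t_def u_def word_map_append add.commute)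
    qed
    have bl: "bounded_linear (word_map T (code_prefix x n))"
      using linear_word_map by (simp add: linear_conv_bounded_linear)
    have "suminf t = (\<Sum>j. t (j + n)) + (\<Sum>i<n. t i)" by (rule suminf_split_initial_segment[OF t])
    also have "(\<Sum>j. t (j + n)) = word_map T (code_prefix x n) (suminf u)"
      unfolding tu by (rule bounded_linear.suminf[OF bl u, symmetric])
    also have "(\<Sum>i<n. t i) = base_point \<omega> (code_prefix x n)"
    proof -
      have "take i (code_prefix x n) = code_prefix x i" if "i \<le> n" for i
        using that by (simp add: code_prefix_def take_map)
      then show ?thesis unfolding base_point_def by (intro sum.cong) (auto simp: t_def)
    qed
    finally have "code_point T \<omega> x = base_point \<omega> (code_prefix x n) + word_map T (code_prefix x n) (suminf u)"
      by (simp add: code_point_def t_def)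
    then show ?thesis using uR by blast
  qed
  ultimately show thesis using that by blast
qed

text \<open>Each term depends on the code through a prefix, which has countably many values, so
  joint measurability can be checked for one fixed word at a time.\<close>

lemma code_point_measurable_pair:
  fixes P :: "('m list \<Rightarrow> real^'n) measure"
  assumes [measurable]: "\<And>w. (\<lambda>\<omega>. \<omega> w) \<in> borel_measurable P"
  shows "(\<lambda>z. code_point T (fst z) (snd z)) \<in> borel_measurable (P \<Otimes>\<^sub>M \<mu>)"
proof -
  have wm [measurable]: "word_map T w \<in> borel_measurable borel" for w
    by (intro borel_measurable_continuous_onI linear_continuous_on)
       (simp add: linear_conv_bounded_linear[symmetric] linear_word_map)
  have "(\<lambda>z. word_map T (code_prefix (snd z) k) (fst z (code_prefix (snd z) (Suc k)))) \<in> borel_measurable (P \<Otimes>\<^sub>M \<mu>)" for k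
  proof -
    have "(\<lambda>z. (\<lambda>w z. word_map T (take k w) (fst z w)) (code_prefix (snd z) (Suc k)) z) \<in> borel_measurable (P \<Otimes>\<^sub>M \<mu>)"
    proof (rule measurable_compose_countable)
      show "(\<lambda>z. word_map T (take k w) (fst z w)) \<in> borel_measurable (P \<Otimes>\<^sub>M \<mu>)" for w
        by (rule measurable_compose[OF measurable_compose[OF measurable_fst assms[of w]] wm])
      show "(\<lambda>z. code_prefix (snd z) (Suc k)) \<in> (P \<Otimes>\<^sub>M \<mu>) \<rightarrow>\<^sub>M count_space UNIV" by measurable
    qed
    then show ?thesis by (simp add: code_prefix_Suc)
  qed
  then show ?thesis unfolding code_point_def[abs_def] by (rule borel_measurable_suminf)
qed

lemma code_point_measurable [measurable]: "code_point T \<omega> \<in> borel_measurable \<mu>"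
proof -
  \<comment> \<open>With the discrete measure on the families every coordinate map is measurable, so
    the section at an arbitrary \<open>\<omega>\<close> can be taken.\<close>
  have "(\<lambda>z. code_point T (fst z) (snd z)) \<in> borel_measurable (count_space UNIV \<Otimes>\<^sub>M \<mu>)"
    by (rule code_point_measurable_pair) simp
  from measurable_compose[OF measurable_Pair1' this, of \<omega>] show ?thesis by simp
qed

lemma measure_projected_cball:
  "measure (projected_measure T \<mu> \<omega>) (cball c r) = measure \<mu> {y. dist c (code_point T \<omega> y) \<le> r}"
proof -
  have "code_point T \<omega> -` cball c r \<inter> space \<mu> = {y. dist c (code_point T \<omega> y) \<le> r}" by auto
  then show ?thesis unfolding projected_measure_def by (subst measure_distr) auto
qed

text \<open>A single code lies in cylinders of geometrically decreasing mass, so it is a null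
  set.\<close>

lemma AE_neq: "AE y in \<mu>. y \<noteq> x"
proof -
  obtain q where q: "0 < q" "q < 1" "\<And>w. weight w \<le> q ^ length w" using weight_le_power by metis
  let ?S = "\<Inter>k. cylinder (code_prefix x k)"
  have S: "?S \<in> sets \<mu>" by measurable
  have "measure \<mu> ?S \<le> q ^ k" for k
  proof -
    have "measure \<mu> ?S \<le> measure \<mu> (cylinder (code_prefix x k))" by (intro finite_measure_mono) auto
    then show ?thesis using q(3)[of "code_prefix x k"] by (simp add: measure_cylinder)
  qed
  moreover have "(\<lambda>k. q ^ k) \<longlonglongrightarrow> 0" using q by (intro LIMSEQ_power_zero) simp
  ultimately have "measure \<mu> ?S \<le> 0" by (intro LIMSEQ_le_const) auto
  then have "?S \<in> null_sets \<mu>" using S measure_nonneg[of \<mu> ?S] by (auto simp: null_sets_def emeasure_eq_measure)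
  then show ?thesis by (rule AE_I') (auto simp: mem_cylinder_iff)
qed

end

lemma norm_neg_power_measurable [measurable]: "norm_neg_power s \<in> borel_measurable borel"
  unfolding norm_neg_power_def[abs_def] by measurable

lemma norm_neg_power_ge:
  assumes "0 \<le> s" "0 < r" "norm z \<le> r"
  shows "ennreal (r powr (- s)) \<le> norm_neg_power s z"
proof (cases "s = 0 \<or> z = 0")
  case True then show ?thesis using assms by (auto simp: norm_neg_power_def)
next
  case False
  then have "r powr (- s) \<le> norm z powr (- s)" using assms by (intro powr_mono2') auto
  then show ?thesis using False by (simp add: norm_neg_power_def ennreal_leI)
qed

section \<open>Potentials and the energy hypothesis\<close>

context self_affine_system
begin

text \<open>The \<open>s\<close>-potential of the projected measure at the point coded by
  \<open>x\<close>, written over the code space so that it can be interchanged with the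
  expectation.\<close>

definition potential :: "real \<Rightarrow> ('m list \<Rightarrow> real^'n) \<Rightarrow> (nat \<Rightarrow> 'm) \<Rightarrow> ennreal" where
  "potential s \<omega> x = (\<integral>\<^sup>+ y. norm_neg_power s (code_point T \<omega> x - code_point T \<omega> y) \<partial>\<mu>)"

text \<open>Markov's inequality: on the ball the kernel is at least
  \<open>r powr (- s)\<close>.\<close>

lemma measure_cball_le_potential:
  assumes s: "0 \<le> s" and fin: "potential s \<omega> x < \<infinity>" and r: "r > 0"
  shows "measure (projected_measure T \<mu> \<omega>) (cball (code_point T \<omega> x) r) \<le> enn2real (potential s \<omega> x) * r powr s"
proof -
  let ?A = "{y. dist (code_point T \<omega> x) (code_point T \<omega> y) \<le> r}"
  have A: "?A \<in> sets \<mu>"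
  proof -
    have "{y \<in> space \<mu>. dist (code_point T \<omega> x) (code_point T \<omega> y) \<le> r} \<in> sets \<mu>" by measurable
    then show ?thesis by simp
  qed
  have "ennreal (r powr (- s) * measure \<mu> ?A) = (\<integral>\<^sup>+ y. ennreal (r powr (- s)) * indicator ?A y \<partial>\<mu>)"
    using A by (simp add: nn_integral_cmult_indicator emeasure_eq_measure ennreal_mult)
  also have "\<dots> \<le> potential s \<omega> x" unfolding potential_def
    by (intro nn_integral_mono) (auto simp: indicator_def dist_norm intro: norm_neg_power_ge[OF s r])
  finally have "r powr (- s) * measure \<mu> ?A \<le> enn2real (potential s \<omega> x)"
    using fin by (cases "potential s \<omega> x" rule: ennreal_cases) auto
  then show ?thesis using r by (simp add: measure_projected_cball powr_minus_divide pos_divide_le_eq)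
qed

lemma code_meet_eq:
  assumes "x \<noteq> y" obtains k where "code_meet x y = code_prefix x k" "y \<in> cylinder (code_prefix x k)"
proof -
  define k where "k = (LEAST k. x k \<noteq> y k)"
  have "x i = y i" if "i < k" for i using not_less_Least[of i "\<lambda>k. x k \<noteq> y k"] that by (auto simp: k_def)
  then have "y \<in> cylinder (code_prefix x k)" by (auto simp: cylinder_def code_prefix_def)
  then show thesis by (intro that[of k]) (simp_all add: code_meet_def k_def)
qed

text \<open>The logarithm of the ratio has negative rate
  \<open>log_weight_rate - lyapunov s\<close>; half of this gap gives a convergent geometric
  majorant.\<close>

lemma AE_summable_weight_ratio:
  assumes s: "0 \<le> s" and crit: "log_weight_rate < lyapunov s"
  shows "AE x in \<mu>. summable (\<lambda>k. weight (code_prefix x k) / \<phi> s (code_prefix x k))"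
  using AE_log_weight_rate AE_lyapunov[OF s]
proof eventually_elim
  case (elim x)
  define \<delta> where "\<delta> = (lyapunov s - log_weight_rate) / 2"
  have \<delta>: "\<delta> > 0" using crit by (simp add: \<delta>_def)
  have pos: "weight (code_prefix x k) / \<phi> s (code_prefix x k) > 0" for k
    using weight_pos wm.svf_pos[OF s] by simp
  have "(\<lambda>k. ln (weight (code_prefix x k)) / real k - ln (\<phi> s (code_prefix x k)) / real k) \<longlonglongrightarrow> log_weight_rate - lyapunov s"
    using elim by (rule tendsto_diff)
  then have "eventually (\<lambda>k. ln (weight (code_prefix x k)) / real k - ln (\<phi> s (code_prefix x k)) / real k < - \<delta>) sequentially"
    by (rule order_tendstoD(2)) (use crit in \<open>simp add: \<delta>_def field_simps\<close>)
  moreover have "eventually (\<lambda>k. k > 0) sequentially" by (rule eventually_gt_at_top)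
  ultimately have "eventually (\<lambda>k. norm (weight (code_prefix x k) / \<phi> s (code_prefix x k)) \<le> exp (- \<delta>) ^ k) sequentially"
  proof eventually_elim
    case (elim k)
    have "ln (weight (code_prefix x k) / \<phi> s (code_prefix x k)) = ln (weight (code_prefix x k)) - ln (\<phi> s (code_prefix x k))"
      using weight_pos[of "code_prefix x k"] wm.svf_pos[OF s, of "code_prefix x k"] by (simp add: ln_div)
    also have "\<dots> < - \<delta> * real k" using elim by (simp add: diff_divide_distrib[symmetric] pos_divide_less_eq)
    finally have "weight (code_prefix x k) / \<phi> s (code_prefix x k) \<le> exp (- \<delta> * real k)"
      using pos[of k] by (metis exp_le_cancel_iff exp_ln less_imp_le)
    then show ?case using pos[of k] by (simp add: exp_of_nat_mult[symmetric] mult.commute)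
  qed
  then show ?case
    by (rule summable_comparison_test_ev) (use \<delta> in \<open>auto intro: summable_geometric\<close>)
qed

text \<open>For almost every fixed \<open>x\<close>, Tonelli's theorem and the energy hypothesis
  bound the expected potential by a series over the prefixes of \<open>x\<close>. Joint
  measurability then allows "for almost all x, almost all \<omega>" to be exchanged for the required
  order.\<close>

lemma AE_potential_finite:
  assumes s: "0 \<le> s" and crit: "log_weight_rate < lyapunov s" and P: "prob_space P"
    and meas [measurable]: "\<And>w. (\<lambda>\<omega>. \<omega> w) \<in> borel_measurable P"
    and energy: "\<And>x y. x \<noteq> y \<Longrightarrow> (\<integral>\<^sup>+ \<omega>. norm_neg_power s (code_point T \<omega> x - code_point T \<omega> y) \<partial>P)
      \<le> ennreal (c / \<phi> s (code_meet x y))"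
  shows "AE \<omega> in P. AE x in \<mu>. potential s \<omega> x < \<infinity>"
proof -
  note sf = sigma_finite_measure_axioms
  interpret P: prob_space P by (rule P)
  interpret pair_sigma_finite P \<mu> by standard
  note pm = code_point_measurable_pair[OF meas]
  have meas3: "(\<lambda>(z, y). norm_neg_power s (code_point T (fst z) (snd z) - code_point T (fst z) y))
      \<in> borel_measurable ((P \<Otimes>\<^sub>M \<mu>) \<Otimes>\<^sub>M \<mu>)"
  proof -
    have [measurable]: "(\<lambda>z. code_point T (fst (fst z)) (snd (fst z))) \<in> borel_measurable ((P \<Otimes>\<^sub>M \<mu>) \<Otimes>\<^sub>M \<mu>)"
      by (rule measurable_compose[OF measurable_fst pm])
    have "(\<lambda>z. (fst (fst z), snd z)) \<in> (P \<Otimes>\<^sub>M \<mu>) \<Otimes>\<^sub>M \<mu> \<rightarrow>\<^sub>M P \<Otimes>\<^sub>M \<mu>" by measurable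
    from measurable_compose[OF this pm]
    have [measurable]: "(\<lambda>z. code_point T (fst (fst z)) (snd z)) \<in> borel_measurable ((P \<Otimes>\<^sub>M \<mu>) \<Otimes>\<^sub>M \<mu>)" by simp
    show ?thesis unfolding case_prod_beta by measurable
  qed
  have pot_meas: "(\<lambda>z. potential s (fst z) (snd z)) \<in> borel_measurable (P \<Otimes>\<^sub>M \<mu>)"
    unfolding potential_def by (rule sigma_finite_measure.borel_measurable_nn_integral[OF sf meas3])
  have "AE x in \<mu>. AE \<omega> in P. potential s \<omega> x < \<infinity>"
    using AE_summable_weight_ratio[OF s crit]
  proof eventually_elim
    case (elim x)
    have x: "(\<lambda>z. (fst z, x)) \<in> P \<Otimes>\<^sub>M \<mu> \<rightarrow>\<^sub>M P \<Otimes>\<^sub>M \<mu>" by measurable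
    have [measurable]: "(\<lambda>z. code_point T (fst z) x) \<in> borel_measurable (P \<Otimes>\<^sub>M \<mu>)"
      using measurable_compose[OF x pm] by simp
    have swap: "(\<lambda>(\<omega>, y). norm_neg_power s (code_point T \<omega> x - code_point T \<omega> y)) \<in> borel_measurable (P \<Otimes>\<^sub>M \<mu>)"
      unfolding case_prod_beta using pm by measurable
    have "(\<integral>\<^sup>+ \<omega>. potential s \<omega> x \<partial>P) = (\<integral>\<^sup>+ y. \<integral>\<^sup>+ \<omega>. norm_neg_power s (code_point T \<omega> x - code_point T \<omega> y) \<partial>P \<partial>\<mu>)"
      unfolding potential_def by (rule Fubini'[OF swap, symmetric])
    \<comment> \<open>The meet of \<open>x\<close> and \<open>y\<close> is some prefix of
      \<open>x\<close> whose cylinder contains \<open>y\<close>. Which one is irrelevant after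
      summing over all prefixes; only \<open>y = x\<close> is excluded, a null event.\<close>
    also have "\<dots> \<le> (\<integral>\<^sup>+ y. (\<Sum>k. ennreal (\<bar>c\<bar> / \<phi> s (code_prefix x k)) * indicator (cylinder (code_prefix x k)) y) \<partial>\<mu>)"
    proof (rule nn_integral_mono_AE)
      show "AE y in \<mu>. (\<integral>\<^sup>+ \<omega>. norm_neg_power s (code_point T \<omega> x - code_point T \<omega> y) \<partial>P)
          \<le> (\<Sum>k. ennreal (\<bar>c\<bar> / \<phi> s (code_prefix x k)) * indicator (cylinder (code_prefix x k)) y)"
        using AE_neq[of x]
      proof eventually_elim
        case (elim y)
        obtain k where k: "code_meet x y = code_prefix x k" "y \<in> cylinder (code_prefix x k)"
          using code_meet_eq elim by metis
        have "(\<integral>\<^sup>+ \<omega>. norm_neg_power s (code_point T \<omega> x - code_point T \<omega> y) \<partial>P) \<le> ennreal (c / \<phi> s (code_prefix x k))"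
          using energy[of x y] elim k(1) by simp
        also have "\<dots> \<le> ennreal (\<bar>c\<bar> / \<phi> s (code_prefix x k)) * indicator (cylinder (code_prefix x k)) y"
          using k(2) wm.svf_pos[OF s, of "code_prefix x k"] by (auto intro!: ennreal_leI divide_right_mono)
        also have "\<dots> \<le> (\<Sum>k. ennreal (\<bar>c\<bar> / \<phi> s (code_prefix x k)) * indicator (cylinder (code_prefix x k)) y)"
          using sum_le_suminf[of "\<lambda>k. ennreal (\<bar>c\<bar> / \<phi> s (code_prefix x k)) * indicator (cylinder (code_prefix x k)) y" "{k}"]
          by (simp only: sum.insert sum.empty finite.intros empty_iff not_False_eq_True add_0_right summableI zero_le simp_thms)
        finally show ?case .
      qed
    qed
    also have "\<dots> = (\<Sum>k. \<integral>\<^sup>+ y. ennreal (\<bar>c\<bar> / \<phi> s (code_prefix x k)) * indicator (cylinder (code_prefix x k)) y \<partial>\<mu>)"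
      by (rule nn_integral_suminf) measurable
    also have "\<dots> = (\<Sum>k. ennreal (\<bar>c\<bar> * (weight (code_prefix x k) / \<phi> s (code_prefix x k))))"
      using wm.svf_pos[OF s] weight_nonneg
      by (simp add: nn_integral_cmult_indicator emeasure_eq_measure measure_cylinder ennreal_mult[symmetric] less_imp_le)
    also have "\<dots> < \<infinity>"
      using summable_mult[OF elim, of "\<bar>c\<bar>"] wm.svf_pos[OF s] weight_nonneg
      by (subst suminf_ennreal2) (auto simp: less_imp_le)
    finally have "(\<integral>\<^sup>+ \<omega>. potential s \<omega> x \<partial>P) \<noteq> \<infinity>" by simp
    moreover have "(\<lambda>\<omega>. potential s \<omega> x) \<in> borel_measurable P"
      using measurable_compose[OF measurable_Pair2' pot_meas, of x] by simp
    ultimately have "AE \<omega> in P. potential s \<omega> x \<noteq> \<infinity>" by (rule nn_integral_noteq_infinite[rotated])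
    then show ?case by eventually_elim (simp add: less_top)
  qed
  moreover have "{z \<in> space (P \<Otimes>\<^sub>M \<mu>). potential s (fst z) (snd z) < \<infinity>} \<in> sets (P \<Otimes>\<^sub>M \<mu>)"
    using pot_meas by measurable
  ultimately show ?thesis by (simp add: AE_commute)
qed

end

section \<open>Local dimensions of almost self-affine measures\<close>

lemma eventually_ln_less: "eventually (\<lambda>r. ln r < c) (at_right (0 :: real))"
  using ln_at_0 unfolding filterlim_at_bot_dense by blast

lemma eventually_less_1_at_right: "eventually (\<lambda>r. 0 < r \<and> r < 1) (at_right (0 :: real))"
  using eventually_at_right_real[of 0 "1 :: real"] by (auto elim: eventually_mono)

text \<open>
  The limit along all radii follows from one-sided information along the radii \<open>r k\<close>: given a small
  radius \<open>\<rho>\<close>, compare \<open>g \<rho>\<close> with \<open>g (r k)\<close> for the least \<open>k\<close> for which \<open>r k \<le> \<rho>\<close> is guaranteed.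
\<close>

lemma log_quotient_tendsto:
  fixes g :: "real \<Rightarrow> real" and r h :: "nat \<Rightarrow> real"
  assumes mono: "\<And>\<rho> \<rho>'. 0 < \<rho> \<Longrightarrow> \<rho> \<le> \<rho>' \<Longrightarrow> g \<rho> \<le> g \<rho>'"
    and d: "0 \<le> d" and r_pos: "\<And>k. r k > 0" and r: "(\<lambda>k. ln (r k) / real k) \<longlonglongrightarrow> \<gamma>" and \<gamma>: "\<gamma> < 0"
    and h: "(\<lambda>k. h k / real k) \<longlonglongrightarrow> d * \<gamma>"
    and g_r: "eventually (\<lambda>k. g (r k) > 0 \<and> h k \<le> ln (g (r k))) sequentially"
    and upper: "\<And>\<epsilon>. \<epsilon> > 0 \<Longrightarrow>
      eventually (\<lambda>\<rho>. g \<rho> > 0 \<longrightarrow> ln (g \<rho>) \<le> (d - \<epsilon>) * ln \<rho>) (at_right 0)"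
  shows "\<rho> > 0 \<Longrightarrow> g \<rho> > 0" "((\<lambda>\<rho>. ln (g \<rho>) / ln \<rho>) \<longlongrightarrow> d) (at_right 0)"
proof -
  have below: "eventually (\<lambda>\<rho>. g \<rho> > 0 \<and> (d * \<gamma> - \<delta>) * (ln \<rho> / (\<gamma> + \<delta>) + 1) \<le> ln (g \<rho>)) (at_right 0)"
    if \<delta>: "0 < \<delta>" "\<gamma> + \<delta> < 0" for \<delta>
  proof -
    have "eventually (\<lambda>k. ln (r k) / real k < \<gamma> + \<delta>) sequentially"
      by (rule order_tendstoD(2)[OF r]) (use \<delta> in simp)
    moreover have "eventually (\<lambda>k. d * \<gamma> - \<delta> < h k / real k) sequentially"
      by (rule order_tendstoD(1)[OF h]) (use \<delta> in simp)
    ultimately have "eventually (\<lambda>k. ln (r k) / real k < \<gamma> + \<delta> \<and> d * \<gamma> - \<delta> < h k / real k \<and>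
        g (r k) > 0 \<and> h k \<le> ln (g (r k))) sequentially"
      using g_r by eventually_elim simp
    then obtain K where K: "\<And>k. k \<ge> K \<Longrightarrow> ln (r k) / real k < \<gamma> + \<delta> \<and> d * \<gamma> - \<delta> < h k / real k \<and>
        g (r k) > 0 \<and> h k \<le> ln (g (r k))" by (auto simp: eventually_sequentially)
    have "eventually (\<lambda>\<rho>. g \<rho> > 0 \<and> (d * \<gamma> - \<delta>) * (ln \<rho> / (\<gamma> + \<delta>) + 1) \<le> ln (g \<rho>)) (at_right 0)"
      using eventually_ln_less[of "(real K + 1) * (\<gamma> + \<delta>)"] eventually_less_1_at_right
    proof eventually_elim
      case (elim \<rho>)
      \<comment> \<open>With k the ceiling of u, ln (r k) <= k (\<gamma> + \<delta>) <= ln \<rho>,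
        so \<open>r k\<close> is at most \<open>\<rho>\<close>. Rounding costs at most one step,
        hence the \<open>+ 1\<close> in the estimate.\<close>
      define u where "u = ln \<rho> / (\<gamma> + \<delta>)"
      have u: "u > real K + 1" using elim(1) \<delta> by (simp add: u_def neg_less_divide_eq)
      define k where "k = nat \<lceil>u\<rceil>"
      have k: "u \<le> real k" "real k \<le> u + 1" using u by (auto simp: k_def)
      then have kK: "k \<ge> K" "k \<ge> 1" using u by linarith+
      note Kk = K[OF kK(1)]
      have "ln (r k) \<le> real k * (\<gamma> + \<delta>)" using Kk kK by (simp add: pos_divide_less_eq mult.commute less_imp_le)
      also have "\<dots> \<le> u * (\<gamma> + \<delta>)" using k(1) \<delta> by (intro mult_right_mono_neg) auto
      also have "\<dots> = ln \<rho>" using \<delta> by (simp add: u_def)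
      finally have "r k \<le> \<rho>" using r_pos[of k] elim by simp
      then have gk: "g (r k) \<le> g \<rho>" by (rule mono[OF r_pos])
      have "d * \<gamma> \<le> 0" using d \<gamma> by (simp add: mult_nonneg_nonpos)
      then have "(d * \<gamma> - \<delta>) * (u + 1) \<le> (d * \<gamma> - \<delta>) * real k"
        using k(2) \<delta> by (intro mult_left_mono_neg) auto
      also have "\<dots> \<le> h k" using Kk kK by (simp add: pos_less_divide_eq less_imp_le)
      also have "\<dots> \<le> ln (g (r k))" using Kk by simp
      also have "\<dots> \<le> ln (g \<rho>)" using Kk gk by simp
      finally show ?case using Kk gk by (simp add: u_def)
    qed
    then show ?thesis .
  qed
  define \<delta>0 where "\<delta>0 = - \<gamma> / 2"
  have \<delta>0: "0 < \<delta>0" "\<gamma> + \<delta>0 < 0" using \<gamma> by (auto simp: \<delta>0_def)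
  have g_pos: "eventually (\<lambda>\<rho>. g \<rho> > 0) (at_right 0)"
    using below[OF \<delta>0] by (auto elim: eventually_mono)
  show "g \<rho> > 0" if "\<rho> > 0" for \<rho>
  proof -
    have "eventually (\<lambda>t. t < \<rho> \<and> 0 < t) (at_right 0)"
      using eventually_at_right_real[of 0 \<rho>] that by (auto elim: eventually_mono)
    with g_pos have "eventually (\<lambda>t. g t > 0 \<and> t < \<rho> \<and> 0 < t) (at_right 0)" by eventually_elim simp
    then obtain t where "g t > 0" "t < \<rho>" "0 < t" using eventually_happens'[of "at_right (0::real)"] by auto
    then show ?thesis using mono[of t \<rho>] by simp
  qed
  show "((\<lambda>\<rho>. ln (g \<rho>) / ln \<rho>) \<longlongrightarrow> d) (at_right 0)"
  proof (rule order_tendstoI)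
    fix a assume "a < d"
    define \<epsilon> where "\<epsilon> = (d - a) / 2"
    have \<epsilon>: "\<epsilon> > 0" "a < d - \<epsilon>" using \<open>a < d\<close> by (auto simp: \<epsilon>_def field_simps)
    show "eventually (\<lambda>\<rho>. a < ln (g \<rho>) / ln \<rho>) (at_right 0)"
      using upper[OF \<epsilon>(1)] eventually_less_1_at_right g_pos
    proof eventually_elim
      case (elim \<rho>)
      then have "ln \<rho> < 0" by simp
      then have "d - \<epsilon> \<le> ln (g \<rho>) / ln \<rho>" using elim(1,3) by (simp add: neg_le_divide_eq)
      then show ?case using \<epsilon> by simp
    qed
  next
    fix a assume a: "d < a"
    \<comment> \<open>The slope of the lower estimate tends to \<open>d\<close> as
      \<open>\<delta>\<close> tends to 0, so some admissible \<open>\<delta>\<close> pushes it below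
      \<open>a\<close>; the additive term vanishes after division by
      \<open>ln \<rho>\<close>.\<close>
    have "((\<lambda>\<delta>. (d * \<gamma> - \<delta>) / (\<gamma> + \<delta>)) \<longlongrightarrow> (d * \<gamma> - 0) / (\<gamma> + 0)) (at_right 0)"
      using \<gamma> by (intro tendsto_intros) auto
    then have "((\<lambda>\<delta>. (d * \<gamma> - \<delta>) / (\<gamma> + \<delta>)) \<longlongrightarrow> d) (at_right 0)" using \<gamma> by simp
    then have "eventually (\<lambda>\<delta>. (d * \<gamma> - \<delta>) / (\<gamma> + \<delta>) < a) (at_right 0)" using a by (rule order_tendstoD(2))
    moreover have "eventually (\<lambda>\<delta>. 0 < \<delta> \<and> \<gamma> + \<delta> < 0) (at_right 0)"
      using eventually_at_right_real[of 0 "- \<gamma>"] \<gamma> by (auto elim: eventually_mono)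
    ultimately have "eventually (\<lambda>\<delta>. (d * \<gamma> - \<delta>) / (\<gamma> + \<delta>) < a \<and> 0 < \<delta> \<and> \<gamma> + \<delta> < 0) (at_right 0)"
      by eventually_elim simp
    then obtain \<delta> where \<delta>: "(d * \<gamma> - \<delta>) / (\<gamma> + \<delta>) < a" "0 < \<delta>" "\<gamma> + \<delta> < 0"
      using eventually_happens'[of "at_right (0::real)"] by auto
    define c where "c = (d * \<gamma> - \<delta>) / (\<gamma> + \<delta>)"
    have "((\<lambda>\<rho>. c + (d * \<gamma> - \<delta>) / ln \<rho>) \<longlongrightarrow> c + 0) (at_right 0)"
      by (intro tendsto_add tendsto_const tendsto_divide_0[OF tendsto_const] filterlim_at_bot_imp_at_infinity ln_at_0)
    then have "eventually (\<lambda>\<rho>. c + (d * \<gamma> - \<delta>) / ln \<rho> < a) (at_right 0)"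
      using \<delta>(1) by (intro order_tendstoD(2)) (auto simp: c_def)
    moreover have "eventually (\<lambda>\<rho>. g \<rho> > 0 \<and> (d * \<gamma> - \<delta>) * (ln \<rho> / (\<gamma> + \<delta>) + 1) \<le> ln (g \<rho>)) (at_right 0)"
      using below[OF \<delta>(2,3)] by blast
    ultimately show "eventually (\<lambda>\<rho>. ln (g \<rho>) / ln \<rho> < a) (at_right 0)"
      using eventually_less_1_at_right
    proof eventually_elim
      case (elim \<rho>)
      then have neg: "ln \<rho> < 0" by simp
      have "ln (g \<rho>) / ln \<rho> \<le> ((d * \<gamma> - \<delta>) * (ln \<rho> / (\<gamma> + \<delta>) + 1)) / ln \<rho>"
        using elim neg by (intro divide_right_mono_neg) auto
      also have "\<dots> = c + (d * \<gamma> - \<delta>) / ln \<rho>"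
      proof -
        have "((d * \<gamma> - \<delta>) * (ln \<rho> / (\<gamma> + \<delta>) + 1)) / ln \<rho>
            = (d * \<gamma> - \<delta>) / (\<gamma> + \<delta>) * (ln \<rho> / ln \<rho>) + (d * \<gamma> - \<delta>) / ln \<rho>"
          by (simp add: distrib_left add_divide_distrib)
        then show ?thesis using neg by (simp add: c_def)
      qed
      finally show ?case using elim by simp
    qed
  qed
qed

text \<open>Restricting to dyadic radii turns the existence of a local dimension into a countable,
  hence measurable, condition on the centre; monotonicity recovers the remaining radii.\<close>

lemma log_quotient_tendsto_of_dyadic:
  fixes g :: "real \<Rightarrow> real"
  assumes mono: "\<And>\<rho> \<rho>'. 0 < \<rho> \<Longrightarrow> \<rho> \<le> \<rho>' \<Longrightarrow> g \<rho> \<le> g \<rho>'" and le_1: "\<And>\<rho>. g \<rho> \<le> 1"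
    and d: "0 \<le> d" and pos: "\<And>n. g ((1 / 2) ^ n) > 0"
    and lim: "(\<lambda>n. ln (g ((1 / 2) ^ n)) / ln ((1 / 2) ^ n)) \<longlonglongrightarrow> d"
  shows "\<rho> > 0 \<Longrightarrow> g \<rho> > 0" "((\<lambda>\<rho>. ln (g \<rho>) / ln \<rho>) \<longlongrightarrow> d) (at_right 0)"
proof -
  let ?r = "\<lambda>n. (1 / 2 :: real) ^ n"
  have ln_r: "ln (?r n) = - (real n * ln 2)" for n by (simp add: ln_realpow ln_div)
  have g_pos: "g \<rho> > 0" if \<rho>: "\<rho> > 0" for \<rho>
  proof -
    obtain n where "?r n < \<rho>" using real_arch_pow_inv[OF \<rho>, of "1 / 2"] by auto
    then show ?thesis using mono[of "?r n" \<rho>] pos[of n] by simp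
  qed
  then show "\<rho> > 0 \<Longrightarrow> g \<rho> > 0" for \<rho> .
  show "((\<lambda>\<rho>. ln (g \<rho>) / ln \<rho>) \<longlongrightarrow> d) (at_right 0)"
  proof (rule log_quotient_tendsto(2)[where r = ?r and \<gamma> = "- ln 2" and h = "\<lambda>n. ln (g (?r n))", OF mono d])
    have "eventually (\<lambda>n. - ln 2 = ln (?r n) / real n) sequentially"
      using eventually_gt_at_top[of 0] by eventually_elim (simp add: ln_r)
    then show r_lim: "(\<lambda>n. ln (?r n) / real n) \<longlonglongrightarrow> - ln 2"
      by (rule Lim_transform_eventually[OF tendsto_const])
    have "(\<lambda>n. ln (g (?r n)) / ln (?r n) * (ln (?r n) / real n)) \<longlonglongrightarrow> d * (- ln 2)"
      by (intro tendsto_mult lim r_lim)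
    moreover have "eventually (\<lambda>n. ln (g (?r n)) / ln (?r n) * (ln (?r n) / real n) = ln (g (?r n)) / real n) sequentially"
      using eventually_gt_at_top[of 0] by eventually_elim (simp add: ln_r)
    ultimately show "(\<lambda>n. ln (g (?r n)) / real n) \<longlonglongrightarrow> d * (- ln 2)" by (rule Lim_transform_eventually)
    show "eventually (\<lambda>n. g (?r n) > 0 \<and> ln (g (?r n)) \<le> ln (g (?r n))) sequentially" using pos by simp
    fix \<epsilon> :: real assume \<epsilon>: "\<epsilon> > 0"
    have "eventually (\<lambda>\<rho>. ln (g \<rho>) \<le> (d - \<epsilon>) * ln \<rho>) (at_right 0)"
    proof (cases "d - \<epsilon> \<le> 0")
      case True
      show ?thesis using eventually_less_1_at_right
      proof eventually_elim
        case (elim \<rho>)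
        then have "ln (g \<rho>) \<le> 0" "ln \<rho> \<le> 0" using le_1[of \<rho>] g_pos[of \<rho>] by auto
        then show ?case using mult_nonpos_nonpos[OF True, of "ln \<rho>"] by simp
      qed
    next
      case False
      \<comment> \<open>Half of \<open>\<epsilon>\<close> is kept in reserve to absorb the term
        \<open>s * ln 2\<close> lost in rounding \<open>\<rho>\<close> up to a dyadic
        radius.\<close>
      define s where "s = d - \<epsilon> / 2"
      have s: "s > 0" "s < d" using False \<epsilon> by (auto simp: s_def)
      have "eventually (\<lambda>n. s < ln (g (?r n)) / ln (?r n)) sequentially" by (rule order_tendstoD(1)[OF lim s(2)])
      then obtain K where K: "\<And>n. n \<ge> K \<Longrightarrow> s < ln (g (?r n)) / ln (?r n)" by (auto simp: eventually_sequentially)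
      show ?thesis
        using eventually_ln_less[of "- ((real K + 2) * ln 2)"] eventually_ln_less[of "- (s * ln 2) / (\<epsilon> / 2)"]
          eventually_less_1_at_right
      proof eventually_elim
        case (elim \<rho>)
        define u where "u = - ln \<rho> / ln 2"
        have u: "u > real K + 2"         proof -
          have "(real K + 2) * ln 2 < - ln \<rho>" using elim(1) by linarith
          then show ?thesis unfolding u_def by (subst pos_less_divide_eq) auto
        qed
        define n where "n = nat \<lfloor>u\<rfloor>"
        have n: "real n \<le> u" "u \<le> real n + 1" using u by (auto simp: n_def)
        then have nK: "n \<ge> K" "n \<ge> 1" using u by linarith+
        have "real n * ln 2 \<le> - ln \<rho>" using n(1) unfolding u_def by (subst (asm) pos_le_divide_eq) auto
        then have "ln \<rho> \<le> ln (?r n)" by (simp add: ln_r)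
        then have "\<rho> \<le> ?r n" using elim by simp
        then have "ln (g \<rho>) \<le> ln (g (?r n))" using mono[of \<rho> "?r n"] g_pos[of \<rho>] elim by simp
        also have "\<dots> \<le> s * ln (?r n)"
        proof -
          have "ln (?r n) < 0" using nK by (simp add: ln_r)
          then show ?thesis using K[OF nK(1)] by (simp add: neg_less_divide_eq less_imp_le)
        qed
        also have "\<dots> \<le> s * (ln \<rho> + ln 2)"
        proof (rule mult_left_mono)
          have "- ln \<rho> \<le> (real n + 1) * ln 2"             using n(2) unfolding u_def by (subst (asm) pos_divide_le_eq) auto
          then show "ln (?r n) \<le> ln \<rho> + ln 2" by (simp add: ln_r algebra_simps)
        qed (use s in simp)
        also have "\<dots> \<le> (d - \<epsilon>) * ln \<rho>"
        proof -
          have "ln \<rho> * (\<epsilon> / 2) < - (s * ln 2)" using elim(2) \<epsilon> by (subst (asm) pos_less_divide_eq) auto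
          then show ?thesis by (simp add: s_def algebra_simps)
        qed
        finally show ?case .
      qed
    qed
    then show "eventually (\<lambda>\<rho>. g \<rho> > 0 \<longrightarrow> ln (g \<rho>) \<le> (d - \<epsilon>) * ln \<rho>) (at_right 0)"
      by (rule eventually_mono) simp
  qed auto
qed

text \<open>Borel--Cantelli: the cells with less than their share divided by (k + 1)^2 carry a total
  mass of at most 1 / (k + 1)^2, which is summable. The lost factor is only polynomial in
  \<open>k\<close>.\<close>

lemma (in prob_space) AE_large_cells:
  fixes D :: "nat \<Rightarrow> 'b \<Rightarrow> 'a set" and q :: "nat \<Rightarrow> 'b \<Rightarrow> real"
  assumes fin: "\<And>k. finite (J k)" and D: "\<And>k b. b \<in> J k \<Longrightarrow> D k b \<in> events"
    and q0: "\<And>k b. b \<in> J k \<Longrightarrow> q k b \<ge> 0" and q1: "\<And>k. (\<Sum>b\<in>J k. q k b) \<le> 1"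
  shows "AE x in M. eventually (\<lambda>k. \<forall>b\<in>J k. x \<in> D k b \<longrightarrow> q k b / (real (Suc k))\<^sup>2 \<le> prob (D k b)) sequentially"
proof -
  define B where "B k = {b \<in> J k. prob (D k b) < q k b / (real (Suc k))\<^sup>2}" for k
  define A where "A k = (\<Union>b\<in>B k. D k b)" for k
  have B: "finite (B k)" "B k \<subseteq> J k" for k using fin[of k] by (auto simp: B_def)
  have A: "A k \<in> events" for k unfolding A_def using B[of k] D by (intro sets.finite_UN) auto
  have pA: "norm (prob (A k)) \<le> inverse ((real (Suc k))\<^sup>2)" for k
  proof -
    have "prob (A k) \<le> (\<Sum>b\<in>B k. prob (D k b))"
      unfolding A_def using B[of k] D by (intro finite_measure_subadditive_finite) auto
    also have "\<dots> \<le> (\<Sum>b\<in>B k. q k b / (real (Suc k))\<^sup>2)" by (intro sum_mono) (auto simp: B_def)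
    also have "\<dots> \<le> (\<Sum>b\<in>J k. q k b / (real (Suc k))\<^sup>2)" using B[of k] fin q0 by (intro sum_mono2) auto
    also have "\<dots> = (\<Sum>b\<in>J k. q k b) / (real (Suc k))\<^sup>2" by (simp add: sum_divide_distrib)
    also have "\<dots> \<le> 1 / (real (Suc k))\<^sup>2" using q1 by (intro divide_right_mono) auto
    finally show ?thesis by (simp only: inverse_eq_divide real_norm_def abs_of_nonneg measure_nonneg)
  qed
  have "summable (\<lambda>n. inverse ((real n)\<^sup>2))"
    using inverse_power_summable[of 2, where ?'a = real] by simp
  then have "summable (\<lambda>k. inverse ((real (Suc k))\<^sup>2))"
    by (subst summable_Suc_iff[of "\<lambda>n. inverse ((real n)\<^sup>2)"])
  then have "summable (\<lambda>k. prob (A k))" by (rule summable_comparison_test'[where N = 0]) (rule pA)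
  then have "AE x in M. eventually (\<lambda>k. x \<in> space M - A k) sequentially"
    using A by (intro borel_cantelli_AE1) (auto simp: less_top[symmetric])
  then show ?thesis
  proof eventually_elim
    case (elim x)
    then show ?case by eventually_elim (auto simp: A_def B_def not_less)
  qed
qed

section \<open>Lower bounds for ball masses from covers\<close>

context self_affine_system
begin

abbreviation ball_mass :: "('m list \<Rightarrow> real^'n) \<Rightarrow> (nat \<Rightarrow> 'm) \<Rightarrow> real \<Rightarrow> real" where
  "ball_mass \<omega> x r \<equiv> measure (projected_measure T \<mu> \<omega>) (cball (code_point T \<omega> x) r)"

text \<open>Packages the sequence hypotheses of \<open>log_quotient_tendsto\<close>: radii of rate
  \<open>\<gamma>\<close> and lower bounds \<open>h\<close> for the logarithmic ball masses of rate
  \<open>d * \<gamma>\<close>. It gives the two cases of the dimension formula a common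
  form.\<close>

definition mass_certificate :: "('m list \<Rightarrow> real^'n) \<Rightarrow> real \<Rightarrow> real \<Rightarrow> (nat \<Rightarrow> 'm) \<Rightarrow> bool" where
  "mass_certificate \<omega> d \<gamma> x \<longleftrightarrow> (\<exists>r h. (\<forall>k. r k > 0) \<and> (\<lambda>k. ln (r k) / real k) \<longlonglongrightarrow> \<gamma> \<and>
     (\<lambda>k. h k / real k) \<longlonglongrightarrow> d * \<gamma> \<and>
     eventually (\<lambda>k. ball_mass \<omega> x (r k) > 0 \<and> h k \<le> ln (ball_mass \<omega> x (r k))) sequentially)"

lemma dist_sets: "{y. dist c (code_point T \<omega> y) \<le> r} \<in> sets \<mu>"
proof -
  have "{y \<in> space \<mu>. dist c (code_point T \<omega> y) \<le> r} \<in> sets \<mu>" by measurable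
  then show ?thesis by simp
qed

text \<open>Cells lie in balls with centres unrelated to \<open>x\<close>; doubling the radius
  recentres such a ball at the point coded by \<open>x\<close>.\<close>

lemma ball_mass_ge:
  assumes "D \<subseteq> {y. dist c (code_point T \<omega> y) \<le> r}" "x \<in> D" "D \<in> sets \<mu>"
  shows "measure \<mu> D \<le> ball_mass \<omega> x (2 * r)"
  unfolding measure_projected_cball
proof (rule finite_measure_mono)
  show "D \<subseteq> {y. dist (code_point T \<omega> x) (code_point T \<omega> y) \<le> 2 * r}"
  proof
    fix y assume "y \<in> D"
    then have "dist c (code_point T \<omega> y) \<le> r" "dist c (code_point T \<omega> x) \<le> r" using assms by auto
    then show "y \<in> {y. dist (code_point T \<omega> x) (code_point T \<omega> y) \<le> 2 * r}"
      using dist_triangle3[of "code_point T \<omega> x" "code_point T \<omega> y" c] by simp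
  qed
qed (rule dist_sets)

lemma ln_Suc_over_n: "(\<lambda>k. 2 * ln (real (Suc k)) / real k) \<longlonglongrightarrow> 0"
  by real_asymp

text \<open>Cells are cylinders intersected with preimages of covering balls. Almost surely the mass
  of the cell containing \<open>x\<close> is subexponentially close from below to the mean
  \<mu>(C_w) / card (Z w), and the cover estimate makes this at least \<mu>(C_w) \<alpha>_l^s /
  \<phi>^s up to a constant.\<close>

lemma AE_mass_certificate_critical:
  assumes \<omega>: "\<forall>w. w \<noteq> [] \<longrightarrow> norm (\<omega> w) \<le> D" and s: "0 < s" "s \<le> real CARD('n)"
    and crit: "lyapunov s = log_weight_rate"
  shows "\<exists>\<gamma><0. AE x in \<mu>. mass_certificate \<omega> s \<gamma> x"
proof -
  obtain l where l: "1 \<le> l" "l \<le> CARD('n)" "real l - 1 \<le> s" "s \<le> real l" using ceiling_level[OF s] .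
  have l': "l - 1 < CARD('n)" using l by linarith
  define \<alpha> where "\<alpha> w = wm.\<alpha> w (l - 1)" for w
  have \<alpha>: "\<alpha> w > 0" for w unfolding \<alpha>_def by (rule wm.sv_pos[OF l'])
  have "\<exists>Z. finite Z \<and> Z \<noteq> {} \<and> word_map T w ` cball 0 1 \<subseteq> (\<Union>z\<in>Z. cball z (real CARD('n) * \<alpha> w)) \<and>
      real (card Z) * \<alpha> w powr s \<le> 4 ^ CARD('n) * \<phi> s w" for w
    using wm.svf_cover[OF l, of w] unfolding \<alpha>_def by metis
  then obtain Z where Z: "\<And>w. finite (Z w)" "\<And>w. Z w \<noteq> {}"
    "\<And>w. word_map T w ` cball 0 1 \<subseteq> (\<Union>z\<in>Z w. cball z (real CARD('n) * \<alpha> w))"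
    "\<And>w. real (card (Z w)) * \<alpha> w powr s \<le> 4 ^ CARD('n) * \<phi> s w" by metis
  obtain R where R: "R > 0" "\<And>x n. \<exists>y. norm y \<le> R \<and>
       code_point T \<omega> x = base_point \<omega> (code_prefix x n) + word_map T (code_prefix x n) y"
    using code_point_decomposition[of D] \<omega> by metis
  define M where "M = R * real CARD('n)"
  have M: "M > 0" using R by (simp add: M_def)
  define C where "C b = {y. dist (base_point \<omega> (fst b) + R *\<^sub>R snd b) (code_point T \<omega> y) \<le> M * \<alpha> (fst b)}" for b
  define J where "J k = Sigma {w. length w = k} Z" for k
  \<comment> \<open>The mean mass of a cell within its cylinder, so the shares at each level sum to
    1.\<close>
  define q where "q b = weight (fst b) / real (card (Z (fst b)))" for b :: "'m list \<times> (real^'n)"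
  have card: "real (card (Z w)) > 0" for w using Z(1,2)[of w] by (simp add: card_gt_0_iff)
  have "AE x in \<mu>. eventually (\<lambda>k. \<forall>b\<in>J k. x \<in> cylinder (fst b) \<inter> C b \<longrightarrow>
      q b / (real (Suc k))\<^sup>2 \<le> measure \<mu> (cylinder (fst b) \<inter> C b)) sequentially"
  proof (rule AE_large_cells)
    show "finite (J k)" for k using Z(1) by (auto simp: J_def finite_words)
    show "cylinder (fst b) \<inter> C b \<in> sets \<mu>" for b unfolding C_def using dist_sets by (intro sets.Int) auto
    show "q b \<ge> 0" for b by (simp add: q_def weight_nonneg)
    show "(\<Sum>b\<in>J k. q b) \<le> 1" for k
    proof -
      have "(\<Sum>b\<in>J k. q b) = (\<Sum>w | length w = k. \<Sum>z\<in>Z w. weight w / real (card (Z w)))"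
        unfolding J_def q_def using Z(1) by (subst sum.Sigma) (auto simp: finite_words case_prod_beta)
      also have "\<dots> = (\<Sum>w | length w = k. weight w)"
        using card by (intro sum.cong) (auto simp: less_imp_neq[symmetric])
      finally show ?thesis by (simp add: sum_weight)
    qed
  qed
  \<comment> \<open>The almost sure rate of \<alpha>_l, hence of the covering radii.\<close>
  moreover define \<gamma> where "\<gamma> = lyapunov (real l) - lyapunov (real (l - 1))"
  have "\<gamma> < 0" using lyapunov_strict_antimono[of "real (l - 1)" "real l"] l by (simp add: \<gamma>_def)
  moreover have "0 \<le> real l" "0 \<le> real (l - 1)" "0 \<le> s" using s by auto
  note lyap = this[THEN AE_lyapunov]
  have "AE x in \<mu>. mass_certificate \<omega> s \<gamma> x"
    using calculation(1) lyap AE_log_weight_rate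
  proof eventually_elim
    case (elim x)
    let ?w = "\<lambda>k. code_prefix x k"
    define r where "r k = 2 * (M * \<alpha> (?w k))" for k
    define h where "h k = ln (weight (?w k)) - ln (\<phi> s (?w k)) + s * ln (\<alpha> (?w k)) - real CARD('n) * ln 4 - 2 * ln (real (Suc k))" for k
    have ln_\<alpha>: "ln (\<alpha> w) = ln (\<phi> (real l) w) - ln (\<phi> (real (l - 1)) w)" for w
      unfolding \<alpha>_def by (rule wm.ln_sv_eq_ln_svf_diff[OF l(1,2)])
    have lim_\<alpha>: "(\<lambda>k. ln (\<alpha> (?w k)) / real k) \<longlonglongrightarrow> \<gamma>"
      unfolding ln_\<alpha> diff_divide_distrib \<gamma>_def by (intro tendsto_diff elim)
    have const: "(\<lambda>k. c / real k) \<longlonglongrightarrow> 0" for c :: real by (rule lim_const_over_n)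
    have "(\<lambda>k. ln (2 * M) / real k + ln (\<alpha> (?w k)) / real k) \<longlonglongrightarrow> 0 + \<gamma>"
      by (intro tendsto_add const lim_\<alpha>)
    moreover have "ln (r k) = ln (2 * M) + ln (\<alpha> (?w k))" for k
      using ln_mult_pos[of "2 * M" "\<alpha> (?w k)"] M \<alpha> by (simp add: r_def mult.assoc)
    ultimately have r_lim: "(\<lambda>k. ln (r k) / real k) \<longlonglongrightarrow> \<gamma>"
      by (simp only: add_divide_distrib add_0_left)
    \<comment> \<open>Criticality makes the rates of weight and \<phi>^s cancel, so only
      \<open>s\<close> times the rate of the radii survives.\<close>
    have "(\<lambda>k. ln (weight (?w k)) / real k - ln (\<phi> s (?w k)) / real k + s * (ln (\<alpha> (?w k)) / real k)
        - real CARD('n) * ln 4 / real k - 2 * ln (real (Suc k)) / real k)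
        \<longlonglongrightarrow> log_weight_rate - lyapunov s + s * \<gamma> - 0 - 0"
      by (intro tendsto_diff tendsto_add tendsto_mult tendsto_const const lim_\<alpha> ln_Suc_over_n elim)
    then have h_lim: "(\<lambda>k. h k / real k) \<longlonglongrightarrow> s * \<gamma>"
      by (simp add: h_def crit add_divide_distrib diff_divide_distrib)
    have "eventually (\<lambda>k. ball_mass \<omega> x (r k) > 0 \<and> h k \<le> ln (ball_mass \<omega> x (r k))) sequentially"
      using elim(1)
    proof eventually_elim
      case (elim k)
      define w where "w = ?w k"
      obtain y where y: "norm y \<le> R" "code_point T \<omega> x = base_point \<omega> w + word_map T w y"
        using R(2)[of x k] by (auto simp: w_def)
      have "y /\<^sub>R R \<in> cball 0 1" using y(1) R(1) by (simp add: inverse_eq_divide pos_divide_le_eq)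
      from subsetD[OF Z(3) imageI[OF this], of w]
      obtain z where z: "z \<in> Z w" "dist z (word_map T w (y /\<^sub>R R)) \<le> real CARD('n) * \<alpha> w" by auto
      have "word_map T w y = R *\<^sub>R word_map T w (y /\<^sub>R R)"
        using R(1) by (simp add: linear_cmul[OF linear_word_map])
      then have "base_point \<omega> w + R *\<^sub>R z - code_point T \<omega> x = R *\<^sub>R (z - word_map T w (y /\<^sub>R R))"
        by (simp only: y(2) scaleR_diff_right add_diff_cancel_left)
      then have "dist (base_point \<omega> w + R *\<^sub>R z) (code_point T \<omega> x) = R * dist z (word_map T w (y /\<^sub>R R))"
        using R(1) by (simp only: dist_norm norm_scaleR abs_of_pos)
      also have "\<dots> \<le> M * \<alpha> w" using z(2) R(1) by (simp add: M_def)
      finally have xC: "x \<in> cylinder w \<inter> C (w, z)" by (simp add: C_def w_def mem_cylinder_iff)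
      have "(w, z) \<in> J k" using z(1) by (simp add: J_def w_def)
      with elim xC have "q (w, z) / (real (Suc k))\<^sup>2 \<le> measure \<mu> (cylinder w \<inter> C (w, z))" by fastforce
      also have "\<dots> \<le> ball_mass \<omega> x (2 * (M * \<alpha> w))"
      proof (rule ball_mass_ge)
        show "cylinder w \<inter> C (w, z) \<subseteq> {y. dist (base_point \<omega> w + R *\<^sub>R z) (code_point T \<omega> y) \<le> M * \<alpha> w}"
          by (auto simp: C_def)
        show "cylinder w \<inter> C (w, z) \<in> sets \<mu>" unfolding C_def using dist_sets by (intro sets.Int) auto
      qed (rule xC)
      finally have mass: "q (w, z) / (real (Suc k))\<^sup>2 \<le> ball_mass \<omega> x (r k)" by (simp add: r_def w_def)
      have pos: "q (w, z) > 0" using card[of w] weight_pos[of w] by (simp add: q_def)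
      have "ln (card (Z w)) + s * ln (\<alpha> w) \<le> real CARD('n) * ln 4 + ln (\<phi> s w)"
      proof -
        have "ln (real (card (Z w)) * \<alpha> w powr s) \<le> ln (4 ^ CARD('n) * \<phi> s w)"
          using Z(4)[of w] card[of w] \<alpha>[of w] wm.svf_pos[of s w] s by simp
        then show ?thesis using card[of w] \<alpha>[of w] wm.svf_pos[of s w] s
          by (simp add: ln_mult ln_powr ln_realpow)
      qed
      moreover have "ln (q (w, z)) = ln (weight w) - ln (card (Z w))"
        using card[of w] weight_pos[of w] by (simp add: q_def ln_div)
      moreover have "ln (q (w, z) / (real (Suc k))\<^sup>2) = ln (q (w, z)) - 2 * ln (real (Suc k))"
        using pos by (simp add: ln_div ln_realpow)
      ultimately have "h k \<le> ln (q (w, z) / (real (Suc k))\<^sup>2)" by (simp add: h_def w_def)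
      also have "\<dots> \<le> ln (ball_mass \<omega> x (r k))" using mass pos
        by (subst ln_le_cancel_iff) (auto intro: less_le_trans[OF _ mass])
      finally show ?case using mass pos by (auto intro: less_le_trans[OF _ mass])
    qed
    then show ?case unfolding mass_certificate_def
      using r_lim h_lim M \<alpha> by (intro exI[of _ r] exI[of _ h]) (auto simp: r_def)
  qed
  ultimately show ?thesis by blast
qed

text \<open>All projected points lie in one ball, which about 2^(kN) balls of radius proportional to
  2^(-k) cover. The cover lemma is applied to the identity, whose singular values are all 1.\<close>

lemma AE_mass_certificate_full:
  assumes \<omega>: "\<forall>w. w \<noteq> [] \<longrightarrow> norm (\<omega> w) \<le> D"
  shows "\<exists>\<gamma><0. AE x in \<mu>. mass_certificate \<omega> (real CARD('n)) \<gamma> x"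
proof -
  interpret I: nonsingular_map "id :: real^'n \<Rightarrow> real^'n"
    unfolding nonsingular_map_def by (intro conjI linear_id bij_id)
  have sv: "I.\<alpha> j = 1" if j: "j < CARD('n)" for j
  proof -
    obtain v :: "real^'n" where "norm v = 1" "norm (id v) = I.\<alpha> j" using I.sv_attained[OF j] .
    then show ?thesis by simp
  qed
  have "\<exists>Z :: (real^'n) set. finite Z \<and> Z \<noteq> {} \<and> cball 0 1 \<subseteq> (\<Union>z\<in>Z. cball z (real CARD('n) * (1 / 2) ^ k)) \<and>
      real (card Z) \<le> 4 ^ CARD('n) * (2 ^ k) ^ CARD('n)" for k
  proof -
    have p: "(1 / 2 :: real) ^ k > 0" by simp
    have prod_eq: "(\<Prod>j<CARD('n). max 1 (I.\<alpha> j / (1 / 2) ^ k)) = (\<Prod>j<CARD('n). 2 ^ k)"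
    proof (rule prod.cong)
      fix j assume "j \<in> {..<CARD('n)}"
      then have "I.\<alpha> j / (1 / 2) ^ k = 2 ^ k" by (simp add: sv power_one_over)
      then show "max 1 (I.\<alpha> j / (1 / 2) ^ k) = 2 ^ k" by (simp add: max_def)
    qed simp
    obtain Z :: "(real^'n) set" where "finite Z" "Z \<noteq> {}"
      "id ` cball 0 1 \<subseteq> (\<Union>z\<in>Z. cball z (real CARD('n) * (1 / 2) ^ k))"
      "real (card Z) \<le> 4 ^ CARD('n) * (\<Prod>j<CARD('n). max 1 (I.\<alpha> j / (1 / 2) ^ k))"
      using I.cover_image_unit_ball[OF p] .
    then show ?thesis unfolding prod_eq prod_constant card_lessThan image_id id_apply
      by (intro exI[of _ Z] conjI)
  qed
  then obtain Z :: "nat \<Rightarrow> (real^'n) set" where Z: "\<And>k. finite (Z k)" "\<And>k. Z k \<noteq> {}"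
    "\<And>k. cball 0 1 \<subseteq> (\<Union>z\<in>Z k. cball z (real CARD('n) * (1 / 2) ^ k))"
    "\<And>k. real (card (Z k)) \<le> 4 ^ CARD('n) * (2 ^ k) ^ CARD('n)" by metis
  obtain R where R: "R > 0" "\<And>x n. \<exists>y. norm y \<le> R \<and>
       code_point T \<omega> x = base_point \<omega> (code_prefix x n) + word_map T (code_prefix x n) y"
    using code_point_decomposition[of D] \<omega> by metis
  have norm_R: "norm (code_point T \<omega> x) \<le> R" for x using R(2)[of x 0] by (auto simp: base_point_def)
  define M where "M = R * real CARD('n)"
  have M: "M > 0" using R by (simp add: M_def)
  define C where "C k z = {y. dist (R *\<^sub>R z) (code_point T \<omega> y) \<le> M * (1 / 2) ^ k}" for k z
  have card: "real (card (Z k)) > 0" for k using Z(1,2)[of k] by (simp add: card_gt_0_iff)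
  have "AE x in \<mu>. eventually (\<lambda>k. \<forall>z\<in>Z k. x \<in> C k z \<longrightarrow>
      1 / real (card (Z k)) / (real (Suc k))\<^sup>2 \<le> measure \<mu> (C k z)) sequentially"
    by (rule AE_large_cells) (use Z(1,2) card dist_sets in \<open>auto simp: C_def\<close>)
  then have "AE x in \<mu>. mass_certificate \<omega> (real CARD('n)) (- ln 2) x"
  proof eventually_elim
    case (elim x)
    define r where "r k = 2 * (M * (1 / 2) ^ k)" for k
    define h where "h k = - (real CARD('n) * ln 4) - real k * (real CARD('n) * ln 2) - 2 * ln (real (Suc k))" for k
    have const: "(\<lambda>k. c / real k) \<longlonglongrightarrow> 0" for c :: real by (rule lim_const_over_n)
    have pos: "eventually (\<lambda>k. k > 0) sequentially" by (rule eventually_gt_at_top)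
    have "(\<lambda>k. ln (2 * M) / real k - ln 2) \<longlonglongrightarrow> 0 - ln 2" by (intro tendsto_diff const tendsto_const)
    moreover have "eventually (\<lambda>k. ln (2 * M) / real k - ln 2 = ln (r k) / real k) sequentially"
      using pos
    proof eventually_elim
      case (elim k)
      have "ln (r k) = ln (2 * M) - real k * ln 2"
        using M by (simp add: r_def ln_mult ln_realpow ln_div)
      then show ?case using elim by (simp add: diff_divide_distrib)
    qed
    ultimately have r_lim: "(\<lambda>k. ln (r k) / real k) \<longlonglongrightarrow> - ln 2" by (simp add: Lim_transform_eventually)
    have "(\<lambda>k. - (real CARD('n) * ln 4) / real k - real CARD('n) * ln 2 - 2 * ln (real (Suc k)) / real k) \<longlonglongrightarrow> 0 - real CARD('n) * ln 2 - 0"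
      by (intro tendsto_diff const tendsto_const ln_Suc_over_n)
    moreover have "eventually (\<lambda>k. - (real CARD('n) * ln 4) / real k - real CARD('n) * ln 2 - 2 * ln (real (Suc k)) / real k = h k / real k) sequentially"
      using pos by eventually_elim (simp add: h_def diff_divide_distrib)
    ultimately have h_lim: "(\<lambda>k. h k / real k) \<longlonglongrightarrow> real CARD('n) * (- ln 2)"
      by (simp add: Lim_transform_eventually)
    have "eventually (\<lambda>k. ball_mass \<omega> x (r k) > 0 \<and> h k \<le> ln (ball_mass \<omega> x (r k))) sequentially"
      using elim
    proof eventually_elim
      case (elim k)
      have "code_point T \<omega> x /\<^sub>R R \<in> cball 0 1" using norm_R[of x] R(1)
        by (simp add: inverse_eq_divide pos_divide_le_eq)
      from subsetD[OF Z(3) this, of k]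
      obtain z where z: "z \<in> Z k" "dist z (code_point T \<omega> x /\<^sub>R R) \<le> real CARD('n) * (1 / 2) ^ k" by auto
      have "R *\<^sub>R z - code_point T \<omega> x = R *\<^sub>R (z - code_point T \<omega> x /\<^sub>R R)"
        using R(1) by (simp add: scaleR_diff_right)
      then have "dist (R *\<^sub>R z) (code_point T \<omega> x) = R * dist z (code_point T \<omega> x /\<^sub>R R)"
        using R(1) by (simp add: dist_norm)
      also have "\<dots> \<le> M * (1 / 2) ^ k" using z(2) R(1) by (simp add: M_def)
      finally have xC: "x \<in> C k z" by (simp add: C_def)
      then have "1 / real (card (Z k)) / (real (Suc k))\<^sup>2 \<le> measure \<mu> (C k z)" using elim z(1) by blast
      also have "\<dots> \<le> ball_mass \<omega> x (2 * (M * (1 / 2) ^ k))"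
        by (rule ball_mass_ge[OF _ xC]) (auto simp: C_def dist_sets)
      finally have mass: "1 / real (card (Z k)) / (real (Suc k))\<^sup>2 \<le> ball_mass \<omega> x (r k)" by (simp add: r_def)
      have p: "0 < 1 / real (card (Z k)) / (real (Suc k))\<^sup>2" using card[of k] by simp
      have "ln (real (card (Z k))) \<le> ln (4 ^ CARD('n) * (2 ^ k) ^ CARD('n))"
        using Z(4)[of k] card[of k] by (subst ln_le_cancel_iff) auto
      also have "\<dots> = real CARD('n) * ln 4 + real k * (real CARD('n) * ln 2)"
        by (simp add: ln_mult ln_realpow)
      finally have "h k \<le> ln (1 / real (card (Z k)) / (real (Suc k))\<^sup>2)"
        using card[of k] by (simp add: h_def ln_div ln_realpow ln_mult)
      also have "\<dots> \<le> ln (ball_mass \<omega> x (r k))" using mass p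
        by (subst ln_le_cancel_iff) (auto intro: less_le_trans[OF _ mass])
      finally show ?case using less_le_trans[OF p mass] by simp
    qed
    then show ?case unfolding mass_certificate_def
      using r_lim h_lim M by (intro exI[of _ r] exI[of _ h]) (auto simp: r_def)
  qed
  then show ?thesis by (intro exI[of _ "- ln 2"]) simp
qed

end

text \<open>Only countable quantifiers occur on the right, so convergence of measurable functions
  defines a measurable set.\<close>

lemma LIMSEQ_iff_Suc:
  fixes X :: "nat \<Rightarrow> real"
  shows "X \<longlonglongrightarrow> L \<longleftrightarrow> (\<forall>k. \<exists>m. \<forall>n\<ge>m. \<bar>X n - L\<bar> < 1 / real (Suc k))"
proof
  assume "X \<longlonglongrightarrow> L"
  then show "\<forall>k. \<exists>m. \<forall>n\<ge>m. \<bar>X n - L\<bar> < 1 / real (Suc k)" by (simp add: LIMSEQ_iff)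
next
  assume *: "\<forall>k. \<exists>m. \<forall>n\<ge>m. \<bar>X n - L\<bar> < 1 / real (Suc k)"
  show "X \<longlonglongrightarrow> L"
  proof (rule LIMSEQ_I)
    fix e :: real assume "e > 0"
    then obtain k where k: "1 / real (Suc k) < e" by (metis nat_approx_posE)
    obtain m where m: "\<And>n. n \<ge> m \<Longrightarrow> \<bar>X n - L\<bar> < 1 / real (Suc k)" using * by blast
    have "norm (X n - L) < e" if "n \<ge> m" for n using m[OF that] k unfolding real_norm_def by linarith
    then show "\<exists>m. \<forall>n\<ge>m. norm (X n - L) < e" by blast
  qed
qed

section \<open>Local dimension along codes, transfer to points, and the conclusion\<close>

context self_affine_system
begin

abbreviation dimension :: real where
  "dimension \<equiv> min (critical_exponent T \<mu>) (real CARD('n))"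

lemma dimension_pos: "dimension > 0"
  using critical_exponent_pos by simp

lemma AE_mass_certificate:
  assumes \<omega>: "\<forall>w. w \<noteq> [] \<longrightarrow> norm (\<omega> w) \<le> D"
  shows "\<exists>\<gamma><0. AE x in \<mu>. mass_certificate \<omega> dimension \<gamma> x"
proof (cases "critical_exponent T \<mu> \<le> real CARD('n)")
  case True
  then show ?thesis
    using AE_mass_certificate_critical[OF \<omega> critical_exponent_pos True lyapunov_critical_exponent]
    by (simp add: min_def)
next
  case False
  then show ?thesis using AE_mass_certificate_full[OF \<omega>] by (simp add: min_def)
qed

lemma sets_projected_measure [simp]: "sets (projected_measure T \<mu> \<omega>) = sets borel"
  by (simp add: projected_measure_def)

lemma prob_space_projected_measure: "prob_space (projected_measure T \<mu> \<omega>)"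
  unfolding projected_measure_def by (rule prob_space_distr) measurable

text \<open>Finite potentials bound ball masses from above at all radii, certificates from below
  along a sequence. A countable choice of exponents keeps the exceptional set null.\<close>

lemma AE_local_dimension:
  assumes \<omega>: "\<forall>w. w \<noteq> [] \<longrightarrow> norm (\<omega> w) \<le> D"
    and pot: "\<And>\<epsilon>. \<epsilon> > 0 \<Longrightarrow> \<exists>s. 0 \<le> s \<and> dimension - \<epsilon> < s \<and> (AE x in \<mu>. potential s \<omega> x < \<infinity>)"
  shows "AE x in \<mu>. (\<forall>\<rho>>0. ball_mass \<omega> x \<rho> > 0) \<and>
    ((\<lambda>\<rho>. ln (ball_mass \<omega> x \<rho>) / ln \<rho>) \<longlongrightarrow> dimension) (at_right 0)"
proof -
  interpret \<nu>: prob_space "projected_measure T \<mu> \<omega>" by (rule prob_space_projected_measure)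
  have "\<exists>s. \<forall>j. 0 \<le> s j \<and> dimension - 1 / real (Suc j) < s j \<and> (AE x in \<mu>. potential (s j) \<omega> x < \<infinity>)"
    by (intro choice allI pot) simp
  then obtain s where s: "\<And>j. 0 \<le> s j" "\<And>j. dimension - 1 / real (Suc j) < s j"
    "\<And>j. AE x in \<mu>. potential (s j) \<omega> x < \<infinity>" by blast
  obtain \<gamma> where \<gamma>: "\<gamma> < 0" "AE x in \<mu>. mass_certificate \<omega> dimension \<gamma> x"
    using AE_mass_certificate[OF \<omega>] by (elim exE conjE) (rule that)
  have "AE x in \<mu>. \<forall>j. potential (s j) \<omega> x < \<infinity>"     by (subst AE_all_countable) (intro allI s(3))
  with \<gamma>(2) show ?thesis
  proof eventually_elim
    case (elim x)
    have pot_x: "potential (s j) \<omega> x < \<infinity>" for j using elim(2) by blast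
    obtain r h where rh: "\<And>k. r k > 0" "(\<lambda>k. ln (r k) / real k) \<longlonglongrightarrow> \<gamma>"
      "(\<lambda>k. h k / real k) \<longlonglongrightarrow> dimension * \<gamma>"
      "eventually (\<lambda>k. ball_mass \<omega> x (r k) > 0 \<and> h k \<le> ln (ball_mass \<omega> x (r k))) sequentially"
      using elim(1) unfolding mass_certificate_def by blast
    have mono: "ball_mass \<omega> x \<rho> \<le> ball_mass \<omega> x \<rho>'" if "\<rho> \<le> \<rho>'" for \<rho> \<rho>'
      using that by (intro \<nu>.finite_measure_mono) auto
    have upper: "eventually (\<lambda>\<rho>. ball_mass \<omega> x \<rho> > 0 \<longrightarrow> ln (ball_mass \<omega> x \<rho>) \<le> (dimension - \<epsilon>) * ln \<rho>) (at_right 0)"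
      if \<epsilon>: "\<epsilon> > 0" for \<epsilon>
    proof -
      obtain j where j: "1 / real (Suc j) < \<epsilon> / 2" using \<epsilon> by (metis half_gt_zero nat_approx_posE)
      \<comment> \<open>The surplus exponent: for small \<open>\<rho>\<close> the factor
        \<open>\<rho> powr c\<close> absorbs the constant \<open>M\<close>.\<close>
      define c where "c = s j - (dimension - \<epsilon>)"
      have c: "c > 0" using s(2)[of j] j \<epsilon> unfolding c_def by linarith
      define M where "M = enn2real (potential (s j) \<omega> x) + 1"
      have M: "M > 0" by (simp add: M_def add_nonneg_pos)
      show ?thesis
        using eventually_ln_less[of "- ln M / c"] eventually_less_1_at_right
      proof eventually_elim
        case (elim \<rho>)
        show ?case
        proof
          assume pos: "ball_mass \<omega> x \<rho> > 0"
          have "ball_mass \<omega> x \<rho> \<le> enn2real (potential (s j) \<omega> x) * \<rho> powr s j"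
            using pot_x elim(2) s(1) by (intro measure_cball_le_potential) auto
          also have "\<dots> \<le> M * \<rho> powr s j" unfolding M_def by (intro mult_right_mono) auto
          finally have "ln (ball_mass \<omega> x \<rho>) \<le> ln (M * \<rho> powr s j)" using pos by simp
          also have "\<dots> = ln M + s j * ln \<rho>" using M elim(2) by (simp add: ln_mult_pos ln_powr)
          also have "\<dots> = ln M + c * ln \<rho> + (dimension - \<epsilon>) * ln \<rho>" by (simp add: c_def algebra_simps)
          also have "c * ln \<rho> < - ln M" using elim(1) c by (subst (asm) pos_less_divide_eq) (auto simp: mult.commute)
          finally show "ln (ball_mass \<omega> x \<rho>) \<le> (dimension - \<epsilon>) * ln \<rho>" by simp
        qed
      qed
    qed
    note * = log_quotient_tendsto[of "ball_mass \<omega> x" dimension r \<gamma> h, OF mono less_imp_le[OF dimension_pos] rh(1,2) \<gamma>(1) rh(3,4) upper]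
    show ?case using *(1) *(2) by blast
  qed
qed

text \<open>The dyadic version of the local dimension is a Borel condition \<open>Q\<close> on the
  point, so it passes from almost all codes to almost all points of the image measure; then all
  radii are restored.\<close>

lemma projected_measure_dimensions:
  assumes \<omega>: "\<forall>w. w \<noteq> [] \<longrightarrow> norm (\<omega> w) \<le> D"
    and pot: "\<And>\<epsilon>. \<epsilon> > 0 \<Longrightarrow> \<exists>s. 0 \<le> s \<and> dimension - \<epsilon> < s \<and> (AE x in \<mu>. potential s \<omega> x < \<infinity>)"
  shows "exact_dimensional (projected_measure T \<mu> \<omega>) dimension \<and>
    has_information_dimension (projected_measure T \<mu> \<omega>) dimension"
proof -
  let ?\<nu> = "projected_measure T \<mu> \<omega>"
  interpret \<nu>: prob_space ?\<nu> by (rule prob_space_projected_measure)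
  let ?r = "\<lambda>n. (1 / 2 :: real) ^ n"
  define Q where "Q c \<longleftrightarrow> (\<forall>n. measure ?\<nu> (cball c (?r n)) > 0) \<and>
    (\<lambda>n. ln (measure ?\<nu> (cball c (?r n))) / ln (?r n)) \<longlonglongrightarrow> dimension" for c
  have r: "filterlim ?r (at_right 0) sequentially"
    unfolding filterlim_at by (auto intro!: LIMSEQ_power_zero)
  have [measurable]: "(\<lambda>c. measure ?\<nu> (cball c \<rho>)) \<in> borel_measurable borel" for \<rho>
    by (rule measurable_measure_cball[OF \<nu>.finite_measure_axioms]) simp
  have Q_iff: "Q c \<longleftrightarrow> (\<forall>n. measure ?\<nu> (cball c (?r n)) > 0) \<and>
      (\<forall>k. \<exists>m. \<forall>n\<ge>m. \<bar>ln (measure ?\<nu> (cball c (?r n))) / ln (?r n) - dimension\<bar> < 1 / real (Suc k))" for c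
    unfolding Q_def LIMSEQ_iff_Suc ..
  have Q_sets: "{c \<in> space borel. Q c} \<in> sets borel" unfolding Q_iff by measurable
  have "AE x in \<mu>. (\<forall>\<rho>>0. ball_mass \<omega> x \<rho> > 0) \<and>
      ((\<lambda>\<rho>. ln (ball_mass \<omega> x \<rho>) / ln \<rho>) \<longlongrightarrow> dimension) (at_right 0)"
    by (rule AE_local_dimension[OF \<omega>]) (rule pot)
  then have "AE x in \<mu>. Q (code_point T \<omega> x)"
  proof eventually_elim
    case (elim x)
    then have "((\<lambda>\<rho>. ln (ball_mass \<omega> x \<rho>) / ln \<rho>) \<longlongrightarrow> dimension) (at_right 0)" by blast
    from filterlim_compose[OF this r] elim show ?case by (simp add: Q_def)
  qed
  then have "AE c in ?\<nu>. Q c"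
    unfolding projected_measure_def using Q_sets by (subst AE_distr_iff) auto
  then have local: "AE c in ?\<nu>. (\<forall>\<rho>>0. measure ?\<nu> (cball c \<rho>) > 0) \<and>
      ((\<lambda>\<rho>. ln (measure ?\<nu> (cball c \<rho>)) / ln \<rho>) \<longlongrightarrow> dimension) (at_right 0)"
  proof eventually_elim
    case (elim c)
    have mono: "measure ?\<nu> (cball c \<rho>) \<le> measure ?\<nu> (cball c \<rho>')" if "\<rho> \<le> \<rho>'" for \<rho> \<rho>'
      using that by (intro \<nu>.finite_measure_mono) auto
    note * = log_quotient_tendsto_of_dyadic[of "\<lambda>\<rho>. measure ?\<nu> (cball c \<rho>)", OF mono \<nu>.prob_le_1 less_imp_le[OF dimension_pos]]
    show ?case using *(1) *(2) elim unfolding Q_def by blast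
  qed
  obtain R where R: "R > 0" "\<And>x n. \<exists>y. norm y \<le> R \<and>
       code_point T \<omega> x = base_point \<omega> (code_prefix x n) + word_map T (code_prefix x n) y"
    using code_point_decomposition[of D] \<omega> by metis
  have norm_R: "norm (code_point T \<omega> x) \<le> R" for x using R(2)[of x 0] by (auto simp: base_point_def)
  interpret b: bounded_prob ?\<nu> R
  proof
    have "measure ?\<nu> (cball 0 R) = measure \<mu> (space \<mu>)"
      using norm_R by (simp add: measure_projected_cball)
    then show "measure ?\<nu> (cball 0 R) = 1" by (simp only: prob_space)
  qed simp
  have "has_information_dimension ?\<nu> dimension"
    by (rule b.has_information_dimension_of_local_dimension[OF _ local]) simp
  moreover have "exact_dimensional ?\<nu> dimension"
    unfolding exact_dimensional_def using \<nu>.prob_space_axioms local by (auto elim: AE_mp)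
  ultimately show ?thesis by blast
qed

end

theorem theorem5p3:
  fixes T :: "'m::finite \<Rightarrow> real^'n \<Rightarrow> real^'n"
    and p :: "'m \<Rightarrow> real"
    and \<mu> :: "(nat \<Rightarrow> 'm) measure"
    and \<Omega> :: "('m list \<Rightarrow> real^'n) set"
    and P :: "('m list \<Rightarrow> real^'n) measure"
    and B :: "(real^'n) set"
  defines "d\<^sub>1 \<equiv> critical_exponent T \<mu>"
  assumes m_ge_2: "CARD('m) \<ge> 2"
    and contraction: "\<And>i. linear_contraction (T i)"
    and nonsingular: "\<And>i. bij (T i)"
    and p_pos: "\<And>i. p i > 0"
    and p_sum: "(\<Sum>i\<in>UNIV. p i) = 1"
    and mu: "bernoulli_measure p \<mu>"
    and B_compact: "compact B" and B_nonempty: "B \<noteq> {}"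
    and B_invariant: "\<And>\<omega> w. \<omega> \<in> \<Omega> \<Longrightarrow> w \<noteq> [] \<Longrightarrow> (\<lambda>z. T (last w) z + \<omega> w) ` B \<subseteq> B"
    and P_prob: "prob_space P" and P_space: "space P = \<Omega>"
    and P_measurable: "(\<lambda>\<omega>. \<omega>) \<in> measurable P (\<Pi>\<^sub>M w\<in>UNIV. borel)"
    and energy: "\<And>\<epsilon>. \<epsilon> > 0 \<Longrightarrow>
      \<exists>s. 0 \<le> s \<and> min d\<^sub>1 (real CARD('n)) - \<epsilon> < s \<and> s < min d\<^sub>1 (real CARD('n)) \<and>
        (\<exists>c::real. \<forall>x y. x \<noteq> y \<longrightarrow>
          (\<integral>\<^sup>+ \<omega>. norm_neg_power s (code_point T \<omega> x - code_point T \<omega> y) \<partial>P)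
            \<le> ennreal (c / singular_value_function s (word_map T (code_meet x y))))"
  shows "AE \<omega> in P.
    exact_dimensional (projected_measure T \<mu> \<omega>) (min d\<^sub>1 (real CARD('n))) \<and>
    has_information_dimension (projected_measure T \<mu> \<omega>) (min d\<^sub>1 (real CARD('n)))"
proof -
  interpret self_affine_system p \<mu> T
    using m_ge_2 contraction nonsingular p_pos p_sum mu by unfold_locales auto
  note energy = energy[unfolded d\<^sub>1_def]
  have meas: "(\<lambda>\<omega>. \<omega> w) \<in> borel_measurable P" for w
    using measurable_compose[OF P_measurable measurable_component_singleton[of w UNIV "\<lambda>_. borel"]] by simp
  \<comment> \<open>Countably many exponents approaching the dimension suffice and keep the
    exceptional set of \<open>\<omega>\<close> null.\<close>
  have "\<exists>s. \<forall>j. 0 \<le> s j \<and> dimension - 1 / real (Suc j) < s j \<and> s j < dimension \<and>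
      (\<exists>c::real. \<forall>x y. x \<noteq> y \<longrightarrow>
          (\<integral>\<^sup>+ \<omega>. norm_neg_power (s j) (code_point T \<omega> x - code_point T \<omega> y) \<partial>P)
            \<le> ennreal (c / \<phi> (s j) (code_meet x y)))"
    by (intro choice allI energy) simp
  then obtain s where s: "\<And>j. 0 \<le> s j" "\<And>j. dimension - 1 / real (Suc j) < s j" "\<And>j. s j < dimension"
    "\<And>j. \<exists>c::real. \<forall>x y. x \<noteq> y \<longrightarrow>
          (\<integral>\<^sup>+ \<omega>. norm_neg_power (s j) (code_point T \<omega> x - code_point T \<omega> y) \<partial>P)
            \<le> ennreal (c / \<phi> (s j) (code_meet x y))" by blast
  have "AE \<omega> in P. AE x in \<mu>. potential (s j) \<omega> x < \<infinity>" for j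
  proof -
    obtain c where c: "\<And>x y. x \<noteq> y \<Longrightarrow>
          (\<integral>\<^sup>+ \<omega>. norm_neg_power (s j) (code_point T \<omega> x - code_point T \<omega> y) \<partial>P)
            \<le> ennreal (c / \<phi> (s j) (code_meet x y))" using s(4) by blast
    \<comment> \<open>\<open>s j\<close> lies below the critical exponent, where
      \<open>lyapunov\<close> equals \<open>log_weight_rate\<close>, and \<open>lyapunov\<close> is
      strictly decreasing.\<close>
    have "log_weight_rate < lyapunov (s j)"
      using lyapunov_strict_antimono[of "s j" "critical_exponent T \<mu>"] s(1,3)[of j] lyapunov_critical_exponent by simp
    then show ?thesis by (rule AE_potential_finite[OF s(1) _ P_prob meas c])
  qed
  then have "AE \<omega> in P. \<forall>j. AE x in \<mu>. potential (s j) \<omega> x < \<infinity>"     by (subst AE_all_countable) (rule allI)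
  moreover have "AE \<omega> in P. \<omega> \<in> \<Omega>" using AE_space[of P] P_space by simp
  ultimately show ?thesis unfolding d\<^sub>1_def
  proof eventually_elim
    case (elim \<omega>)
    obtain z where z: "z \<in> B" using B_nonempty by blast
    obtain \<beta> where \<beta>: "\<And>v. v \<in> B \<Longrightarrow> norm v \<le> \<beta>"
      using compact_imp_bounded[OF B_compact] by (auto simp: bounded_iff)
    obtain a b :: real where ab: "0 < a" "a \<le> b" "b < 1"
      and upper: "\<And>w v. norm (word_map T w v) \<le> b ^ length w * norm v" using expansion_bounds by metis
    \<comment> \<open>A translation is the difference of a point of \<open>B\<close> and a
      contracted point of \<open>B\<close>, each of norm at most \<open>\<beta>\<close>. The bound
      is uniform over words, as the convergence of the series requires.\<close>
    have bound: "norm (\<omega> w) \<le> \<beta> + \<beta>" if w: "w \<noteq> []" for w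
    proof -
      have "T (last w) z + \<omega> w \<in> B" using B_invariant[OF elim(2) w] z by blast
      then have "norm (T (last w) z + \<omega> w) \<le> \<beta>" by (rule \<beta>)
      moreover have "norm (T (last w) z) \<le> \<beta>"
      proof -
        have "norm (T (last w) z) \<le> b * norm z" using upper[of "[last w]" z] by (simp add: word_map_Cons)
        also have "\<dots> \<le> 1 * norm z" using ab by (intro mult_right_mono) auto
        finally show ?thesis using \<beta>[OF z] by simp
      qed
      moreover have "norm (\<omega> w) \<le> norm (T (last w) z + \<omega> w) + norm (T (last w) z)"
        using norm_triangle_ineq4[of "T (last w) z + \<omega> w" "T (last w) z"] by simp
      ultimately show ?thesis by linarith
    qed
    show ?case
    proof (rule projected_measure_dimensions)
      show "\<forall>w. w \<noteq> [] \<longrightarrow> norm (\<omega> w) \<le> \<beta> + \<beta>" using bound by blast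
    next
      fix \<epsilon> :: real assume "\<epsilon> > 0"
      then obtain j where j: "1 / real (Suc j) < \<epsilon>" by (metis nat_approx_posE)
      have "dimension - \<epsilon> < s j" using s(2)[of j] j by linarith
      then show "\<exists>s. 0 \<le> s \<and> dimension - \<epsilon> < s \<and> (AE x in \<mu>. potential s \<omega> x < \<infinity>)"
        using s(1) elim(1) by blast
    qed
  qed
qed

end
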